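(* Let $M_\omega$ be the free monoid generated by a countably infinite set. Then the $M_\omega$-action topos $\mathbf{PSh}(M_\omega)$ has proper class many mutually non-equivalent quotient topoi.
   Context: $\mathbf{PSh}(M)$ is the category of presheaves of sets on the monoid $M$ viewed as a one-object category, i.e. the category of right $M$-sets. A geometric morphism $f$ is connected if its inverse image functor $f^*$ is fully faithful. A quotient topos of a topos $\mathcal{E}$ is a connected geometric morphism with domain $\mathcal{E}$; two quotient topoi $f\colon\mathcal{E}\to\mathcal{F}$ and $f'\colon\mathcal{E}\to\mathcal{F}'$ are equivalent if there is an equivalence of categories $e\colon\mathcal{F}\to\mathcal{F}'$ with $e\circ f\cong f'$. "Proper class many mutually non-equivalent quotient topoi" means that the equivalence classes of quotient topoi do not form a small set: no set of quotient topoi contains a representative of every equivalence class. *)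

theory Defs
  imports
    "HOL-Library.Equipollence"
    "HOL-Library.Countable_Set"
    "HOL-Library.FuncSet"
    "HOL-Algebra.Group"
begin

section \<open>Size\<close>

text \<open>
  HOL has no type of all sets. A type \<open>'u\<close> of inaccessible cardinality takes its place: subsets of
  \<open>'u\<close> are the classes, and a set over any type is small if it has fewer elements than \<open>'u\<close>
  (von Neumann's limitation of size). The clauses below are infinity, power set, and
  union with replacement.
\<close>

definition small :: "'u itself \<Rightarrow> 'a set \<Rightarrow> bool" where
  "small U X \<longleftrightarrow> X \<prec> (UNIV :: 'u set)"

definition inaccessible :: "'u itself \<Rightarrow> bool" where
  "inaccessible U \<longleftrightarrow>
     small U (UNIV :: nat set) \<and>
     (\<forall>X :: 'u set. small U X \<longrightarrow> small U (Pow X)) \<and>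
     (\<forall>(I :: 'u set) (A :: 'u \<Rightarrow> 'u set).
        small U I \<and> (\<forall>i\<in>I. small U (A i)) \<longrightarrow> small U (\<Union>i\<in>I. A i))"


section \<open>Categories, functors, natural transformations\<close>

text \<open>\<open>Comp C g f\<close> is the composite of \<open>g\<close> after \<open>f\<close>.\<close>

record ('o, 'a) cat =
  Obj :: "'o set"
  Arr :: "'a set"
  Dom :: "'a \<Rightarrow> 'o"
  Cod :: "'a \<Rightarrow> 'o"
  Ident :: "'o \<Rightarrow> 'a"
  Comp :: "'a \<Rightarrow> 'a \<Rightarrow> 'a"

definition Hom :: "('o, 'a) cat \<Rightarrow> 'o \<Rightarrow> 'o \<Rightarrow> 'a set" where
  "Hom C x y = {f \<in> Arr C. Dom C f = x \<and> Cod C f = y}"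

locale category =
  fixes C :: "('o, 'a) cat"
  assumes Dom_Obj: "f \<in> Arr C \<Longrightarrow> Dom C f \<in> Obj C"
    and Cod_Obj: "f \<in> Arr C \<Longrightarrow> Cod C f \<in> Obj C"
    and Ident_Hom: "x \<in> Obj C \<Longrightarrow> Ident C x \<in> Hom C x x"
    and Comp_Hom: "f \<in> Hom C x y \<Longrightarrow> g \<in> Hom C y z \<Longrightarrow> Comp C g f \<in> Hom C x z"
    and Comp_Ident: "f \<in> Hom C x y \<Longrightarrow> Comp C f (Ident C x) = f"
    and Ident_Comp: "f \<in> Hom C x y \<Longrightarrow> Comp C (Ident C y) f = f"
    and Comp_assoc: "f \<in> Hom C w x \<Longrightarrow> g \<in> Hom C x y \<Longrightarrow> h \<in> Hom C y z \<Longrightarrow>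
      Comp C h (Comp C g f) = Comp C (Comp C h g) f"

definition iso_arr :: "('o, 'a) cat \<Rightarrow> 'a \<Rightarrow> bool" where
  "iso_arr C f \<longleftrightarrow> f \<in> Arr C \<and>
     (\<exists>g \<in> Hom C (Cod C f) (Dom C f).
        Comp C g f = Ident C (Dom C f) \<and> Comp C f g = Ident C (Cod C f))"

record ('o1, 'a1, 'o2, 'a2) fctr =
  FObj :: "'o1 \<Rightarrow> 'o2"
  FArr :: "'a1 \<Rightarrow> 'a2"

definition is_functor ::
  "('o1, 'a1) cat \<Rightarrow> ('o2, 'a2) cat \<Rightarrow> ('o1, 'a1, 'o2, 'a2) fctr \<Rightarrow> bool" where
  "is_functor C D F \<longleftrightarrow>
     (\<forall>x\<in>Obj C. FObj F x \<in> Obj D) \<and>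
     (\<forall>f\<in>Arr C. FArr F f \<in> Hom D (FObj F (Dom C f)) (FObj F (Cod C f))) \<and>
     (\<forall>x\<in>Obj C. FArr F (Ident C x) = Ident D (FObj F x)) \<and>
     (\<forall>f\<in>Arr C. \<forall>g\<in>Arr C. Dom C g = Cod C f \<longrightarrow>
        FArr F (Comp C g f) = Comp D (FArr F g) (FArr F f))"

definition id_fctr :: "('o, 'a, 'o, 'a) fctr" where
  "id_fctr = \<lparr>FObj = id, FArr = id\<rparr>"

definition comp_fctr ::
  "('o2, 'a2, 'o3, 'a3) fctr \<Rightarrow> ('o1, 'a1, 'o2, 'a2) fctr \<Rightarrow> ('o1, 'a1, 'o3, 'a3) fctr" where
  "comp_fctr G F = \<lparr>FObj = FObj G \<circ> FObj F, FArr = FArr G \<circ> FArr F\<rparr>"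

definition fully_faithful ::
  "('o1, 'a1) cat \<Rightarrow> ('o2, 'a2) cat \<Rightarrow> ('o1, 'a1, 'o2, 'a2) fctr \<Rightarrow> bool" where
  "fully_faithful C D F \<longleftrightarrow>
     (\<forall>x\<in>Obj C. \<forall>y\<in>Obj C. bij_betw (FArr F) (Hom C x y) (Hom D (FObj F x) (FObj F y)))"

definition nat_trans ::
  "('o1, 'a1) cat \<Rightarrow> ('o2, 'a2) cat \<Rightarrow> ('o1, 'a1, 'o2, 'a2) fctr \<Rightarrow> ('o1, 'a1, 'o2, 'a2) fctr
    \<Rightarrow> ('o1 \<Rightarrow> 'a2) \<Rightarrow> bool" where
  "nat_trans C D F G \<eta> \<longleftrightarrow>
     (\<forall>x\<in>Obj C. \<eta> x \<in> Hom D (FObj F x) (FObj G x)) \<and>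
     (\<forall>f\<in>Arr C. Comp D (\<eta> (Cod C f)) (FArr F f) = Comp D (FArr G f) (\<eta> (Dom C f)))"

definition nat_isomorphic ::
  "('o1, 'a1) cat \<Rightarrow> ('o2, 'a2) cat \<Rightarrow> ('o1, 'a1, 'o2, 'a2) fctr \<Rightarrow> ('o1, 'a1, 'o2, 'a2) fctr
    \<Rightarrow> bool" where
  "nat_isomorphic C D F G \<longleftrightarrow>
     (\<exists>\<eta>. nat_trans C D F G \<eta> \<and> (\<forall>x\<in>Obj C. iso_arr D (\<eta> x)))"

text \<open>\<open>F\<close> and \<open>G\<close> are mutually pseudo-inverse.\<close>

definition equivalence ::
  "('o1, 'a1) cat \<Rightarrow> ('o2, 'a2) cat \<Rightarrow> ('o1, 'a1, 'o2, 'a2) fctr \<Rightarrow> ('o2, 'a2, 'o1, 'a1) fctr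
    \<Rightarrow> bool" where
  "equivalence C D F G \<longleftrightarrow>
     is_functor C D F \<and> is_functor D C G \<and>
     nat_isomorphic C C (comp_fctr G F) id_fctr \<and>
     nat_isomorphic D D (comp_fctr F G) id_fctr"

text \<open>\<open>L\<close> is left adjoint to \<open>R\<close>, by unit, counit and the triangle identities.\<close>

definition adjunction ::
  "('o1, 'a1) cat \<Rightarrow> ('o2, 'a2) cat \<Rightarrow> ('o1, 'a1, 'o2, 'a2) fctr \<Rightarrow> ('o2, 'a2, 'o1, 'a1) fctr
    \<Rightarrow> bool" where
  "adjunction C D L R \<longleftrightarrow>
     is_functor C D L \<and> is_functor D C R \<and>
     (\<exists>\<eta> \<epsilon>. nat_trans C C id_fctr (comp_fctr R L) \<eta> \<and>
            nat_trans D D (comp_fctr L R) id_fctr \<epsilon> \<and>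
            (\<forall>x\<in>Obj C. Comp D (\<epsilon> (FObj L x)) (FArr L (\<eta> x)) = Ident D (FObj L x)) \<and>
            (\<forall>y\<in>Obj D. Comp C (FArr R (\<epsilon> y)) (\<eta> (FObj R y)) = Ident C (FObj R y)))"


section \<open>Finite limits\<close>

definition is_cone ::
  "('j, 'k) cat \<Rightarrow> ('o, 'a) cat \<Rightarrow> ('j, 'k, 'o, 'a) fctr \<Rightarrow> 'o \<Rightarrow> ('j \<Rightarrow> 'a) \<Rightarrow> bool" where
  "is_cone J C D v \<pi> \<longleftrightarrow>
     v \<in> Obj C \<and>
     (\<forall>j\<in>Obj J. \<pi> j \<in> Hom C v (FObj D j)) \<and>
     (\<forall>k\<in>Arr J. Comp C (FArr D k) (\<pi> (Dom J k)) = \<pi> (Cod J k))"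

definition is_limit ::
  "('j, 'k) cat \<Rightarrow> ('o, 'a) cat \<Rightarrow> ('j, 'k, 'o, 'a) fctr \<Rightarrow> 'o \<Rightarrow> ('j \<Rightarrow> 'a) \<Rightarrow> bool" where
  "is_limit J C D v \<pi> \<longleftrightarrow>
     is_cone J C D v \<pi> \<and>
     (\<forall>w \<rho>. is_cone J C D w \<rho> \<longrightarrow>
        (\<exists>!h. h \<in> Hom C w v \<and> (\<forall>j\<in>Obj J. Comp C (\<pi> j) h = \<rho> j)))"

text \<open>Every finite category is isomorphic to one whose objects and arrows are natural numbers.\<close>

definition preserves_finite_limits ::
  "('o1, 'a1) cat \<Rightarrow> ('o2, 'a2) cat \<Rightarrow> ('o1, 'a1, 'o2, 'a2) fctr \<Rightarrow> bool" where
  "preserves_finite_limits C D F \<longleftrightarrow>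
     (\<forall>(J :: (nat, nat) cat) K v \<pi>.
        category J \<and> finite (Obj J) \<and> finite (Arr J) \<and> is_functor J C K \<and> is_limit J C K v \<pi> \<longrightarrow>
        is_limit J D (comp_fctr F K) (FObj F v) (FArr F \<circ> \<pi>))"


section \<open>Presheaves and sheaves of small sets\<close>

text \<open>
  For an arrow \<open>f\<close> from \<open>c\<close> to \<open>d\<close>, \<open>Res P f\<close> maps \<open>Sect P d\<close> to \<open>Sect P c\<close>. Extensionality
  outside the relevant domains makes equality of presheaves and of their morphisms the
  mathematical one.
\<close>

record ('o, 'a, 'u) presheaf =
  Sect :: "'o \<Rightarrow> 'u set"
  Res :: "'a \<Rightarrow> 'u \<Rightarrow> 'u"

definition is_presheaf :: "('o, 'a) cat \<Rightarrow> ('o, 'a, 'u) presheaf \<Rightarrow> bool" where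
  "is_presheaf C P \<longleftrightarrow>
     Sect P \<in> extensional (Obj C) \<and> Res P \<in> extensional (Arr C) \<and>
     (\<forall>c\<in>Obj C. small TYPE('u) (Sect P c)) \<and>
     (\<forall>f\<in>Arr C. Res P f \<in> Sect P (Cod C f) \<rightarrow>\<^sub>E Sect P (Dom C f)) \<and>
     (\<forall>c\<in>Obj C. \<forall>x\<in>Sect P c. Res P (Ident C c) x = x) \<and>
     (\<forall>f\<in>Arr C. \<forall>g\<in>Arr C. Dom C g = Cod C f \<longrightarrow>
        (\<forall>x\<in>Sect P (Cod C g). Res P (Comp C g f) x = Res P f (Res P g x)))"

type_synonym ('o, 'a, 'u) presheaf_arr =
  "('o, 'a, 'u) presheaf \<times> ('o, 'a, 'u) presheaf \<times> ('o \<Rightarrow> 'u \<Rightarrow> 'u)"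

definition is_presheaf_arr :: "('o, 'a) cat \<Rightarrow> ('o, 'a, 'u) presheaf_arr \<Rightarrow> bool" where
  "is_presheaf_arr C = (\<lambda>(P, Q, \<alpha>).
     is_presheaf C P \<and> is_presheaf C Q \<and>
     \<alpha> \<in> extensional (Obj C) \<and>
     (\<forall>c\<in>Obj C. \<alpha> c \<in> Sect P c \<rightarrow>\<^sub>E Sect Q c) \<and>
     (\<forall>f\<in>Arr C. \<forall>x\<in>Sect P (Cod C f).
        \<alpha> (Dom C f) (Res P f x) = Res Q f (\<alpha> (Cod C f) x)))"

definition PSh ::
  "('o, 'a) cat \<Rightarrow> (('o, 'a, 'u) presheaf, ('o, 'a, 'u) presheaf_arr) cat" where
  "PSh C = \<lparr>
     Obj = {P. is_presheaf C P},
     Arr = {t. is_presheaf_arr C t},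
     Dom = (\<lambda>(P, Q, \<alpha>). P),
     Cod = (\<lambda>(P, Q, \<alpha>). Q),
     Ident = (\<lambda>P. (P, P, \<lambda>c\<in>Obj C. \<lambda>x\<in>Sect P c. x)),
     Comp = (\<lambda>(Q', R, \<beta>) (P, Q, \<alpha>). (P, R, \<lambda>c\<in>Obj C. compose (Sect P c) (\<beta> c) (\<alpha> c)))\<rparr>"

definition is_sieve :: "('o, 'a) cat \<Rightarrow> 'o \<Rightarrow> 'a set \<Rightarrow> bool" where
  "is_sieve C c S \<longleftrightarrow>
     S \<subseteq> {f \<in> Arr C. Cod C f = c} \<and>
     (\<forall>f\<in>S. \<forall>g\<in>Arr C. Cod C g = Dom C f \<longrightarrow> Comp C f g \<in> S)"

definition pullback_sieve :: "('o, 'a) cat \<Rightarrow> 'a \<Rightarrow> 'a set \<Rightarrow> 'a set" where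
  "pullback_sieve C f S = {g \<in> Arr C. Cod C g = Dom C f \<and> Comp C f g \<in> S}"

definition grothendieck_topology :: "('o, 'a) cat \<Rightarrow> ('o \<Rightarrow> 'a set set) \<Rightarrow> bool" where
  "grothendieck_topology C J \<longleftrightarrow>
     (\<forall>c\<in>Obj C. \<forall>S\<in>J c. is_sieve C c S) \<and>
     (\<forall>c\<in>Obj C. {f \<in> Arr C. Cod C f = c} \<in> J c) \<and>
     (\<forall>f\<in>Arr C. \<forall>S\<in>J (Cod C f). pullback_sieve C f S \<in> J (Dom C f)) \<and>
     (\<forall>c\<in>Obj C. \<forall>S\<in>J c. \<forall>R. is_sieve C c R \<and> (\<forall>f\<in>S. pullback_sieve C f R \<in> J (Dom C f)) \<longrightarrow>
        R \<in> J c)"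

definition matching_family ::
  "('o, 'a) cat \<Rightarrow> ('o, 'a, 'u) presheaf \<Rightarrow> 'a set \<Rightarrow> ('a \<Rightarrow> 'u) \<Rightarrow> bool" where
  "matching_family C P S x \<longleftrightarrow>
     (\<forall>f\<in>S. x f \<in> Sect P (Dom C f)) \<and>
     (\<forall>f\<in>S. \<forall>g\<in>Arr C. Cod C g = Dom C f \<longrightarrow> Res P g (x f) = x (Comp C f g))"

definition is_sheaf ::
  "('o, 'a) cat \<Rightarrow> ('o \<Rightarrow> 'a set set) \<Rightarrow> ('o, 'a, 'u) presheaf \<Rightarrow> bool" where
  "is_sheaf C J P \<longleftrightarrow>
     is_presheaf C P \<and>
     (\<forall>c\<in>Obj C. \<forall>S\<in>J c. \<forall>x. matching_family C P S x \<longrightarrow>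
        (\<exists>!y. y \<in> Sect P c \<and> (\<forall>f\<in>S. Res P f y = x f)))"

definition full_subcategory :: "('o, 'a) cat \<Rightarrow> 'o set \<Rightarrow> ('o, 'a) cat" where
  "full_subcategory C X =
     C\<lparr>Obj := Obj C \<inter> X, Arr := {f \<in> Arr C. Dom C f \<in> X \<and> Cod C f \<in> X}\<rparr>"

definition Sh ::
  "('o, 'a) cat \<Rightarrow> ('o \<Rightarrow> 'a set set) \<Rightarrow>
    (('o, 'a, 'u) presheaf, ('o, 'a, 'u) presheaf_arr) cat" where
  "Sh C J = full_subcategory (PSh C) {P. is_sheaf C J P}"


section \<open>Topoi and their quotients\<close>

text \<open>
  Topos means Grothendieck topos: a category equivalent to the category of sheaves on a small
  site. As classes are subsets of \<open>'u\<close>, such a category has objects and arrows in \<open>'u\<close>; so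
  does the site, which is small.
\<close>

definition grothendieck_topos :: "('u, 'u) cat \<Rightarrow> bool" where
  "grothendieck_topos T \<longleftrightarrow>
     category T \<and>
     (\<exists>(C :: ('u, 'u) cat) J.
        category C \<and> small TYPE('u) (Obj C) \<and> small TYPE('u) (Arr C) \<and>
        grothendieck_topology C J \<and>
        (\<exists>F G. equivalence T (Sh C J :: (('u, 'u, 'u) presheaf, ('u, 'u, 'u) presheaf_arr) cat) F G))"

record ('o1, 'a1, 'o2, 'a2) geom =
  direct :: "('o1, 'a1, 'o2, 'a2) fctr"
  inverse_im :: "('o2, 'a2, 'o1, 'a1) fctr"

definition geometric_morphism ::
  "('o1, 'a1) cat \<Rightarrow> ('o2, 'a2) cat \<Rightarrow> ('o1, 'a1, 'o2, 'a2) geom \<Rightarrow> bool" where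
  "geometric_morphism E F f \<longleftrightarrow>
     adjunction F E (inverse_im f) (direct f) \<and>
     preserves_finite_limits F E (inverse_im f)"

definition connected_geom ::
  "('o1, 'a1) cat \<Rightarrow> ('o2, 'a2) cat \<Rightarrow> ('o1, 'a1, 'o2, 'a2) geom \<Rightarrow> bool" where
  "connected_geom E F f \<longleftrightarrow> fully_faithful F E (inverse_im f)"

definition comp_geom ::
  "('o2, 'a2, 'o3, 'a3) geom \<Rightarrow> ('o1, 'a1, 'o2, 'a2) geom \<Rightarrow> ('o1, 'a1, 'o3, 'a3) geom" where
  "comp_geom g f = \<lparr>direct = comp_fctr (direct g) (direct f),
                    inverse_im = comp_fctr (inverse_im f) (inverse_im g)\<rparr>"

text \<open>
  As usual, transformations of geometric morphisms are transformations of inverse images.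
\<close>

definition geom_isomorphic ::
  "('o1, 'a1) cat \<Rightarrow> ('o2, 'a2) cat \<Rightarrow> ('o1, 'a1, 'o2, 'a2) geom \<Rightarrow> ('o1, 'a1, 'o2, 'a2) geom
    \<Rightarrow> bool" where
  "geom_isomorphic E F f g \<longleftrightarrow> nat_isomorphic F E (inverse_im f) (inverse_im g)"

text \<open>A pair \<open>(F, f)\<close> of a codomain and a geometric morphism to it.\<close>

type_synonym ('o, 'a, 'u) quotient = "('u, 'u) cat \<times> ('o, 'a, 'u, 'u) geom"

definition quotient_topos :: "('o, 'a) cat \<Rightarrow> ('o, 'a, 'u) quotient \<Rightarrow> bool" where
  "quotient_topos E = (\<lambda>(F, f).
     grothendieck_topos F \<and> geometric_morphism E F f \<and> connected_geom E F f)"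

text \<open>
  An equivalence \<open>e\<close> of categories is regarded as the geometric morphism with direct image \<open>e\<close>
  and inverse image a pseudo-inverse \<open>d\<close> of \<open>e\<close>.
\<close>

definition equivalent_quotients ::
  "('o, 'a) cat \<Rightarrow> ('o, 'a, 'u) quotient \<Rightarrow> ('o, 'a, 'u) quotient \<Rightarrow> bool" where
  "equivalent_quotients E = (\<lambda>(F, f) (F', f').
     \<exists>e d. equivalence F F' e d \<and>
           geom_isomorphic E F' (comp_geom \<lparr>direct = e, inverse_im = d\<rparr> f) f')"


section \<open>Action topoi\<close>

definition free_monoid :: "'g set \<Rightarrow> 'g list monoid" where
  "free_monoid G = \<lparr>carrier = lists G, mult = (@), one = []\<rparr>"

text \<open>
  With composition given by multiplication, a presheaf on this category is a right action:
  \<open>Res P (m \<otimes> n) x = Res P n (Res P m x)\<close>.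
\<close>

definition one_object_category :: "('m, 'b) monoid_scheme \<Rightarrow> (unit, 'm) cat" where
  "one_object_category M = \<lparr>
     Obj = {()},
     Arr = carrier M,
     Dom = (\<lambda>_. ()),
     Cod = (\<lambda>_. ()),
     Ident = (\<lambda>_. \<one>\<^bsub>M\<^esub>),
     Comp = mult M\<rparr>"

definition action_topos ::
  "('m, 'b) monoid_scheme \<Rightarrow> ((unit, 'm, 'u) presheaf, (unit, 'm, 'u) presheaf_arr) cat" where
  "action_topos M = PSh (one_object_category M)"

end

theory Submission
  imports Defs
begin

text \<open>
  For a set \<open>Y\<close>, the sets with an action of all selfmaps of \<open>Y\<close> in which every element depends on
  finitely many points of \<open>Y\<close> form a topos: the presheaves on the opposite of the category of finite
  nonempty subsets of \<open>Y\<close>. Restriction to countably many selfmaps of \<open>Y\<close> is the inverse image part of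
  a geometric morphism from the topos of actions of the free monoid. It is fully faithful as soon as
  every map between such sets that commutes with the chosen selfmaps commutes with all selfmaps.

  This rigidity is attained for arbitrarily large \<open>Y\<close>, whose points are sequences with a colour in the
  natural numbers. There is a function \<open>h\<close> on sequences with \<open>h (s \<circ> Suc) \<noteq> h s\<close> unless \<open>s\<close> is
  constant. An equivariant map that is not induced by points produces, by iteration, a sequence that
  the map relates to its own shift, while commuting with \<open>h\<close>: a contradiction.

  In the quotient so obtained from \<open>Y\<close>, every action with nontrivial operations is about as large as \<open>Y\<close>.
  A small set of quotients contains an upper bound for the sizes of some nontrivial actions in them, so
  it misses the quotients obtained from large \<open>Y\<close>.
\<close>

section \<open>Small sets\<close>

text \<open>The obstacle: countably many maps must control all selfmaps of an arbitrarily large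
  \<open>Y\<close>. This dictates the shape of the points. Colours are natural numbers, so countably
  many maps recolour any finite tuple at will, and a sequence is accessible one natural-number
  coordinate at a time. Equivariance under an arbitrary \<open>t\<close> is reduced to supports:
  pair \<open>x\<close> and \<open>t \<circ> x\<close> into one tuple \<open>w\<close> with distinct
  colours. The fixed maps \<open>left\<close> and \<open>right\<close> recover the halves, and
  \<open>right\<close> equals \<open>t \<circ> left\<close> on the entries of \<open>w\<close>, so
  it suffices that the element assigned to \<open>w\<close> is supported by these entries. Colours
  have to be distinct because then writing the value of \<open>h\<close> into each entry is a mere
  recolouring of the tuple. Finiteness of supports is used twice more: it makes the iteration
  converge to an actual point of a support, and it lets finite limits be computed on elements. The
  size estimate has to exclude trivial operations, since every small set with trivial operations
  occurs in each of these quotients. How large \<open>Y\<close> must be is settled by Cantor's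
  theorem.\<close>

lemma small_lepoll: "X \<lesssim> Y \<Longrightarrow> small U Y \<Longrightarrow> small U X"
  unfolding small_def by (rule lesspoll_trans1)

lemma small_subset: "X \<subseteq> Y \<Longrightarrow> small U Y \<Longrightarrow> small U X"
  by (meson small_lepoll subset_imp_lepoll)

lemma small_image: "small U X \<Longrightarrow> small U (f ` X)"
  by (meson image_lepoll small_lepoll)

lemma lepoll_total: "(A :: 'a set) \<lesssim> (B :: 'b set) \<or> B \<lesssim> A"
  using ordLeq_total[OF card_of_Well_order card_of_Well_order, of A B]
  by (simp add: card_of_ordLeq lepoll_def)

lemma not_lepoll_imp_lesspoll: "\<not> B \<lesssim> A \<Longrightarrow> A \<prec> B"
  by (meson eqpoll_imp_lepoll eqpoll_sym lepoll_total lesspoll_def)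

text \<open>One fixed choice of a map into the universe, injective whenever the set embeds there.
  All later encodings, of functions, families, objects and arrows, are instances of it.\<close>

definition code_of :: "'a set \<Rightarrow> 'a \<Rightarrow> 'u" where
  "code_of X = (SOME e. inj_on e X)"

lemma inj_on_code_of: "X \<lesssim> (UNIV :: 'u set) \<Longrightarrow> inj_on (code_of X :: _ \<Rightarrow> 'u) X"
  unfolding code_of_def lepoll_def by (metis someI_ex)

lemma small_inj_on_code_of: "small TYPE('u) X \<Longrightarrow> inj_on (code_of X :: _ \<Rightarrow> 'u) X"
  by (simp add: inj_on_code_of lesspoll_imp_lepoll small_def)

context
  assumes U: "inaccessible TYPE('u)"
begin

lemma small_nat: "small TYPE('u) (UNIV :: nat set)"
  using U by (auto simp: inaccessible_def)

lemma infinite_universe: "infinite (UNIV :: 'u set)"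
proof
  assume "finite (UNIV :: 'u set)"
  moreover obtain f :: "nat \<Rightarrow> 'u" where "inj f"
    using small_nat by (auto simp: small_def lesspoll_def lepoll_def)
  ultimately have "finite (UNIV :: nat set)"
    by (meson finite_imageD finite_subset subset_UNIV)
  then show False by simp
qed

lemma small_countable: "countable X \<Longrightarrow> small TYPE('u) X"
  by (rule small_lepoll[OF _ small_nat]) (auto simp: countable_def lepoll_def)

lemma small_finite: "finite X \<Longrightarrow> small TYPE('u) X"
  by (simp add: countable_finite small_countable)

lemma small_Pow:
  assumes "small TYPE('u) X" shows "small TYPE('u) (Pow X)"
proof -
  define e where "e = (code_of X :: _ \<Rightarrow> 'u)"
  have e: "inj_on e X"
    unfolding e_def using assms by (intro small_inj_on_code_of)
  have "small TYPE('u) (Pow (e ` X))"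
    using U small_image[OF assms] by (auto simp: inaccessible_def)
  moreover have "Pow X \<lesssim> Pow (e ` X)"
    unfolding lepoll_def using e by (intro exI[of _ "image e"]) (auto simp: inj_on_image_Pow)
  ultimately show ?thesis by (rule small_lepoll[rotated])
qed

text \<open>Inaccessibility speaks of index sets inside \<open>'u\<close>, so an index set over
  another type is first replaced by its image under a code.\<close>

lemma small_UN:
  assumes "small TYPE('u) I" and "\<And>i. i \<in> I \<Longrightarrow> small TYPE('u) (A i :: 'u set)"
  shows "small TYPE('u) (\<Union>i\<in>I. A i)"
proof -
  define e where "e = (code_of I :: _ \<Rightarrow> 'u)"
  have e: "inj_on e I"
    unfolding e_def using assms by (intro small_inj_on_code_of)
  have "small TYPE('u) (\<Union>j \<in> e ` I. A (inv_into I e j))"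
  proof -
    have *: "small TYPE('u) (\<Union>i\<in>I'. A' i)"
      if "small TYPE('u) I'" "\<forall>i\<in>I'. small TYPE('u) (A' i)" for I' and A' :: "'u \<Rightarrow> 'u set"
      using U that by (simp add: inaccessible_def)
    show ?thesis
      by (rule *) (use e assms(2) small_image[OF assms(1)] in auto)
  qed
  also have "(\<Union>j \<in> e ` I. A (inv_into I e j)) = (\<Union>i\<in>I. A i)"
    using e by auto
  finally show ?thesis .
qed

lemma times_self_lepoll: "infinite X \<Longrightarrow> X \<times> X \<lesssim> X"
  using card_of_Times_same_infinite[of X]
  by (metis (no_types, lifting) card_of_ordIso eqpoll_def eqpoll_imp_lepoll)

text \<open>An infinite set absorbs the product with a set that is no larger, and cardinalities are
  comparable.\<close>

lemma small_Times:
  assumes "small TYPE('u) X" "small TYPE('u) Y" shows "small TYPE('u) (X \<times> Y)"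
proof -
  have *: "small TYPE('u) (X \<times> Y)" if "small TYPE('u) X" "small TYPE('u) Y" "X \<lesssim> Y" for X :: "'x set" and Y :: "'y set"
  proof (cases "finite Y")
    case True
    then show ?thesis
      using small_finite that by (meson finite_SigmaI lepoll_def finite_imageD finite_subset)
  next
    case False
    then have "X \<times> Y \<lesssim> Y"
      by (intro lepoll_trans[OF times_lepoll_mono[OF that(3) lepoll_refl]] times_self_lepoll)
    then show ?thesis
      using small_lepoll that by blast
  qed
  show ?thesis
    using lepoll_total[of X Y] *[of X Y] *[of Y X] assms times_commute_eqpoll[of X Y]
    by (meson eqpoll_imp_lepoll small_lepoll)
qed

text \<open>An extensional function is determined by its graph, and the graphs lie in the power set
  of a small product.\<close>

lemma small_PiE:
  assumes "small TYPE('u) X" "small TYPE('u) Y" shows "small TYPE('u) (X \<rightarrow>\<^sub>E Y)"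
proof -
  have "inj_on (\<lambda>f. {(x, f x) |x. x \<in> X}) (X \<rightarrow>\<^sub>E Y)"
  proof (rule inj_onI)
    fix f g assume f: "f \<in> X \<rightarrow>\<^sub>E Y" "g \<in> X \<rightarrow>\<^sub>E Y" and "{(x, f x) |x. x \<in> X} = {(x, g x) |x. x \<in> X}"
    then have "f x = g x" if "x \<in> X" for x
      using that by blast
    then show "f = g"
      using f by (auto intro: PiE_ext)
  qed
  moreover have "(\<lambda>f. {(x, f x) |x. x \<in> X}) ` (X \<rightarrow>\<^sub>E Y) \<subseteq> Pow (X \<times> Y)"
    by auto
  ultimately show ?thesis
    using small_lepoll[OF _ small_Pow[OF small_Times[OF assms]]] by (auto simp: lepoll_def)
qed

lemma lepoll_universe_Times:
  assumes "X \<lesssim> (UNIV :: 'u set)" "Y \<lesssim> (UNIV :: 'u set)" shows "X \<times> Y \<lesssim> (UNIV :: 'u set)"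
proof -
  have "X \<times> Y \<lesssim> (UNIV :: 'u set) \<times> (UNIV :: 'u set)"
    using assms by (rule times_lepoll_mono)
  then show ?thesis
    by (rule lepoll_trans[OF _ times_self_lepoll[OF infinite_universe]])
qed

text \<open>A small class is bounded in a well-order of the universe of minimal order type, whose initial
  segments have small power sets; so the bound and an element of \<open>'u\<close> determine the class.\<close>

lemma small_classes_lepoll: "{X :: 'u set. small TYPE('u) X} \<lesssim> (UNIV :: 'u set)"
proof -
  let ?r = "card_of (UNIV :: 'u set)"
  have field: "Field ?r = UNIV" and co: "Card_order ?r"
    by (simp_all add: Field_card_of card_of_card_order_on)
  have seg: "small TYPE('u) (underS ?r a)" for a
  proof -
    have "ordLess2 (card_of (underS ?r a)) ?r"
      using card_of_underS[OF co, of a] field by simp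
    then have "\<not> (UNIV :: 'u set) \<lesssim> underS ?r a"
      unfolding lepoll_def card_of_ordLess[symmetric] .
    then show ?thesis
      unfolding small_def by (rule not_lepoll_imp_lesspoll)
  qed
  \<comment> \<open>Regularity of the universe: were \<open>X\<close> contained in no initial
    segment, the universe would be the union of small sets, the initial segments of the members of
    \<open>X\<close> together with these members.\<close>
  have bounded: "\<exists>a. X \<subseteq> underS ?r a" if X: "small TYPE('u) X" for X
  proof (rule ccontr)
    assume "\<nexists>a. X \<subseteq> underS ?r a"
    moreover have "total_on UNIV ?r"
      using co unfolding card_order_on_def well_order_on_def linear_order_on_def field by simp
    ultimately have "\<exists>x\<in>X. a = x \<or> a \<in> underS ?r x" for a
      unfolding total_on_def underS_def by (smt (verit) UNIV_I mem_Collect_eq subsetI)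
    then have "(UNIV :: 'u set) \<subseteq> (\<Union>x\<in>X. insert x (underS ?r x))"
      by blast
    moreover have "small TYPE('u) (insert x (underS ?r x))" for x
    proof -
      show ?thesis
      proof (cases "finite (underS ?r x)")
        case True
        then show ?thesis by (intro small_finite) simp
      next
        case False
        then show ?thesis
          using small_lepoll[OF eqpoll_imp_lepoll[OF infinite_insert_eqpoll] seg] by blast
      qed
    qed
    ultimately have "small TYPE('u) (UNIV :: 'u set)"
      using small_subset[OF _ small_UN[OF X, of "\<lambda>x. insert x (underS ?r x)"]] by (simp only:)
    then show False
      by (simp add: small_def)
  qed
  define b where "b = (\<lambda>X. SOME a. X \<subseteq> underS ?r a)"
  have b: "X \<subseteq> underS ?r (b X)" if "small TYPE('u) X" for X
    unfolding b_def using bounded[OF that] by (rule someI_ex)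
  define e where "e = (\<lambda>a. code_of (Pow (underS ?r a)) :: 'u set \<Rightarrow> 'u)"
  have e: "inj_on (e a) (Pow (underS ?r a))" for a
    unfolding e_def by (intro small_inj_on_code_of small_Pow seg)
  have "inj_on (\<lambda>X. (b X, e (b X) X)) {X. small TYPE('u) X}"
  proof (rule inj_onI, clarsimp)
    fix X X' assume "small TYPE('u) X" "small TYPE('u) X'" "b X = b X'" "e (b X') X = e (b X') X'"
    then show "X = X'"
      using b[of X] b[of X'] e[of "b X'"] by (auto dest: inj_onD)
  qed
  then have "{X :: 'u set. small TYPE('u) X} \<lesssim> (UNIV :: 'u set) \<times> (UNIV :: 'u set)"
    unfolding lepoll_def by (intro exI conjI) (assumption, simp)
  then show ?thesis
    by (rule lepoll_trans[OF _ times_self_lepoll[OF infinite_universe]])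
qed

end

section \<open>Actions with finite supports\<close>

definition fix_outside :: "'y set \<Rightarrow> ('y \<Rightarrow> 'y) \<Rightarrow> 'y \<Rightarrow> 'y" where
  "fix_outside Z f y = (if y \<in> Z then f y else y)"

text \<open>Fixing the points outside \<open>Y\<close> makes the selfmaps of \<open>Y\<close> compose by plain function composition.\<close>

definition selfmaps :: "'y set \<Rightarrow> ('y \<Rightarrow> 'y) set" where
  "selfmaps Y = {f. f ` Y \<subseteq> Y \<and> (\<forall>y. y \<notin> Y \<longrightarrow> f y = y)}"

lemma fix_outside_in [simp]: "y \<in> Z \<Longrightarrow> fix_outside Z f y = f y"
  by (simp add: fix_outside_def)

lemma id_selfmaps [simp]: "id \<in> selfmaps Y" "(\<lambda>y. y) \<in> selfmaps Y"
  by (auto simp: selfmaps_def)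

lemma comp_selfmaps [simp]: "f \<in> selfmaps Y \<Longrightarrow> g \<in> selfmaps Y \<Longrightarrow> g \<circ> f \<in> selfmaps Y"
  by (auto simp: selfmaps_def)

lemma selfmaps_in: "f \<in> selfmaps Y \<Longrightarrow> y \<in> Y \<Longrightarrow> f y \<in> Y"
  by (auto simp: selfmaps_def)

lemma selfmaps_image: "f \<in> selfmaps Y \<Longrightarrow> Z \<subseteq> Y \<Longrightarrow> f ` Z \<subseteq> Y"
  by (auto simp: selfmaps_def)

lemma selfmaps_out: "f \<in> selfmaps Y \<Longrightarrow> y \<notin> Y \<Longrightarrow> f y = y"
  by (auto simp: selfmaps_def)

lemma fix_outside_selfmaps: "Z \<subseteq> Y \<Longrightarrow> f ` Z \<subseteq> Y \<Longrightarrow> fix_outside Z f \<in> selfmaps Y"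
  by (auto simp: selfmaps_def fix_outside_def)

lemma fix_outside_cong: "(\<And>y. y \<in> Z \<Longrightarrow> f y = g y) \<Longrightarrow> fix_outside Z f = fix_outside Z g"
  by (auto simp: fix_outside_def)

lemma fix_outside_id: "(\<And>y. y \<in> Z \<Longrightarrow> f y = y) \<Longrightarrow> fix_outside Z f = id"
  by (auto simp: fix_outside_def)

locale selfmaps_action =
  fixes Y :: "'y set" and V :: "'v set" and act :: "('y \<Rightarrow> 'y) \<Rightarrow> 'v \<Rightarrow> 'v"
  assumes act_closed: "f \<in> selfmaps Y \<Longrightarrow> v \<in> V \<Longrightarrow> act f v \<in> V"
    and act_id: "v \<in> V \<Longrightarrow> act id v = v"
    and act_comp: "f \<in> selfmaps Y \<Longrightarrow> g \<in> selfmaps Y \<Longrightarrow> v \<in> V \<Longrightarrow> act (g \<circ> f) v = act g (act f v)"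
begin

text \<open>The notion of support known from nominal sets, with arbitrary selfmaps in place of
  permutations.\<close>

definition supports :: "'y set \<Rightarrow> 'v \<Rightarrow> bool" where
  "supports Z v \<longleftrightarrow>
     (\<forall>f \<in> selfmaps Y. \<forall>g \<in> selfmaps Y. (\<forall>z\<in>Z. f z = g z) \<longrightarrow> act f v = act g v)"

lemma supportsD:
  "supports Z v \<Longrightarrow> f \<in> selfmaps Y \<Longrightarrow> g \<in> selfmaps Y \<Longrightarrow> (\<And>z. z \<in> Z \<Longrightarrow> f z = g z) \<Longrightarrow>
    act f v = act g v"
  unfolding supports_def by blast

lemma supports_mono: "supports Z v \<Longrightarrow> Z \<subseteq> Z' \<Longrightarrow> supports Z' v"
  unfolding supports_def by blast

lemma supports_fixed:
  "supports Z v \<Longrightarrow> v \<in> V \<Longrightarrow> f \<in> selfmaps Y \<Longrightarrow> (\<And>z. z \<in> Z \<Longrightarrow> f z = z) \<Longrightarrow> act f v = v"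
  using supportsD[of Z v f id] act_id by simp

lemma supports_act:
  assumes "supports Z v" "v \<in> V" "f \<in> selfmaps Y"
  shows "supports (f ` Z) (act f v)"
  unfolding supports_def
proof (intro ballI impI)
  fix g g' assume g: "g \<in> selfmaps Y" "g' \<in> selfmaps Y" "\<forall>z\<in>f ` Z. g z = g' z"
  then have "act (g \<circ> f) v = act (g' \<circ> f) v"
    using assms by (intro supportsD[OF assms(1)]) auto
  then show "act g (act f v) = act g' (act f v)"
    using assms g by (simp add: act_comp)
qed

text \<open>The map \<open>h\<close> glued from \<open>f\<close> on \<open>Z\<close> and
  \<open>g\<close> elsewhere agrees with \<open>f\<close> on \<open>Z\<close> and with
  \<open>g\<close> on \<open>Z'\<close>. Gluing is possible because arbitrary selfmaps act, not only
  bijections.\<close>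

lemma supports_Int:
  assumes "supports Z v" "supports Z' v" shows "supports (Z \<inter> Z') v"
  unfolding supports_def
proof (intro ballI impI)
  fix f g assume fg: "f \<in> selfmaps Y" "g \<in> selfmaps Y" "\<forall>z\<in>Z \<inter> Z'. f z = g z"
  define h where "h = (\<lambda>y. if y \<in> Z then f y else g y)"
  have h: "h \<in> selfmaps Y"
    using fg by (auto simp: h_def selfmaps_def)
  have "act f v = act h v"
    using fg h by (intro supportsD[OF assms(1)]) (auto simp: h_def)
  also have "\<dots> = act g v"
    using fg h by (intro supportsD[OF assms(2)]) (auto simp: h_def)
  finally show "act f v = act g v" .
qed

end

locale finsupp_action = selfmaps_action +
  assumes finsupp: "v \<in> V \<Longrightarrow> \<exists>Z. finite Z \<and> Z \<subseteq> Y \<and> supports Z v"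
begin

definition supp :: "'b \<Rightarrow> 'a set" where
  "supp v = (\<Inter> {Z. finite Z \<and> Z \<subseteq> Y \<and> supports Z v})"

text \<open>A finite support of least cardinality lies in every finite support, because intersecting
  it with another one gives a support again. So the intersection that defines \<open>supp\<close> is
  attained.\<close>

lemma supp_props:
  assumes "v \<in> V" shows "finite (supp v) \<and> supp v \<subseteq> Y \<and> supports (supp v) v"
proof -
  let ?P = "\<lambda>Z. finite Z \<and> Z \<subseteq> Y \<and> supports Z v"
  obtain Z where Z: "?P Z" "\<And>Z'. ?P Z' \<Longrightarrow> card Z \<le> card Z'"
    using finsupp[OF assms] ex_has_least_nat[of ?P _ card] by metis
  have "Z \<subseteq> Z'" if "?P Z'" for Z'
  proof -
    have "?P (Z \<inter> Z')"
      using Z(1) that supports_Int by blast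
    then have "Z \<inter> Z' = Z"
      using Z by (metis card_seteq inf_le1)
    then show ?thesis by blast
  qed
  then have "supp v = Z"
    unfolding supp_def using Z(1) by blast
  with Z(1) show ?thesis by simp
qed

lemmas finite_supp = supp_props[THEN conjunct1]
  and supp_subset = supp_props[THEN conjunct2, THEN conjunct1]
  and supports_supp = supp_props[THEN conjunct2, THEN conjunct2]

lemma supp_least: "finite Z \<Longrightarrow> Z \<subseteq> Y \<Longrightarrow> supports Z v \<Longrightarrow> supp v \<subseteq> Z"
  unfolding supp_def by blast

lemma supp_act:
  assumes "v \<in> V" "f \<in> selfmaps Y" shows "supp (act f v) \<subseteq> f ` supp v"
proof (rule supp_least)
  show "f ` supp v \<subseteq> Y"
    using assms supp_subset by (intro selfmaps_image)
  show "finite (f ` supp v)"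
    using finite_supp[OF assms(1)] by simp
  show "supports (f ` supp v) (act f v)"
    using supports_act[OF supports_supp] assms by simp
qed

text \<open>A selfmap \<open>l\<close> that inverts \<open>f\<close> on the support brings
  \<open>act f v\<close> back to \<open>v\<close>; the inclusion known for \<open>f\<close> is
  applied to \<open>l\<close> as well.\<close>

lemma supp_act_inj:
  assumes "v \<in> V" "f \<in> selfmaps Y" "inj_on f (supp v)"
  shows "supp (act f v) = f ` supp v"
proof
  define l where "l = fix_outside (f ` supp v) (inv_into (supp v) f)"
  have "inv_into (supp v) f ` f ` supp v \<subseteq> Y" "f ` supp v \<subseteq> Y"
    using supp_subset[OF assms(1)] assms by (simp_all add: inv_into_image_cancel selfmaps_image)
  then have l: "l \<in> selfmaps Y"
    unfolding l_def by (intro fix_outside_selfmaps)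
  have "l (f z) = z" if "z \<in> supp v" for z
    using that assms(3) by (simp add: l_def)
  then have "act (l \<circ> f) v = v"
    using assms l by (intro supports_fixed[OF supports_supp]) simp_all
  then have "supp v \<subseteq> l ` supp (act f v)"
    using supp_act[OF act_closed[OF assms(2,1)] l] l assms by (simp add: act_comp)
  then have "f ` supp v \<subseteq> f ` l ` supp (act f v)"
    by blast
  also have "\<dots> = supp (act f v)"
  proof -
    have "f (l y) = y" if "y \<in> supp (act f v)" for y
      using that supp_act[OF assms(1,2)] assms(3) by (auto simp: l_def)
    then show ?thesis by (simp add: image_image)
  qed
  finally show "f ` supp v \<subseteq> supp (act f v)" .
qed (rule supp_act[OF assms(1,2)])

end

section \<open>Rigidity\<close>

text \<open>Call points equivalent if their forward orbits meet, and choose a representative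
  \<open>r y\<close> in each class. Let \<open>m y\<close> count the steps from \<open>y\<close>
  until the orbit of \<open>r y\<close> is met, and let \<open>n y\<close> be the position of
  \<open>y\<close> on that orbit when \<open>m y = 0\<close>. Applying \<open>f\<close> lowers a
  positive \<open>m\<close>. If \<open>m\<close> vanishes at \<open>y\<close>, it vanishes at
  \<open>f y\<close>, and equal positions would force \<open>f y = y\<close>. So the pair of
  \<open>m\<close> and \<open>n\<close> is a suitable colour.\<close>

lemma fixpoint_free_colouring:
  fixes f :: "'a \<Rightarrow> 'a"
  shows "\<exists>h :: 'a \<Rightarrow> nat. \<forall>y. f y \<noteq> y \<longrightarrow> h (f y) \<noteq> h y"
proof -
  define E where "E = (\<lambda>y y'. \<exists>m n. (f ^^ m) y = (f ^^ n) y')"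
  have E_refl: "E y y" for y
    unfolding E_def by (intro exI, rule refl)
  have E_sym: "E y y' \<Longrightarrow> E y' y" for y y'
    unfolding E_def by (elim exE, intro exI, erule sym)
  have E_trans: "E x z" if "E x y" "E y z" for x y z
  proof -
    from that obtain a b c d where ab: "(f ^^ a) x = (f ^^ b) y" and cd: "(f ^^ c) y = (f ^^ d) z"
      unfolding E_def by blast
    have "(f ^^ (c + a)) x = (f ^^ (c + b)) y"
      by (simp only: funpow_add comp_apply ab)
    also have "\<dots> = (f ^^ (b + c)) y"
      by (simp only: add.commute)
    also have "\<dots> = (f ^^ (b + d)) z"
      by (simp only: funpow_add comp_apply cd)
    finally show ?thesis
      unfolding E_def by blast
  qed
  have E_f: "E (f y) y" for y
    unfolding E_def by (intro exI[of _ 0] exI[of _ 1]) simp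
  define r where "r = (\<lambda>y. SOME y'. E y y')"
  have r: "E y (r y)" for y
    unfolding r_def by (rule someI) (rule E_refl)
  have rf: "r (f y) = r y" for y
  proof -
    have "E (f y) = E y"
      by (intro ext iffI) (erule E_trans[OF E_sym[OF E_f]], erule E_trans[OF E_f])
    then show ?thesis by (simp add: r_def)
  qed
  define m where "m = (\<lambda>y. LEAST m. \<exists>n. (f ^^ m) y = (f ^^ n) (r y))"
  define n where "n = (\<lambda>y. LEAST n. y = (f ^^ n) (r y))"
  have m: "\<exists>n. (f ^^ m y) y = (f ^^ n) (r y)" for y
    unfolding m_def by (rule LeastI_ex) (use r in \<open>auto simp: E_def\<close>)
  have n: "y = (f ^^ n y) (r y)" if "m y = 0" for y
    unfolding n_def by (rule LeastI_ex) (use m[of y] that in auto)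
  have "prod_encode (m (f y), n (f y)) \<noteq> prod_encode (m y, n y)" if "f y \<noteq> y" for y
  proof (cases "m y")
    case 0
    then have *: "f y = (f ^^ Suc (n y)) (r (f y))"
      using n[of y] rf by simp
    then have "m (f y) = 0"
      unfolding m_def by (intro Least_eq_0) (metis funpow_0)
    then show ?thesis
      using n[of y] n[of "f y"] 0 rf that by auto
  next
    case (Suc k)
    then have "\<exists>n. (f ^^ k) (f y) = (f ^^ n) (r (f y))"
      using m[of y] rf by (simp add: funpow_swap1)
    then have "m (f y) \<le> k"
      unfolding m_def by (rule Least_le)
    then show ?thesis
      using Suc by auto
  qed
  then show ?thesis
    by (intro exI[of _ "\<lambda>y. prod_encode (m y, n y)"]) blast
qed

section \<open>Coloured sequences and a countable stock of maps between them\<close>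

type_synonym 'u point = "nat \<times> (nat \<Rightarrow> 'u)"

definition points :: "'u set \<Rightarrow> 'u point set" where
  "points S = {y. \<forall>i. snd y i \<in> S}"

definition evens :: "(nat \<Rightarrow> 'u) \<Rightarrow> nat \<Rightarrow> 'u" where
  "evens s i = s (2 * i)"

definition odds :: "(nat \<Rightarrow> 'u) \<Rightarrow> nat \<Rightarrow> 'u" where
  "odds s i = s (2 * i + 1)"

definition interleave :: "(nat \<Rightarrow> 'u) \<Rightarrow> (nat \<Rightarrow> 'u) \<Rightarrow> nat \<Rightarrow> 'u" where
  "interleave s t i = (if even i then s (i div 2) else t (i div 2))"

lemma evens_interleave [simp]: "evens (interleave s t) = s"
  by (auto simp: evens_def interleave_def)

lemma odds_interleave [simp]: "odds (interleave s t) = t"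
  by (auto simp: odds_def interleave_def)

text \<open>The bound is inclusive: \<open>cut b 0\<close> still keeps one coordinate, which carries
  the value that starts the iteration.\<close>

definition cut :: "'u \<Rightarrow> nat \<Rightarrow> (nat \<Rightarrow> 'u) \<Rightarrow> nat \<Rightarrow> 'u" where
  "cut b r s i = (if i \<le> r then s i else b)"

text \<open>A finite table with a default value. Coding recolourings by finite data keeps their
  number countable.\<close>

definition recolour :: "nat \<times> nat list \<Rightarrow> nat \<Rightarrow> nat" where
  "recolour L k = (if k < length (snd L) then snd L ! k else fst L)"

text \<open>The prescribed default \<open>d\<close> serves to push every colour that does not occur
  in a tuple onto one that does.\<close>

lemma ex_recolour:
  assumes "finite K"
  shows "\<exists>L. (\<forall>k\<in>K. recolour L k = f k) \<and> (\<forall>k. k \<notin> K \<longrightarrow> recolour L k = d)"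
proof -
  obtain n where n: "K \<subseteq> {..<n}"
    using assms by (meson finite_nat_bounded)
  then show ?thesis
    by (intro exI[of _ "(d, map (\<lambda>k. if k \<in> K then f k else d) [0..<n])"]) (auto simp: recolour_def)
qed

text \<open>A choice of the function \<open>h\<close> of the overview. Its values are natural
  numbers, so they can be stored in the colour of a point.\<close>

definition marking :: "(nat \<Rightarrow> 'u) \<Rightarrow> nat" where
  "marking = (SOME h. \<forall>s. s \<circ> Suc \<noteq> s \<longrightarrow> h (s \<circ> Suc) \<noteq> h s)"

lemma marking: "s \<circ> Suc \<noteq> s \<Longrightarrow> marking (s \<circ> Suc) \<noteq> marking s"
proof -
  have "\<exists>h :: (nat \<Rightarrow> 'u) \<Rightarrow> nat. \<forall>s. s \<circ> Suc \<noteq> s \<longrightarrow> h (s \<circ> Suc) \<noteq> h s"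
    by (rule fixpoint_free_colouring)
  then have "\<forall>s. s \<circ> Suc \<noteq> s \<longrightarrow> marking (s \<circ> Suc) \<noteq> marking (s :: nat \<Rightarrow> 'u)"
    unfolding marking_def by (rule someI_ex)
  then show "s \<circ> Suc \<noteq> s \<Longrightarrow> marking (s \<circ> Suc) \<noteq> marking s" for s :: "nat \<Rightarrow> 'u"
    by blast
qed

text \<open>The colour of a point encodes a tag and the colours of the two points that \<open>left\<close> and \<open>right\<close>
  recover. Tags serve to make the colours in a tuple distinct.\<close>

context
  fixes b :: 'u
begin

fun left :: "'u point \<Rightarrow> 'u point" where
  "left (k, s) = (fst (prod_decode (snd (prod_decode k))), evens s)"

fun right :: "'u point \<Rightarrow> 'u point" where
  "right (k, s) = (snd (prod_decode (snd (prod_decode k))), odds s)"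

text \<open>The old colour stays readable inside the new one. This makes the map injective, and it
  later identifies the entry from which a marked colour comes.\<close>

fun mark :: "'u point \<Rightarrow> 'u point" where
  "mark (k, s) = (prod_encode (k, marking (evens s)), s)"

text \<open>Coordinate \<open>l\<close> is exposed at the front of the even half, while the odd half
  retains the whole sequence, so that the map is injective.\<close>

fun load :: "nat \<Rightarrow> 'u point \<Rightarrow> 'u point" where
  "load l (k, s) = (k, interleave (cut b 0 (\<lambda>_. s l)) s)"

text \<open>Provides finite approximations: coordinates of the even half beyond \<open>r\<close> can
  be altered without any effect on the image.\<close>

fun trunc :: "nat \<Rightarrow> 'u point \<Rightarrow> 'u point" where
  "trunc r (k, s) = (k, interleave (cut b r (evens s)) (odds s))"

fun paint :: "nat \<times> nat list \<Rightarrow> 'u point \<Rightarrow> 'u point" where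
  "paint L (k, s) = (recolour L k, s)"

end

definition basic_maps :: "'u \<Rightarrow> 'u set \<Rightarrow> ('u point \<Rightarrow> 'u point) set" where
  "basic_maps b S = fix_outside (points S) `
     ({left, right, mark} \<union> range (load b) \<union> range (trunc b) \<union> range paint)"

lemma countable_basic_maps: "countable (basic_maps b S)"
  by (simp add: basic_maps_def)

lemma basics_points:
  assumes "b \<in> S" "y \<in> points S"
    and "f \<in> {left, right, mark} \<union> range (load b) \<union> range (trunc b) \<union> range paint"
  shows "f y \<in> points S"
  using assms by (cases y) (auto simp: points_def evens_def odds_def interleave_def cut_def)

lemma basic_maps_selfmaps:
  assumes "b \<in> S" shows "basic_maps b S \<subseteq> selfmaps (points S)"
  unfolding basic_maps_def
proof (rule image_subsetI)
  fix f assume f: "f \<in> {left, right, mark} \<union> range (load b) \<union> range (trunc b) \<union> range paint"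
  have "f ` points S \<subseteq> points S"
    by (rule image_subsetI) (rule basics_points[OF assms _ f])
  then show "fix_outside (points S) f \<in> selfmaps (points S)"
    by (rule fix_outside_selfmaps[OF subset_refl])
qed

text \<open>\<open>\<Phi>\<close> stands for a map from the \<open>Z\<close>-indexed tuples of points.\<close>

locale tuple_map = finsupp_action "points S" V act
  for S :: "'u set" and V :: "'v set" and act +
  fixes b :: 'u and Z :: "'i set" and \<Phi> :: "('i \<Rightarrow> 'u point) \<Rightarrow> 'v"
  assumes base: "b \<in> S"
    and Z: "finite Z" "Z \<noteq> {}"
    and \<Phi>_closed: "x ` Z \<subseteq> points S \<Longrightarrow> \<Phi> x \<in> V"
    and \<Phi>_cong: "(\<And>i. i \<in> Z \<Longrightarrow> x i = x' i) \<Longrightarrow> \<Phi> x = \<Phi> x'"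
    and \<Phi>_basic: "m \<in> basic_maps b S \<Longrightarrow> x ` Z \<subseteq> points S \<Longrightarrow> \<Phi> (m \<circ> x) = act m (\<Phi> x)"
begin

abbreviation "basics \<equiv> {left, right, mark} \<union> range (load b) \<union> range (trunc b) \<union> range paint"

lemma basics_image: "f \<in> basics \<Longrightarrow> y \<in> points S \<Longrightarrow> f y \<in> points S"
  by (rule basics_points[OF base])

lemma basics_selfmaps: "f \<in> basics \<Longrightarrow> fix_outside (points S) f \<in> selfmaps (points S)"
  by (rule fix_outside_selfmaps[OF subset_refl image_subsetI]) (rule basics_image)

lemma \<Phi>_basics:
  assumes "f \<in> basics" "x ` Z \<subseteq> points S"
  shows "\<Phi> (f \<circ> x) = act (fix_outside (points S) f) (\<Phi> x)"
proof -
  have "\<Phi> (f \<circ> x) = \<Phi> (fix_outside (points S) f \<circ> x)"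
    using assms by (intro \<Phi>_cong) (auto simp: image_subset_iff)
  also have "\<dots> = act (fix_outside (points S) f) (\<Phi> x)"
    using assms by (intro \<Phi>_basic) (auto simp: basic_maps_def)
  finally show ?thesis .
qed

lemma fix_outside_supp:
  assumes "x ` Z \<subseteq> points S" shows "fix_outside (points S) f ` supp (\<Phi> x) = f ` supp (\<Phi> x)"
  using supp_subset[OF \<Phi>_closed[OF assms]] by (intro image_cong) auto

lemma supp_basic:
  assumes "f \<in> basics" "x ` Z \<subseteq> points S"
  shows "supp (\<Phi> (f \<circ> x)) \<subseteq> f ` supp (\<Phi> x)"
  using supp_act[OF \<Phi>_closed[OF assms(2)] basics_selfmaps[OF assms(1)]] fix_outside_supp[OF assms(2)]
  by (simp add: \<Phi>_basics[OF assms])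

lemma supp_basic_inj:
  assumes "f \<in> basics" "x ` Z \<subseteq> points S" "inj f"
  shows "supp (\<Phi> (f \<circ> x)) = f ` supp (\<Phi> x)"
proof -
  have "inj_on (fix_outside (points S) f) (supp (\<Phi> x))"
    using supp_subset[OF \<Phi>_closed[OF assms(2)]] assms(3) by (auto simp: inj_on_def fix_outside_def)
  then show ?thesis
    using supp_act_inj[OF \<Phi>_closed[OF assms(2)] basics_selfmaps[OF assms(1)]]
      fix_outside_supp[OF assms(2)] by (simp add: \<Phi>_basics[OF assms(1,2)])
qed

text \<open>A painting that fixes the colours of the tuple and sends all others to one of them
  leaves the tuple unchanged. So the support lies in its own painted image, where only colours of
  the tuple occur.\<close>

lemma colour_supp:
  assumes "x ` Z \<subseteq> points S" "\<tau> \<in> supp (\<Phi> x)"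
  shows "\<exists>i\<in>Z. fst \<tau> = fst (x i)"
proof -
  let ?K = "fst ` x ` Z"
  obtain i0 where i0: "i0 \<in> Z"
    using Z by blast
  obtain L where L: "\<forall>k\<in>?K. recolour L k = k" "\<forall>k. k \<notin> ?K \<longrightarrow> recolour L k = fst (x i0)"
    using ex_recolour[of ?K "\<lambda>k. k" "fst (x i0)"] Z by auto
  have "\<Phi> (paint L \<circ> x) = \<Phi> x"
  proof (rule \<Phi>_cong)
    show "(paint L \<circ> x) i = x i" if "i \<in> Z" for i
      using L(1) that by (cases "x i") force
  qed
  then have "\<tau> \<in> paint L ` supp (\<Phi> x)"
    using supp_basic[of "paint L" x] assms by auto
  then obtain \<tau>' where "\<tau> = paint L \<tau>'"
    by blast
  then have "fst \<tau> = recolour L (fst \<tau>')"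
    by (cases \<tau>') simp
  then show ?thesis
    using L i0 by (cases "fst \<tau>' \<in> ?K") auto
qed

lemma inj_load: "inj (load b l)"
  by (rule injI) (metis load.simps odds_interleave prod.exhaust prod.inject)

lemma inj_mark: "inj (mark :: 'u point \<Rightarrow> _)"
  by (rule injI) (metis mark.simps prod.exhaust prod.inject prod_encode_eq)

lemma trunc_trunc: "r \<le> r' \<Longrightarrow> trunc b r (trunc b r' y) = trunc b r y"
  by (cases y) (auto simp: cut_def fun_eq_iff interleave_def)

lemma fst_trunc: "fst (trunc b r y) = fst y"
  by (cases y) simp

text \<open>If a point of the support differed from the entry of its colour, then iterating the
  difference would produce a tuple with an entry whose even part \<open>c\<close> has its own shift in the support
  at the same place; but \<open>c\<close> and its shift carry different marks.\<close>

lemma supp_tuple_distinct: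
  assumes x: "x ` Z \<subseteq> points S" and inj: "inj_on (fst \<circ> x) Z" and \<tau>: "\<tau> \<in> supp (\<Phi> x)"
  shows "\<tau> \<in> x ` Z"
proof -
  obtain j where j: "j \<in> Z" "fst \<tau> = fst (x j)"
    using colour_supp[OF x \<tau>] by blast
  have "snd \<tau> l = snd (x j) l" for l
  proof (rule ccontr)
    assume neq: "snd \<tau> l \<noteq> snd (x j) l"
    \<comment> \<open>The odd halves keep the sequences of \<open>x\<close>. The even halves are
      chosen such that, for \<open>c\<close> constant with value \<open>snd (x j) l\<close>,
      truncation at \<open>0\<close> yields \<open>load b l \<circ> x\<close>.\<close>
    define z where "z = (\<lambda>c i. (fst (x i),
      interleave (if i = j then c else (\<lambda>_. snd (x i) l)) (snd (x i))))"
    have z: "z c ` Z \<subseteq> points S" if "range c \<subseteq> S" for c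
      using x that by (auto simp: z_def points_def interleave_def image_subset_iff)
    have trunc_z: "(trunc b r \<circ> z c) ` Z \<subseteq> points S" if "range c \<subseteq> S" for c r
      using z[OF that] by (simp only: image_subset_iff comp_apply) (blast intro: basics_image)
    have trunc_cong: "trunc b r \<circ> z c = trunc b r \<circ> z c'" if "\<And>i. i \<le> r \<Longrightarrow> c i = c' i" for r c c'
      using that by (auto simp: z_def cut_def fun_eq_iff interleave_def)
    \<comment> \<open>Stage \<open>r\<close> of the iteration: \<open>\<sigma>\<close> is a support
      point of the truncated tuple with the colour of entry \<open>j\<close>. At stage
      \<open>0\<close> its even half begins with the deviating value \<open>snd \<tau> l\<close>,
      whereas \<open>c\<close> begins with \<open>snd (x j) l\<close>.\<close>
    define P where "P = (\<lambda>r (c, \<sigma>). range c \<subseteq> S \<and> c 0 = snd (x j) l \<and> fst \<sigma> = fst (x j) \<and>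
      (r = 0 \<longrightarrow> evens (snd \<sigma>) 0 = snd \<tau> l) \<and> \<sigma> \<in> supp (\<Phi> (trunc b r \<circ> z c)))"
    \<comment> \<open>The new entry of \<open>c\<close> is read off from \<open>\<sigma>\<close> one
      place earlier; in the limit this forces the support point to carry the shift of
      \<open>c\<close>.\<close>
    define Q where "Q = (\<lambda>r (c, \<sigma>) (c', \<sigma>'). c' = c(Suc r := evens (snd \<sigma>) r) \<and>
      trunc b r \<sigma>' = \<sigma>)"
    \<comment> \<open>As \<open>load\<close> is injective, supports are transported exactly, so the
      image of \<open>\<tau>\<close> lies in the support for
      \<open>load b l \<circ> x\<close>.\<close>
    have P0: "\<exists>s. P 0 s"
    proof -
      let ?c = "\<lambda>_ :: nat. snd (x j) l"
      have "range ?c \<subseteq> S"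
        using x j by (auto simp: points_def)
      moreover have "trunc b 0 \<circ> z ?c = load b l \<circ> x"
        by (rule ext, rename_tac i, case_tac "x i") (auto simp: z_def)
      moreover have "load b l \<tau> \<in> supp (\<Phi> (load b l \<circ> x))"
        using supp_basic_inj[OF _ x inj_load] \<tau> by auto
      moreover have "fst (load b l \<tau>) = fst (x j)" "evens (snd (load b l \<tau>)) 0 = snd \<tau> l"
        using j by (cases \<tau>; simp add: cut_def)+
      ultimately have "P 0 (?c, load b l \<tau>)"
        by (simp add: P_def)
      then show ?thesis ..
    qed
    have step: "\<exists>s'. P (Suc r) s' \<and> Q r s s'" if "P r s" for r s
    proof -
      obtain c \<sigma> where s: "s = (c, \<sigma>)"
        by (cases s)
      note P = that[unfolded s P_def prod.case]
      let ?c = "c(Suc r := evens (snd \<sigma>) r)"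
      have "\<sigma> \<in> points S"
        using P supp_subset[OF \<Phi>_closed[OF trunc_z]] by blast
      then have c: "range ?c \<subseteq> S"
        using P by (auto simp: points_def evens_def)
      \<comment> \<open>Truncation at \<open>r\<close> does not see the new entry at
        \<open>Suc r\<close>. So \<open>\<sigma>\<close> lifts along it to a support point for the
        altered tuple.\<close>
      have "trunc b r \<circ> (trunc b (Suc r) \<circ> z ?c) = trunc b r \<circ> z ?c"
        by (auto simp: trunc_trunc)
      also have "\<dots> = trunc b r \<circ> z c"
        by (rule trunc_cong) simp
      finally have "\<sigma> \<in> trunc b r ` supp (\<Phi> (trunc b (Suc r) \<circ> z ?c))"
        using supp_basic[OF _ trunc_z[OF c], of "trunc b r" "Suc r"] P by auto
      then obtain \<sigma>' where \<sigma>': "\<sigma>' \<in> supp (\<Phi> (trunc b (Suc r) \<circ> z ?c))" "trunc b r \<sigma>' = \<sigma>"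
        by blast
      then have "fst \<sigma>' = fst (x j)"
        using P by (cases \<sigma>') auto
      then show ?thesis
        using P c \<sigma>' by (intro exI[of _ "(?c, \<sigma>')"]) (simp add: P_def Q_def s)
    qed
    have "\<exists>s. \<forall>r. P r (s r) \<and> Q r (s r) (s (Suc r))"
      by (rule dependent_nat_choice) (use P0 step in blast)+
    then obtain s where s: "\<And>r. P r (s r)" "\<And>r. Q r (s r) (s (Suc r))"
      by blast
    \<comment> \<open>Entries up to \<open>r\<close> no longer change after stage \<open>r\<close>,
      so the diagonal is the limit of the sequences.\<close>
    define c where "c = (\<lambda>r. fst (s r) r)"
    define \<sigma> where "\<sigma> = (\<lambda>r. snd (s r))"
    have sP: "range (fst (s r)) \<subseteq> S" "fst (s r) 0 = snd (x j) l" "fst (\<sigma> r) = fst (x j)"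
       "\<sigma> r \<in> supp (\<Phi> (trunc b r \<circ> z (fst (s r))))" for r
      using s(1)[of r] by (auto simp: P_def \<sigma>_def split: prod.splits)
    have sQ: "fst (s (Suc r)) = (fst (s r))(Suc r := evens (snd (\<sigma> r)) r)"
      "trunc b r (\<sigma> (Suc r)) = \<sigma> r" for r
      using s(2)[of r] by (auto simp: Q_def \<sigma>_def split: prod.splits)
    have \<sigma>0: "evens (snd (\<sigma> 0)) 0 = snd \<tau> l"
      using s(1)[of 0] by (auto simp: P_def \<sigma>_def split: prod.splits)
    have c: "range c \<subseteq> S"
      using sP(1) by (auto simp: c_def)
    have c_Suc: "c (Suc r) = evens (snd (\<sigma> r)) r" for r
      by (simp add: c_def sQ)
    have stable: "fst (s r) i = c i" if "i \<le> r" for i r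
      using that by (induction r rule: dec_induct) (auto simp: c_def sQ)
    have \<sigma>_supp: "\<sigma> r \<in> supp (\<Phi> (trunc b r \<circ> z c))" for r
    proof -
      have "trunc b r \<circ> z (fst (s r)) = trunc b r \<circ> z c"
        by (rule trunc_cong) (rule stable)
      then show ?thesis
        using sP(4)[of r] by simp
    qed
    \<comment> \<open>The support points of the untruncated tuple that lie above the approximations:
      a decreasing sequence of nonempty sets, finite because supports are. Hence one point lies
      above all of them.\<close>
    define A where "A = (\<lambda>r. {\<tau>' \<in> supp (\<Phi> (z c)). trunc b r \<tau>' = \<sigma> r})"
    have A_ne: "A r \<noteq> {}" for r
    proof -
      have "trunc b r \<in> basics" by simp
      then have "\<sigma> r \<in> trunc b r ` supp (\<Phi> (z c))"
        using supp_basic[OF _ z[OF c]] \<sigma>_supp[of r] by blast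
      then obtain \<rho> where "\<rho> \<in> supp (\<Phi> (z c))" "\<sigma> r = trunc b r \<rho>"
        by (rule imageE)
      then have "\<rho> \<in> A r"
        by (simp add: A_def)
      then show ?thesis
        by blast
    qed
    have A_mono: "A (Suc r) \<subseteq> A r" for r
    proof
      fix \<rho> assume "\<rho> \<in> A (Suc r)"
      then have "\<rho> \<in> supp (\<Phi> (z c))" "trunc b (Suc r) \<rho> = \<sigma> (Suc r)"
        by (simp_all add: A_def)
      moreover from this have "trunc b r \<rho> = \<sigma> r"
        using trunc_trunc[of r "Suc r" \<rho>] sQ(2)[of r] by simp
      ultimately show "\<rho> \<in> A r"
        by (simp add: A_def)
    qed
    have A_fin: "finite (A 0)"
      using finite_supp[OF \<Phi>_closed[OF z[OF c]]] by (simp add: A_def)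
    have "\<exists>\<omega>. \<forall>r. \<omega> \<in> A r"
    proof (rule ccontr)
      assume "\<nexists>\<omega>. \<forall>r. \<omega> \<in> A r"
      then obtain n where n: "\<And>\<omega>. \<omega> \<notin> A (n \<omega>)"
        by metis
      have le: "A r' \<subseteq> A r" if "r \<le> r'" for r r'
        using that A_mono by (rule lift_Suc_antimono_le[of A, rotated])
      obtain \<omega> where \<omega>: "\<omega> \<in> A (Max (n ` A 0))"
        using A_ne by blast
      then have "\<omega> \<in> A 0"
        using le[of 0 "Max (n ` A 0)"] by blast
      then have "n \<omega> \<le> Max (n ` A 0)"
        using A_fin by simp
      then show False
        using le \<omega> n by blast
    qed
    then obtain \<omega> where \<omega>: "\<And>r. \<omega> \<in> A r"
      by blast
    have \<omega>_supp: "\<omega> \<in> supp (\<Phi> (z c))" and \<omega>_trunc: "trunc b r \<omega> = \<sigma> r" for r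
      using \<omega> by (auto simp: A_def)
    have \<omega>_colour: "fst \<omega> = fst (x j)"
      using \<omega>_trunc[of 0] sP(3)[of 0] fst_trunc[of 0 \<omega>] by simp
    have "evens (snd \<omega>) r = c (Suc r)" for r
    proof -
      have "evens (snd \<omega>) r = evens (snd (trunc b r \<omega>)) r"
        by (cases \<omega>) (simp add: cut_def)
      then show ?thesis
        by (simp add: \<omega>_trunc c_Suc)
    qed
    then have \<omega>_evens: "evens (snd \<omega>) = c \<circ> Suc"
      by auto
    \<comment> \<open>Entry \<open>1\<close> of \<open>c\<close> is \<open>snd \<tau> l\<close> and
      entry \<open>0\<close> is \<open>snd (x j) l\<close>, so \<open>neq\<close> applies.\<close>
    have "(c \<circ> Suc) 0 \<noteq> c 0"
      using neq \<sigma>0 sP(2)[of 0] c_Suc[of 0] by (simp add: c_def)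
    then have "c \<circ> Suc \<noteq> c"
      by metis
    then have mark_neq: "marking (c \<circ> Suc) \<noteq> marking c"
      by (rule marking)
    \<comment> \<open>Since the colour determines the entry, marking the tuple \<open>z c\<close>
      has the same effect as painting it. Hence the colour of \<open>mark \<omega>\<close> is the
      colour of some marked entry. The old colour stored in it shows that this is entry
      \<open>j\<close>, and the stored marks of \<open>c\<close> and its shift would
      coincide.\<close>
    let ?K = "(fst \<circ> x) ` Z"
    define g where "g = (\<lambda>k. fst (mark (z c (inv_into Z (fst \<circ> x) k))))"
    obtain L where L: "\<forall>k\<in>?K. recolour L k = g k"
      using ex_recolour[of ?K g 0] Z by auto
    have g: "g (fst (x i)) = fst (mark (z c i))" if "i \<in> Z" for i
      using inv_into_f_f[OF inj that] by (simp add: g_def)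
    have "\<Phi> (mark \<circ> z c) = \<Phi> (paint L \<circ> z c)"
    proof (rule \<Phi>_cong)
      fix i assume i: "i \<in> Z"
      then have "recolour L (fst (z c i)) = fst (mark (z c i))"
        using L g[OF i] by (auto simp: z_def)
      then show "(mark \<circ> z c) i = (paint L \<circ> z c) i"
        by (cases "z c i") simp
    qed
    moreover have "mark \<omega> \<in> supp (\<Phi> (mark \<circ> z c))"
      using supp_basic_inj[OF _ z[OF c] inj_mark] \<omega>_supp by simp
    ultimately obtain \<rho> where \<rho>: "\<rho> \<in> supp (\<Phi> (z c))" "mark \<omega> = paint L \<rho>"
      using supp_basic[OF _ z[OF c], of "paint L"] by auto
    obtain i where i: "i \<in> Z" "fst \<rho> = fst (z c i)"
      using colour_supp[OF z[OF c] \<rho>(1)] by blast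
    have "fst (mark \<omega>) = recolour L (fst \<rho>)"
      using \<rho>(2) by (cases \<rho>) simp
    also have "\<dots> = fst (mark (z c i))"
      using i L g[OF i(1)] by (auto simp: z_def)
    finally have "prod_encode (fst \<omega>, marking (c \<circ> Suc)) =
        prod_encode (fst (x i), marking (if i = j then c else (\<lambda>_. snd (x i) l)))"
      using \<omega>_evens by (cases \<omega>) (simp add: z_def)
    then have *: "fst (x i) = fst (x j)" "marking (c \<circ> Suc) = marking (if i = j then c else (\<lambda>_. snd (x i) l))"
      using \<omega>_colour by auto
    then have "i = j"
      using inj_onD[OF inj _ i(1) j(1)] by simp
    with * mark_neq show False
      by simp
  qed
  then have "\<tau> = x j"
    using j by (auto simp: prod_eq_iff)
  with j show ?thesis by blast
qed

text \<open>The tuple \<open>w\<close> carries \<open>x\<close> and \<open>t \<circ> x\<close> at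
  once. On the support of \<open>\<Phi> w\<close>, which consists of entries of \<open>w\<close>,
  the map \<open>right\<close> equals \<open>t \<circ> left\<close>. So the arbitrary
  \<open>t\<close> is traded for two basic maps.\<close>

theorem equivariant:
  assumes x: "x ` Z \<subseteq> points S" and t: "t \<in> selfmaps (points S)"
  shows "\<Phi> (t \<circ> x) = act t (\<Phi> x)"
proof -
  \<comment> \<open>Entries of \<open>x\<close> may share a colour. The tags make the colours of
    \<open>w\<close> distinct, as \<open>supp_tuple_distinct\<close> requires.\<close>
  obtain tag :: "'i \<Rightarrow> nat" where tag: "inj_on tag Z"
    using finite_imp_inj_to_nat_seg[OF Z(1)] by blast
  define w where "w = (\<lambda>i. (prod_encode (tag i, prod_encode (fst (x i), fst (t (x i)))),
    interleave (snd (x i)) (snd (t (x i)))))"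
  have tx: "t (x i) \<in> points S" "x i \<in> points S" if "i \<in> Z" for i
    using x t that by (auto intro: selfmaps_in)
  have w: "w ` Z \<subseteq> points S"
    using tx by (auto simp: w_def points_def interleave_def image_subset_iff)
  have lw: "left \<circ> w = x" and rw: "right \<circ> w = t \<circ> x"
    by (auto simp: w_def)
  have "inj_on (fst \<circ> w) Z"
    using tag by (auto simp: w_def inj_on_def)
  then have supp_w: "supp (\<Phi> w) \<subseteq> w ` Z"
    using supp_tuple_distinct[OF w] by blast
  let ?l = "fix_outside (points S) left" and ?r = "fix_outside (points S) right"
  have lr: "?l \<in> selfmaps (points S)" "?r \<in> selfmaps (points S)"
    by (intro basics_selfmaps; simp)+
  have "\<Phi> (t \<circ> x) = act ?r (\<Phi> w)"
    using \<Phi>_basics[OF _ w, of right] rw by simp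
  also have "\<dots> = act (t \<circ> ?l) (\<Phi> w)"
  proof (rule supportsD[OF supports_supp[OF \<Phi>_closed[OF w]]])
    fix y assume "y \<in> supp (\<Phi> w)"
    then obtain i where i: "i \<in> Z" "y = w i"
      using supp_w by blast
    then show "?r y = (t \<circ> ?l) y"
      using w lw[THEN fun_cong, of i] rw[THEN fun_cong, of i] by (simp add: image_subset_iff)
  qed (use lr t in auto)
  also have "\<dots> = act t (act ?l (\<Phi> w))"
    using lr t \<Phi>_closed[OF w] by (simp add: act_comp)
  also have "act ?l (\<Phi> w) = \<Phi> x"
    using \<Phi>_basics[OF _ w, of left] lw by simp
  finally show ?thesis .
qed

end

section \<open>Equivalences and adjunctions\<close>

lemma HomD:
  assumes "f \<in> Hom C x y" shows "f \<in> Arr C" "Dom C f = x" "Cod C f = y"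
  using assms by (simp_all add: Hom_def)

lemma Arr_Hom: "f \<in> Arr C \<Longrightarrow> f \<in> Hom C (Dom C f) (Cod C f)"
  by (simp add: Hom_def)

lemma (in category) Hom_Obj: "f \<in> Hom C x y \<Longrightarrow> x \<in> Obj C \<and> y \<in> Obj C"
  using Dom_Obj Cod_Obj by (auto simp: Hom_def)

lemma is_functorI:
  assumes "\<And>x. x \<in> Obj C \<Longrightarrow> FObj F x \<in> Obj D"
    and "\<And>f x y. f \<in> Hom C x y \<Longrightarrow> x \<in> Obj C \<Longrightarrow> y \<in> Obj C \<Longrightarrow> FArr F f \<in> Hom D (FObj F x) (FObj F y)"
    and "\<And>x. x \<in> Obj C \<Longrightarrow> FArr F (Ident C x) = Ident D (FObj F x)"
    and "\<And>f g x y z. f \<in> Hom C x y \<Longrightarrow> g \<in> Hom C y z \<Longrightarrow>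
      FArr F (Comp C g f) = Comp D (FArr F g) (FArr F f)"
    and "category C"
  shows "is_functor C D F"
  unfolding is_functor_def using assms(1,3) 
proof (intro conjI ballI impI; blast?)
  interpret category C by fact
  fix f assume f: "f \<in> Arr C"
  then show "FArr F f \<in> Hom D (FObj F (Dom C f)) (FObj F (Cod C f))"
    by (intro assms(2)) (auto intro: Dom_Obj Cod_Obj simp: Hom_def)
  fix g assume "g \<in> Arr C" "Dom C g = Cod C f"
  with f show "FArr F (Comp C g f) = Comp D (FArr F g) (FArr F f)"
    by (intro assms(4)[of f _ _ g]) (auto simp: Hom_def)
qed

lemma is_functor_Obj: "is_functor C D F \<Longrightarrow> x \<in> Obj C \<Longrightarrow> FObj F x \<in> Obj D"
  by (simp add: is_functor_def)

lemma is_functor_Hom: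
  "is_functor C D F \<Longrightarrow> f \<in> Hom C x y \<Longrightarrow> FArr F f \<in> Hom D (FObj F x) (FObj F y)"
  by (auto simp: is_functor_def Hom_def)

lemma is_functor_Ident:
  "is_functor C D F \<Longrightarrow> x \<in> Obj C \<Longrightarrow> FArr F (Ident C x) = Ident D (FObj F x)"
  by (simp add: is_functor_def)

lemma is_functor_Comp:
  "is_functor C D F \<Longrightarrow> f \<in> Hom C x y \<Longrightarrow> g \<in> Hom C y z \<Longrightarrow>
    FArr F (Comp C g f) = Comp D (FArr F g) (FArr F f)"
  by (simp add: is_functor_def Hom_def)

lemma comp_fctr_simps [simp]:
  "FObj (comp_fctr G F) x = FObj G (FObj F x)" "FArr (comp_fctr G F) f = FArr G (FArr F f)"
  by (simp_all add: comp_fctr_def)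

lemma id_fctr_simps [simp]: "FObj id_fctr x = x" "FArr id_fctr f = f"
  by (simp_all add: id_fctr_def)

lemma is_functor_id: "category C \<Longrightarrow> is_functor C C id_fctr"
  by (rule is_functorI) simp_all

lemma is_functor_comp:
  "category C \<Longrightarrow> is_functor C D F \<Longrightarrow> is_functor D E G \<Longrightarrow> is_functor C E (comp_fctr G F)"
  by (rule is_functorI)
    (auto simp: is_functor_Obj is_functor_Ident intro: is_functor_Hom
      is_functor_Comp[THEN trans[OF arg_cong[of _ _ "FArr G"] is_functor_Comp]])

lemma fully_faithful_comp:
  assumes "is_functor C D F" "fully_faithful C D F" "fully_faithful D E G"
  shows "fully_faithful C E (comp_fctr G F)"
  unfolding fully_faithful_def
proof (intro ballI)
  fix x y assume "x \<in> Obj C" "y \<in> Obj C"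
  then have "bij_betw (FArr G \<circ> FArr F) (Hom C x y) (Hom E (FObj G (FObj F x)) (FObj G (FObj F y)))"
    using assms is_functor_Obj[OF assms(1)]
    by (intro bij_betw_trans[of _ _ "Hom D (FObj F x) (FObj F y)"]) (auto simp: fully_faithful_def)
  then show "bij_betw (FArr (comp_fctr G F)) (Hom C x y)
      (Hom E (FObj (comp_fctr G F) x) (FObj (comp_fctr G F) y))"
    by (simp add: comp_fctr_def)
qed

lemma iso_arrI:
  "f \<in> Hom C x y \<Longrightarrow> g \<in> Hom C y x \<Longrightarrow> Comp C g f = Ident C x \<Longrightarrow> Comp C f g = Ident C y \<Longrightarrow>
    iso_arr C f"
  unfolding iso_arr_def by (auto simp: Hom_def)

lemma iso_arrE:
  assumes "iso_arr C f" "f \<in> Hom C x y"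
  obtains g where "g \<in> Hom C y x" "Comp C g f = Ident C x" "Comp C f g = Ident C y"
  using assms unfolding iso_arr_def by (auto simp: Hom_def)

lemma nat_transD:
  "nat_trans C D F G \<eta> \<Longrightarrow> x \<in> Obj C \<Longrightarrow> \<eta> x \<in> Hom D (FObj F x) (FObj G x)"
  by (simp add: nat_trans_def)

lemma nat_trans_natural:
  "nat_trans C D F G \<eta> \<Longrightarrow> f \<in> Hom C x y \<Longrightarrow> Comp D (\<eta> y) (FArr F f) = Comp D (FArr G f) (\<eta> x)"
  by (auto simp: nat_trans_def Hom_def)

lemma nat_transI:
  assumes "\<And>x. x \<in> Obj C \<Longrightarrow> \<eta> x \<in> Hom D (FObj F x) (FObj G x)"
    and "\<And>f x y. f \<in> Hom C x y \<Longrightarrow> Comp D (\<eta> y) (FArr F f) = Comp D (FArr G f) (\<eta> x)"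
  shows "nat_trans C D F G \<eta>"
  unfolding nat_trans_def using assms Arr_Hom by fast

lemma nat_isomorphic_sym:
  assumes "nat_isomorphic C D F G" "category C" "category D" "is_functor C D F" "is_functor C D G"
  shows "nat_isomorphic C D G F"
proof -
  interpret C: category C by fact
  interpret D: category D by fact
  obtain \<eta> where \<eta>: "nat_trans C D F G \<eta>" "\<And>x. x \<in> Obj C \<Longrightarrow> iso_arr D (\<eta> x)"
    using assms by (auto simp: nat_isomorphic_def)
  have "\<exists>g. g \<in> Hom D (FObj G x) (FObj F x) \<and> Comp D g (\<eta> x) = Ident D (FObj F x) \<and>
      Comp D (\<eta> x) g = Ident D (FObj G x)" if "x \<in> Obj C" for x
    using iso_arrE[OF \<eta>(2) nat_transD[OF \<eta>(1)]] that by metis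
  then obtain \<theta> where \<theta>: "\<And>x. x \<in> Obj C \<Longrightarrow> \<theta> x \<in> Hom D (FObj G x) (FObj F x)"
    "\<And>x. x \<in> Obj C \<Longrightarrow> Comp D (\<theta> x) (\<eta> x) = Ident D (FObj F x)"
    "\<And>x. x \<in> Obj C \<Longrightarrow> Comp D (\<eta> x) (\<theta> x) = Ident D (FObj G x)"
    by metis
  have "nat_trans C D G F \<theta>"
  proof (rule nat_transI)
    fix f x y assume f: "f \<in> Hom C x y"
    then have xy: "x \<in> Obj C" "y \<in> Obj C"
      using C.Hom_Obj by auto
    note [simp] = D.Comp_assoc[symmetric]
    have Ff: "FArr F f \<in> Hom D (FObj F x) (FObj F y)" and Gf: "FArr G f \<in> Hom D (FObj G x) (FObj G y)"
      using is_functor_Hom[OF assms(4) f] is_functor_Hom[OF assms(5) f] by simp_all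
    have \<eta>H: "\<eta> x \<in> Hom D (FObj F x) (FObj G x)" "\<eta> y \<in> Hom D (FObj F y) (FObj G y)"
      using \<eta>(1) xy nat_transD by fast+
    have "Comp D (\<theta> y) (FArr G f) = Comp D (\<theta> y) (Comp D (FArr G f) (Comp D (\<eta> x) (\<theta> x)))"
      using \<theta>(3)[OF xy(1)] D.Comp_Ident[OF Gf] by simp
    also have "Comp D (FArr G f) (Comp D (\<eta> x) (\<theta> x)) = Comp D (Comp D (\<eta> y) (FArr F f)) (\<theta> x)"
      using D.Comp_assoc[OF \<theta>(1)[OF xy(1)] \<eta>H(1) Gf] nat_trans_natural[OF \<eta>(1) f] by simp
    also have "\<dots> = Comp D (\<eta> y) (Comp D (FArr F f) (\<theta> x))"
      using D.Comp_assoc[OF \<theta>(1)[OF xy(1)] Ff \<eta>H(2)] by simp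
    also have "Comp D (\<theta> y) \<dots> = Comp D (FArr F f) (\<theta> x)"
      using D.Comp_assoc[OF D.Comp_Hom[OF \<theta>(1)[OF xy(1)] Ff] \<eta>H(2) \<theta>(1)[OF xy(2)]] \<theta>(2)[OF xy(2)]
        D.Ident_Comp[OF D.Comp_Hom[OF \<theta>(1)[OF xy(1)] Ff]] by simp
    finally show "Comp D (\<theta> y) (FArr G f) = Comp D (FArr F f) (\<theta> x)" .
  qed (rule \<theta>)
  moreover have "iso_arr D (\<theta> x)" if "x \<in> Obj C" for x
    using \<theta> that nat_transD[OF \<eta>(1) that] by (intro iso_arrI) auto
  ultimately show ?thesis
    by (auto simp: nat_isomorphic_def)
qed

text \<open>A right adjoint can be given object by object through universal arrows. Two instances
  occur: the counit of restriction, and the isomorphisms that witness essential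
  surjectivity.\<close>

locale universal_arrows =
  C: category C + D: category D
  for C :: "('o1, 'a1) cat" and D :: "('o2, 'a2) cat" +
  fixes L :: "('o1, 'a1, 'o2, 'a2) fctr" and r :: "'o2 \<Rightarrow> 'o1" and \<epsilon> :: "'o2 \<Rightarrow> 'a2"
  assumes L: "is_functor C D L"
    and r: "y \<in> Obj D \<Longrightarrow> r y \<in> Obj C"
    and \<epsilon>: "y \<in> Obj D \<Longrightarrow> \<epsilon> y \<in> Hom D (FObj L (r y)) y"
    and universal: "y \<in> Obj D \<Longrightarrow> x \<in> Obj C \<Longrightarrow> h \<in> Hom D (FObj L x) y \<Longrightarrow>
      \<exists>!k. k \<in> Hom C x (r y) \<and> Comp D (\<epsilon> y) (FArr L k) = h"
begin

definition lift :: "'o1 \<Rightarrow> 'o2 \<Rightarrow> 'a2 \<Rightarrow> 'a1" where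
  "lift x y h = (THE k. k \<in> Hom C x (r y) \<and> Comp D (\<epsilon> y) (FArr L k) = h)"

lemma lift:
  assumes "y \<in> Obj D" "x \<in> Obj C" "h \<in> Hom D (FObj L x) y"
  shows "lift x y h \<in> Hom C x (r y)" "Comp D (\<epsilon> y) (FArr L (lift x y h)) = h"
  using theI'[OF universal[OF assms]] by (simp_all add: lift_def)

text \<open>The uniqueness half of universality. Functoriality of \<open>R\<close>, naturality of
  the unit and one triangle identity are obtained by cancelling \<open>\<epsilon>\<close>.\<close>

lemma \<epsilon>_cancel:
  assumes "y \<in> Obj D" "k \<in> Hom C x (r y)" "k' \<in> Hom C x (r y)"
    and "Comp D (\<epsilon> y) (FArr L k) = Comp D (\<epsilon> y) (FArr L k')"
  shows "k = k'"
proof -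
  have "Comp D (\<epsilon> y) (FArr L k') \<in> Hom D (FObj L x) y"
    using assms \<epsilon> is_functor_Hom[OF L] D.Comp_Hom by blast
  then show ?thesis
    using universal[OF assms(1)] assms C.Hom_Obj by blast
qed

definition R :: "('o2, 'a2, 'o1, 'a1) fctr" where
  "R = \<lparr>FObj = r, FArr = (\<lambda>f. lift (r (Dom D f)) (Cod D f) (Comp D f (\<epsilon> (Dom D f))))\<rparr>"

definition \<eta> :: "'o1 \<Rightarrow> 'a1" where
  "\<eta> x = lift x (FObj L x) (Ident D (FObj L x))"

lemma R_Obj [simp]: "FObj R y = r y"
  by (simp add: R_def)

lemma R_Arr:
  assumes "f \<in> Hom D y y'"
  shows "FArr R f \<in> Hom C (r y) (r y')" "Comp D (\<epsilon> y') (FArr L (FArr R f)) = Comp D f (\<epsilon> y)"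
proof -
  have y: "y \<in> Obj D" "y' \<in> Obj D"
    using assms D.Hom_Obj by auto
  have "FArr R f = lift (r y) y' (Comp D f (\<epsilon> y))"
    using HomD[OF assms] by (simp add: R_def)
  then show "FArr R f \<in> Hom C (r y) (r y')" "Comp D (\<epsilon> y') (FArr L (FArr R f)) = Comp D f (\<epsilon> y)"
    using lift[OF y(2) r[OF y(1)] D.Comp_Hom[OF \<epsilon>[OF y(1)] assms]] by simp_all
qed

lemma L_Comp: "f \<in> Hom C x y \<Longrightarrow> g \<in> Hom C y z \<Longrightarrow> FArr L (Comp C g f) = Comp D (FArr L g) (FArr L f)"
  using L is_functor_Comp by fast

lemmas L_Hom = is_functor_Hom[OF L]
  and L_Obj = is_functor_Obj[OF L]

lemma is_functor_R: "is_functor D C R"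
proof (rule is_functorI)
  fix y assume y: "y \<in> Obj D"
  show "FArr R (Ident D y) = Ident C (FObj R y)"
  proof (rule \<epsilon>_cancel[OF y])
    show "FArr R (Ident D y) \<in> Hom C (r y) (r y)" "Ident C (FObj R y) \<in> Hom C (r y) (r y)"
      using R_Arr(1)[OF D.Ident_Hom[OF y]] C.Ident_Hom[OF r[OF y]] by simp_all
    show "Comp D (\<epsilon> y) (FArr L (FArr R (Ident D y))) = Comp D (\<epsilon> y) (FArr L (Ident C (FObj R y)))"
      using R_Arr(2)[OF D.Ident_Hom[OF y]] D.Ident_Comp[OF \<epsilon>[OF y]] D.Comp_Ident[OF \<epsilon>[OF y]]
        is_functor_Ident[OF L r[OF y]] by simp
  qed
next
  fix f g x y z assume fg: "f \<in> Hom D x y" "g \<in> Hom D y z"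
  then have z: "z \<in> Obj D" "y \<in> Obj D" "x \<in> Obj D"
    using D.Hom_Obj by auto
  note RL = R_Arr[OF fg(1)] R_Arr[OF fg(2)]
  note C = R_Arr[OF D.Comp_Hom[OF fg]]
  show "FArr R (Comp D g f) = Comp C (FArr R g) (FArr R f)"
  proof (rule \<epsilon>_cancel[OF z(1)])
    show "Comp C (FArr R g) (FArr R f) \<in> Hom C (r x) (r z)"
      using RL C.Comp_Hom by blast
    have "Comp D (\<epsilon> z) (FArr L (Comp C (FArr R g) (FArr R f))) =
        Comp D (Comp D (\<epsilon> z) (FArr L (FArr R g))) (FArr L (FArr R f))"
      using L_Comp[OF RL(1,3)] D.Comp_assoc[OF L_Hom[OF RL(1)] L_Hom[OF RL(3)] \<epsilon>[OF z(1)]] by simp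
    also have "\<dots> = Comp D g (Comp D (\<epsilon> y) (FArr L (FArr R f)))"
      using D.Comp_assoc[OF L_Hom[OF RL(1)] \<epsilon>[OF z(2)] fg(2)] RL(4) by simp
    also have "\<dots> = Comp D (Comp D g f) (\<epsilon> x)"
      using D.Comp_assoc[OF \<epsilon>[OF z(3)] fg] RL(2) by simp
    finally show "Comp D (\<epsilon> z) (FArr L (FArr R (Comp D g f))) =
        Comp D (\<epsilon> z) (FArr L (Comp C (FArr R g) (FArr R f)))"
      using C by simp
  qed (use C in simp)
qed (auto simp: r D.category_axioms intro: R_Arr)

lemma \<eta>:
  assumes "x \<in> Obj C"
  shows "\<eta> x \<in> Hom C x (r (FObj L x))" "Comp D (\<epsilon> (FObj L x)) (FArr L (\<eta> x)) = Ident D (FObj L x)"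
  using lift[OF L_Obj[OF assms] assms D.Ident_Hom[OF L_Obj[OF assms]]] by (simp_all add: \<eta>_def)

lemma nat_trans_\<epsilon>: "nat_trans D D (comp_fctr L R) id_fctr \<epsilon>"
  by (rule nat_transI) (simp_all add: \<epsilon> R_Arr)

lemma nat_trans_\<eta>: "nat_trans C C id_fctr (comp_fctr R L) \<eta>"
proof (rule nat_transI)
  fix f x y assume f: "f \<in> Hom C x y"
  then have xy: "x \<in> Obj C" "y \<in> Obj C"
    using C.Hom_Obj by auto
  note Lf = L_Hom[OF f] and RLf = R_Arr[OF L_Hom[OF f]]
  have "Comp C (\<eta> y) f = Comp C (FArr R (FArr L f)) (\<eta> x)"
  proof (rule \<epsilon>_cancel[OF L_Obj[OF xy(2)]])
    show "Comp C (\<eta> y) f \<in> Hom C x (r (FObj L y))"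
      using f \<eta>(1)[OF xy(2)] C.Comp_Hom by blast
    show "Comp C (FArr R (FArr L f)) (\<eta> x) \<in> Hom C x (r (FObj L y))"
      using RLf(1) \<eta>(1)[OF xy(1)] C.Comp_Hom by blast
    have "Comp D (\<epsilon> (FObj L y)) (FArr L (Comp C (\<eta> y) f)) =
        Comp D (Comp D (\<epsilon> (FObj L y)) (FArr L (\<eta> y))) (FArr L f)"
      using L_Comp[OF f \<eta>(1)[OF xy(2)]]
        D.Comp_assoc[OF Lf L_Hom[OF \<eta>(1)[OF xy(2)]] \<epsilon>[OF L_Obj[OF xy(2)]]] by simp
    also have "\<dots> = FArr L f"
      using \<eta>(2)[OF xy(2)] D.Ident_Comp[OF Lf] by simp
    also have "\<dots> = Comp D (FArr L f) (Comp D (\<epsilon> (FObj L x)) (FArr L (\<eta> x)))"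
      using \<eta>(2)[OF xy(1)] D.Comp_Ident[OF Lf] by simp
    also have "\<dots> = Comp D (Comp D (\<epsilon> (FObj L y)) (FArr L (FArr R (FArr L f)))) (FArr L (\<eta> x))"
      using RLf(2) D.Comp_assoc[OF L_Hom[OF \<eta>(1)[OF xy(1)]] \<epsilon>[OF L_Obj[OF xy(1)]] Lf] by simp
    also have "\<dots> = Comp D (\<epsilon> (FObj L y)) (FArr L (Comp C (FArr R (FArr L f)) (\<eta> x)))"
      using L_Comp[OF \<eta>(1)[OF xy(1)] RLf(1)]
        D.Comp_assoc[OF L_Hom[OF \<eta>(1)[OF xy(1)]] L_Hom[OF RLf(1)] \<epsilon>[OF L_Obj[OF xy(2)]]] by simp
    finally show "Comp D (\<epsilon> (FObj L y)) (FArr L (Comp C (\<eta> y) f)) =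
      Comp D (\<epsilon> (FObj L y)) (FArr L (Comp C (FArr R (FArr L f)) (\<eta> x)))" .
  qed
  then show "Comp C (\<eta> y) (FArr id_fctr f) = Comp C (FArr (comp_fctr R L) f) (\<eta> x)"
    by simp
qed (simp add: \<eta>)

lemma triangle:
  assumes y: "y \<in> Obj D" shows "Comp C (FArr R (\<epsilon> y)) (\<eta> (r y)) = Ident C (r y)"
proof (rule \<epsilon>_cancel[OF y])
  note e = \<epsilon>[OF y] and Re = R_Arr[OF \<epsilon>[OF y]] and h = \<eta>[OF r[OF y]]
  show "Comp C (FArr R (\<epsilon> y)) (\<eta> (r y)) \<in> Hom C (r y) (r y)"
    using Re(1) h(1) C.Comp_Hom by blast
  show "Ident C (r y) \<in> Hom C (r y) (r y)"
    using C.Ident_Hom r y by blast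
  have "Comp D (\<epsilon> y) (FArr L (Comp C (FArr R (\<epsilon> y)) (\<eta> (r y)))) =
      Comp D (Comp D (\<epsilon> y) (FArr L (FArr R (\<epsilon> y)))) (FArr L (\<eta> (r y)))"
    using L_Comp[OF h(1) Re(1)] D.Comp_assoc[OF L_Hom[OF h(1)] L_Hom[OF Re(1)] e] by simp
  also have "\<dots> = Comp D (\<epsilon> y) (Comp D (\<epsilon> (FObj L (r y))) (FArr L (\<eta> (r y))))"
    using Re(2) D.Comp_assoc[OF L_Hom[OF h(1)] \<epsilon>[OF L_Obj[OF r[OF y]]] e] by simp
  also have "\<dots> = Comp D (\<epsilon> y) (FArr L (Ident C (r y)))"
    using h(2) is_functor_Ident[OF L r[OF y]] by simp
  finally show "Comp D (\<epsilon> y) (FArr L (Comp C (FArr R (\<epsilon> y)) (\<eta> (r y)))) =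
      Comp D (\<epsilon> y) (FArr L (Ident C (r y)))" .
qed

theorem adjunction: "adjunction C D L R"
  unfolding adjunction_def
  using L is_functor_R nat_trans_\<eta> nat_trans_\<epsilon> \<eta>(2) triangle
  by (intro conjI exI[of _ \<eta>] exI[of _ \<epsilon>]) auto

end

text \<open>For fully faithful \<open>F\<close> the chosen isomorphisms \<open>\<epsilon>\<close>
  are universal arrows, so \<open>universal_arrows\<close> supplies the pseudo-inverse. Its unit at
  \<open>x\<close> is inverted by the arrow that \<open>F\<close> sends to the component of
  \<open>\<epsilon>\<close> at the image of \<open>x\<close>.\<close>

lemma equivalence_if_essentially_surjective:
  assumes "category C" "category D" "is_functor C D F" "fully_faithful C D F"
    and "\<And>y. y \<in> Obj D \<Longrightarrow> \<exists>x\<in>Obj C. \<exists>i\<in>Hom D (FObj F x) y. iso_arr D i"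
  shows "\<exists>G. equivalence C D F G"
proof -
  interpret C: category C by fact
  interpret D: category D by fact
  obtain r \<epsilon> where r: "\<And>y. y \<in> Obj D \<Longrightarrow> r y \<in> Obj C"
    and \<epsilon>: "\<And>y. y \<in> Obj D \<Longrightarrow> \<epsilon> y \<in> Hom D (FObj F (r y)) y"
    and iso: "\<And>y. y \<in> Obj D \<Longrightarrow> iso_arr D (\<epsilon> y)"
    using assms(5) by metis
  have ff: "bij_betw (FArr F) (Hom C x y) (Hom D (FObj F x) (FObj F y))"
    if "x \<in> Obj C" "y \<in> Obj C" for x y
    using assms(4) that by (simp add: fully_faithful_def)
  interpret universal_arrows C D F r \<epsilon>
  proof
    fix y x h assume yxh: "y \<in> Obj D" "x \<in> Obj C" "h \<in> Hom D (FObj F x) y"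
    obtain \<delta> where \<delta>: "\<delta> \<in> Hom D y (FObj F (r y))" "Comp D \<delta> (\<epsilon> y) = Ident D (FObj F (r y))"
      "Comp D (\<epsilon> y) \<delta> = Ident D y"
      using iso_arrE[OF iso \<epsilon>] yxh(1) by metis
    have "Comp D \<delta> h \<in> Hom D (FObj F x) (FObj F (r y))"
      using \<delta>(1) yxh(3) D.Comp_Hom by blast
    then obtain k where k: "k \<in> Hom C x (r y)" "FArr F k = Comp D \<delta> h"
      using bij_betw_imp_surj_on[OF ff[OF yxh(2) r[OF yxh(1)]]] by (metis imageE)
    have "Comp D (\<epsilon> y) (FArr F k) = h"
      using k(2) D.Comp_assoc[OF yxh(3) \<delta>(1) \<epsilon>[OF yxh(1)]] \<delta>(3) D.Ident_Comp[OF yxh(3)] by simp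
    moreover have "k' = k" if "k' \<in> Hom C x (r y)" "Comp D (\<epsilon> y) (FArr F k') = h" for k'
    proof -
      have Fk': "FArr F k' \<in> Hom D (FObj F x) (FObj F (r y))"
        using that(1) assms(3) is_functor_Hom by fast
      have "FArr F k' = Comp D \<delta> (Comp D (\<epsilon> y) (FArr F k'))"
        using D.Comp_assoc[OF Fk' \<epsilon>[OF yxh(1)] \<delta>(1)] \<delta>(2) D.Ident_Comp[OF Fk'] by simp
      then have "FArr F k' = FArr F k"
        using that(2) k(2) by simp
      then show ?thesis
        using ff[OF yxh(2) r[OF yxh(1)]] that(1) k(1) by (auto simp: bij_betw_def inj_on_def)
    qed
    ultimately show "\<exists>!k. k \<in> Hom C x (r y) \<and> Comp D (\<epsilon> y) (FArr F k) = h"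
      using k(1) by blast
  qed (use assms r \<epsilon> in auto)
  have "iso_arr C (\<eta> x)" if x: "x \<in> Obj C" for x
  proof -
    let ?y = "FObj F x"
    have y: "?y \<in> Obj D" "r ?y \<in> Obj C"
      using x r L_Obj by auto
    obtain k where k: "k \<in> Hom C (r ?y) x" "FArr F k = \<epsilon> ?y"
      using bij_betw_imp_surj_on[OF ff[OF y(2) x]] \<epsilon>[OF y(1)] by (metis imageE)
    have inj: "inj_on (FArr F) (Hom C x x)" "inj_on (FArr F) (Hom C (r ?y) (r ?y))"
      using ff x y by (auto simp: bij_betw_def)
    note h = \<eta>[OF x] and Fh = L_Hom[OF \<eta>(1)[OF x]]
    have kh: "Comp C k (\<eta> x) = Ident C x"
    proof (rule inj_onD[OF inj(1)])
      show "FArr F (Comp C k (\<eta> x)) = FArr F (Ident C x)"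
        using L_Comp[OF h(1) k(1)] k(2) h(2) is_functor_Ident[OF L x] by simp
    qed (use h(1) k(1) C.Comp_Hom C.Ident_Hom x in auto)
    obtain \<delta> where \<delta>: "\<delta> \<in> Hom D ?y (FObj F (r ?y))" "Comp D \<delta> (\<epsilon> ?y) = Ident D (FObj F (r ?y))"
      using iso_arrE[OF iso \<epsilon>] y(1) by metis
    have "\<delta> = Comp D \<delta> (Comp D (\<epsilon> ?y) (FArr F (\<eta> x)))"
      using h(2) D.Comp_Ident[OF \<delta>(1)] by simp
    also have "\<dots> = FArr F (\<eta> x)"
      using D.Comp_assoc[OF Fh \<epsilon>[OF y(1)] \<delta>(1)] \<delta>(2) D.Ident_Comp[OF Fh] by simp
    finally have \<delta>_eq: "FArr F (\<eta> x) = \<delta>" ..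
    have "Comp C (\<eta> x) k = Ident C (r ?y)"
    proof (rule inj_onD[OF inj(2)])
      show "FArr F (Comp C (\<eta> x) k) = FArr F (Ident C (r ?y))"
        using L_Comp[OF k(1) h(1)] k(2) \<delta>_eq \<delta>(2) is_functor_Ident[OF L y(2)] by simp
    qed (use h(1) k(1) C.Comp_Hom C.Ident_Hom y in auto)
    then show ?thesis
      using kh h(1) k(1) by (intro iso_arrI)
  qed
  then have "nat_isomorphic C C id_fctr (comp_fctr R F)"
    using nat_trans_\<eta> by (auto simp: nat_isomorphic_def)
  then have "nat_isomorphic C C (comp_fctr R F) id_fctr"
    by (rule nat_isomorphic_sym[OF _ assms(1,1) is_functor_id[OF assms(1)]
          is_functor_comp[OF assms(1,3) is_functor_R]])
  moreover have "nat_isomorphic D D (comp_fctr F R) id_fctr"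
    using nat_trans_\<epsilon> iso by (auto simp: nat_isomorphic_def)
  ultimately show ?thesis
    using assms(3) is_functor_R by (auto simp: equivalence_def)
qed

section \<open>Encoding a category in the universe\<close>

text \<open>Topoi and their sites are required to have objects and arrows in \<open>'u\<close>,
  whereas the categories constructed here live on other types. Both the topos and its site are
  replaced by such copies, and \<open>decoding\<close> is an isomorphism from the copy to the
  original once the codes are injective.\<close>

definition coded :: "('o, 'a) cat \<Rightarrow> ('o \<Rightarrow> 'p) \<Rightarrow> ('a \<Rightarrow> 'b) \<Rightarrow> ('p, 'b) cat" where
  "coded K eo ea = \<lparr>
     Obj = eo ` Obj K,
     Arr = ea ` Arr K,
     Dom = (\<lambda>f. eo (Dom K (inv_into (Arr K) ea f))),
     Cod = (\<lambda>f. eo (Cod K (inv_into (Arr K) ea f))),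
     Ident = (\<lambda>x. ea (Ident K (inv_into (Obj K) eo x))),
     Comp = (\<lambda>g f. ea (Comp K (inv_into (Arr K) ea g) (inv_into (Arr K) ea f)))\<rparr>"

definition decoding ::
  "('o, 'a) cat \<Rightarrow> ('o \<Rightarrow> 'p) \<Rightarrow> ('a \<Rightarrow> 'b) \<Rightarrow> ('p, 'b, 'o, 'a) fctr" where
  "decoding K eo ea = \<lparr>FObj = inv_into (Obj K) eo, FArr = inv_into (Arr K) ea\<rparr>"

locale coding = category K for K :: "('o, 'a) cat" +
  fixes eo :: "'o \<Rightarrow> 'p" and ea :: "'a \<Rightarrow> 'b"
  assumes inj_eo: "inj_on eo (Obj K)" and inj_ea: "inj_on ea (Arr K)"
begin

abbreviation "CK \<equiv> coded K eo ea"
abbreviation "dec \<equiv> decoding K eo ea"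

lemma Obj_coded [simp]: "Obj CK = eo ` Obj K"
  and Arr_coded: "Arr CK = ea ` Arr K"
  by (simp_all add: coded_def)

lemma dec_Obj [simp]: "x \<in> Obj K \<Longrightarrow> FObj dec (eo x) = x"
  by (simp add: decoding_def inj_eo)

lemma dec_Arr [simp]: "f \<in> Arr K \<Longrightarrow> FArr dec (ea f) = f"
  by (simp add: decoding_def inj_ea)

lemma Hom_coded: "x \<in> Obj K \<Longrightarrow> y \<in> Obj K \<Longrightarrow> Hom CK (eo x) (eo y) = ea ` Hom K x y"
  by (auto simp: Hom_def coded_def inj_ea Dom_Obj Cod_Obj inj_on_eq_iff[OF inj_eo])

lemma Hom_codedE:
  assumes "f \<in> Hom CK x y"
  obtains x' y' f' where "x' \<in> Obj K" "y' \<in> Obj K" "f' \<in> Hom K x' y'" "x = eo x'" "y = eo y'" "f = ea f'"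
  using assms by (auto simp: Hom_def coded_def inj_ea Dom_Obj Cod_Obj)

lemma Ident_coded: "x \<in> Obj K \<Longrightarrow> Ident CK (eo x) = ea (Ident K x)"
  by (simp add: coded_def inj_eo)

lemma Comp_coded: "f \<in> Arr K \<Longrightarrow> g \<in> Arr K \<Longrightarrow> Comp CK (ea g) (ea f) = ea (Comp K g f)"
  by (simp add: coded_def inj_ea)

lemma category_coded: "category CK"
proof
  fix f assume "f \<in> Arr CK"
  then show "Dom CK f \<in> Obj CK" "Cod CK f \<in> Obj CK"
    by (auto simp: coded_def inj_ea Dom_Obj Cod_Obj)
next
  fix x assume "x \<in> Obj CK"
  then show "Ident CK x \<in> Hom CK x x"
    by (auto simp: Ident_coded Hom_coded Ident_Hom)
next
  fix f g x y z assume f: "f \<in> Hom CK x y" and g: "g \<in> Hom CK y z"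
  obtain x' y' f' where f': "x' \<in> Obj K" "y' \<in> Obj K" "f' \<in> Hom K x' y'" "x = eo x'" "y = eo y'" "f = ea f'"
    using f by (rule Hom_codedE)
  obtain y'' z' g' where g': "y'' \<in> Obj K" "z' \<in> Obj K" "g' \<in> Hom K y'' z'" "y = eo y''" "z = eo z'" "g = ea g'"
    using g by (rule Hom_codedE)
  have "y'' = y'"
    using f' g' inj_eo by (auto dest: inj_onD)
  then show "Comp CK g f \<in> Hom CK x z"
    using f' g' Comp_Hom by (simp add: Comp_coded Hom_coded HomD)
next
  fix f x y assume f: "f \<in> Hom CK x y"
  obtain x' y' f' where f': "x' \<in> Obj K" "y' \<in> Obj K" "f' \<in> Hom K x' y'" "x = eo x'" "y = eo y'" "f = ea f'"
    using f by (rule Hom_codedE)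
  then show "Comp CK f (Ident CK x) = f" "Comp CK (Ident CK y) f = f"
    using Ident_Hom by (simp_all add: Ident_coded Comp_coded HomD(1)[OF f'(3)] HomD(1)[OF Ident_Hom]
      Comp_Ident[OF f'(3)] Ident_Comp[OF f'(3)])
next
  fix f g h w x y z assume f: "f \<in> Hom CK w x" and g: "g \<in> Hom CK x y" and h: "h \<in> Hom CK y z"
  obtain w' x' f' where f': "x' \<in> Obj K" "f' \<in> Hom K w' x'" "x = eo x'" "f = ea f'"
    using f by (rule Hom_codedE)
  obtain x'' y' g' where g': "x'' \<in> Obj K" "y' \<in> Obj K" "g' \<in> Hom K x'' y'" "x = eo x''" "y = eo y'" "g = ea g'"
    using g by (rule Hom_codedE)
  obtain y'' z' h' where h': "y'' \<in> Obj K" "h' \<in> Hom K y'' z'" "y = eo y''" "h = ea h'"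
    using h by (rule Hom_codedE)
  have eq: "x'' = x'" "y'' = y'"
    using f' g' h' inj_eo by (auto dest: inj_onD)
  have hom: "f' \<in> Hom K w' x'" "g' \<in> Hom K x' y'" "h' \<in> Hom K y' z'"
    using f' g' h' eq by auto
  show "Comp CK h (Comp CK g f) = Comp CK (Comp CK h g) f"
    using hom Comp_Hom[OF hom(1,2)] Comp_Hom[OF hom(2,3)] f'(4) g'(6) h'(4) Comp_assoc[OF hom]
    by (simp add: Comp_coded HomD(1))
qed

lemma is_functor_dec: "is_functor CK K dec"
proof (rule is_functorI)
  fix f x y assume "f \<in> Hom CK x y"
  then show "FArr dec f \<in> Hom K (FObj dec x) (FObj dec y)"
    by (elim Hom_codedE) (simp add: HomD)
next
  fix f g x y z assume f: "f \<in> Hom CK x y" and g: "g \<in> Hom CK y z"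
  obtain x' y' f' where f': "x' \<in> Obj K" "y' \<in> Obj K" "f' \<in> Hom K x' y'" "x = eo x'" "y = eo y'" "f = ea f'"
    using f by (rule Hom_codedE)
  obtain y'' z' g' where g': "y'' \<in> Obj K" "z' \<in> Obj K" "g' \<in> Hom K y'' z'" "y = eo y''" "z = eo z'" "g = ea g'"
    using g by (rule Hom_codedE)
  have "y'' = y'"
    using f' g' inj_eo by (auto dest: inj_onD)
  then have "Comp K g' f' \<in> Hom K x' z'"
    using f' g' Comp_Hom by blast
  then show "FArr dec (Comp CK g f) = Comp K (FArr dec g) (FArr dec f)"
    using f' g' by (simp add: Comp_coded HomD)
qed (auto simp: Ident_coded HomD(1)[OF Ident_Hom] category_coded)

lemma fully_faithful_dec: "fully_faithful CK K dec"
  unfolding fully_faithful_def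
proof (intro ballI)
  fix x y assume "x \<in> Obj CK" "y \<in> Obj CK"
  then obtain x' y' where xy: "x' \<in> Obj K" "y' \<in> Obj K" "x = eo x'" "y = eo y'"
    by auto
  have "bij_betw (FArr dec) (ea ` Hom K x' y') (Hom K x' y')"
    by (rule bij_betw_byWitness[of _ ea]) (auto simp: HomD)
  then show "bij_betw (FArr dec) (Hom CK x y) (Hom K (FObj dec x) (FObj dec y))"
    using xy by (simp add: Hom_coded)
qed

lemma ea_Hom: "f \<in> Hom K x (FObj dec y) \<Longrightarrow> y \<in> Obj CK \<Longrightarrow> ea f \<in> Hom CK (eo x) y"
  using Hom_Obj[of f x] by (auto simp: Hom_coded)

lemma dec_Hom:
  assumes "h \<in> Hom CK (eo x) y" "x \<in> Obj K" "y \<in> Obj CK"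
  shows "FArr dec h \<in> Hom K x (FObj dec y)" "ea (FArr dec h) = h"
  using assms by (auto simp: Hom_coded HomD)

text \<open>A cone in \<open>K\<close> over the decoded diagram is encoded, factored in the copy and
  decoded again.\<close>

lemma preserves_finite_limits_dec: "preserves_finite_limits CK K dec"
  unfolding preserves_finite_limits_def
proof (intro allI impI, elim conjE)
  fix J :: "(nat, nat) cat" and D v \<pi>
  assume J: "category J" and D: "is_functor J CK D" and lim: "is_limit J CK D v \<pi>"
  interpret J: category J by fact
  interpret CK: category CK by (rule category_coded)
  have cone: "v \<in> Obj CK" "\<And>j. j \<in> Obj J \<Longrightarrow> \<pi> j \<in> Hom CK v (FObj D j)"
    "\<And>k. k \<in> Arr J \<Longrightarrow> Comp CK (FArr D k) (\<pi> (Dom J k)) = \<pi> (Cod J k)"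
    using lim by (auto simp: is_limit_def is_cone_def)
  obtain v' where v': "v' \<in> Obj K" "v = eo v'"
    using cone(1) by auto
  have D_Obj: "FObj D j \<in> Obj CK" if "j \<in> Obj J" for j
    using D that is_functor_Obj by fast
  have D_Arr: "FArr D k \<in> Hom CK (FObj D (Dom J k)) (FObj D (Cod J k))" if "k \<in> Arr J" for k
    using is_functor_Hom[OF D Arr_Hom[OF that]] .
  show "is_limit J K (comp_fctr dec D) (FObj dec v) (FArr dec \<circ> \<pi>)"
    unfolding is_limit_def
  proof (intro conjI allI impI)
    show "is_cone J K (comp_fctr dec D) (FObj dec v) (FArr dec \<circ> \<pi>)"
      unfolding is_cone_def
    proof (intro conjI ballI)
      fix k assume k: "k \<in> Arr J"
      show "Comp K (FArr (comp_fctr dec D) k) ((FArr dec \<circ> \<pi>) (Dom J k)) = (FArr dec \<circ> \<pi>) (Cod J k)"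
        using is_functor_Comp[OF is_functor_dec cone(2)[OF J.Dom_Obj[OF k]] D_Arr[OF k]] cone(3)[OF k]
        by simp
    qed (use v' is_functor_Hom[OF is_functor_dec cone(2)] in auto)
    fix w \<rho> assume w: "is_cone J K (comp_fctr dec D) w \<rho>"
    then have w_Obj: "w \<in> Obj K" and \<rho>: "\<And>j. j \<in> Obj J \<Longrightarrow> \<rho> j \<in> Hom K w (FObj dec (FObj D j))"
      and \<rho>_nat: "\<And>k. k \<in> Arr J \<Longrightarrow> Comp K (FArr dec (FArr D k)) (\<rho> (Dom J k)) = \<rho> (Cod J k)"
      by (auto simp: is_cone_def)
    have "is_cone J CK D (eo w) (ea \<circ> \<rho>)"
      unfolding is_cone_def
    proof (intro conjI ballI)
      fix k assume k: "k \<in> Arr J"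
      have "Comp CK (FArr D k) (ea (\<rho> (Dom J k))) = ea (Comp K (FArr dec (FArr D k)) (\<rho> (Dom J k)))"
      proof -
        obtain f where "f \<in> Arr K" "FArr D k = ea f"
          using HomD(1)[OF D_Arr[OF k]] by (auto simp: Arr_coded)
        then show ?thesis
          using HomD(1)[OF \<rho>[OF J.Dom_Obj[OF k]]] by (simp add: Comp_coded)
      qed
      then show "Comp CK (FArr D k) ((ea \<circ> \<rho>) (Dom J k)) = (ea \<circ> \<rho>) (Cod J k)"
        using \<rho>_nat[OF k] by simp
    qed (use w_Obj ea_Hom[OF \<rho> D_Obj] in auto)
    then have "\<exists>!h. h \<in> Hom CK (eo w) v \<and> (\<forall>j\<in>Obj J. Comp CK (\<pi> j) h = (ea \<circ> \<rho>) j)"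
      using lim unfolding is_limit_def by blast
    then obtain h where h: "h \<in> Hom CK (eo w) v" "\<And>j. j \<in> Obj J \<Longrightarrow> Comp CK (\<pi> j) h = ea (\<rho> j)"
      and uniq: "\<And>h'. h' \<in> Hom CK (eo w) v \<Longrightarrow> (\<And>j. j \<in> Obj J \<Longrightarrow> Comp CK (\<pi> j) h' = ea (\<rho> j)) \<Longrightarrow> h' = h"
      unfolding Ex1_def comp_apply by blast
    note dec_h = dec_Hom[OF h(1) w_Obj cone(1)]
    show "\<exists>!h. h \<in> Hom K w (FObj dec v) \<and> (\<forall>j\<in>Obj J. Comp K ((FArr dec \<circ> \<pi>) j) h = \<rho> j)"
    proof (rule ex1I[of _ "FArr dec h"], intro conjI ballI)
      show "FArr dec h \<in> Hom K w (FObj dec v)"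
        by (rule dec_h)
      fix j assume j: "j \<in> Obj J"
      show "Comp K ((FArr dec \<circ> \<pi>) j) (FArr dec h) = \<rho> j"
        using is_functor_Comp[OF is_functor_dec h(1) cone(2)[OF j]] h(2)[OF j] HomD(1)[OF \<rho>[OF j]]
        by simp
    next
      fix h' assume h': "h' \<in> Hom K w (FObj dec v) \<and> (\<forall>j\<in>Obj J. Comp K ((FArr dec \<circ> \<pi>) j) h' = \<rho> j)"
      have "ea h' = h"
      proof (rule uniq)
        show "ea h' \<in> Hom CK (eo w) v"
          using ea_Hom[OF _ cone(1)] h' by blast
        fix j assume j: "j \<in> Obj J"
        obtain p where p: "p \<in> Arr K" "\<pi> j = ea p"
          using HomD(1)[OF cone(2)[OF j]] by (auto simp: Arr_coded)
        moreover have "Comp K p h' = \<rho> j"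
          using h' j p by auto
        moreover have "h' \<in> Arr K"
          using h' HomD(1) by fast
        ultimately show "Comp CK (\<pi> j) (ea h') = ea (\<rho> j)"
          by (simp add: Comp_coded)
      qed
      then show "h' = FArr dec h"
        using h' by (auto simp: HomD(1))
    qed
  qed
qed

end

lemma preserves_finite_limits_comp:
  assumes "is_functor C D F" "preserves_finite_limits C D F" "preserves_finite_limits D E G"
  shows "preserves_finite_limits C E (comp_fctr G F)"
  unfolding preserves_finite_limits_def
proof (intro allI impI, elim conjE)
  fix J :: "(nat, nat) cat" and K v \<pi>
  assume J: "category J" "finite (Obj J)" "finite (Arr J)" "is_functor J C K" "is_limit J C K v \<pi>"
  then have "is_limit J D (comp_fctr F K) (FObj F v) (FArr F \<circ> \<pi>)"
    using assms(2) by (simp add: preserves_finite_limits_def)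
  then have "is_limit J E (comp_fctr G (comp_fctr F K)) (FObj G (FObj F v)) (FArr G \<circ> (FArr F \<circ> \<pi>))"
    using assms(3) J is_functor_comp[OF J(1,4) assms(1)] by (simp add: preserves_finite_limits_def)
  then show "is_limit J E (comp_fctr (comp_fctr G F) K) (FObj (comp_fctr G F) v) (FArr (comp_fctr G F) \<circ> \<pi>)"
    by (simp add: comp_fctr_def comp_assoc)
qed

lemma full_subcategory_simps:
  "Obj (full_subcategory C X) = Obj C \<inter> X" "Dom (full_subcategory C X) = Dom C"
  "Cod (full_subcategory C X) = Cod C" "Ident (full_subcategory C X) = Ident C"
  "Comp (full_subcategory C X) = Comp C"
  by (simp_all add: full_subcategory_def)

lemma Hom_full_subcategory:
  "x \<in> X \<Longrightarrow> y \<in> X \<Longrightarrow> Hom (full_subcategory C X) x y = Hom C x y"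
  by (auto simp: full_subcategory_def Hom_def)

lemma Hom_full_subcategoryD:
  "f \<in> Hom (full_subcategory C X) x y \<Longrightarrow> f \<in> Hom C x y \<and> x \<in> X \<and> y \<in> X"
  by (auto simp: full_subcategory_def Hom_def)

lemma category_full_subcategory:
  assumes "category C" shows "category (full_subcategory C X)"
proof -
  interpret category C by fact
  show ?thesis
  proof
    show "f \<in> Arr (full_subcategory C X) \<Longrightarrow> Dom (full_subcategory C X) f \<in> Obj (full_subcategory C X)"
      "f \<in> Arr (full_subcategory C X) \<Longrightarrow> Cod (full_subcategory C X) f \<in> Obj (full_subcategory C X)" for f
      by (auto simp: full_subcategory_def Dom_Obj Cod_Obj)
  next
    show "x \<in> Obj (full_subcategory C X) \<Longrightarrow>
        Ident (full_subcategory C X) x \<in> Hom (full_subcategory C X) x x" for x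
      by (auto simp: full_subcategory_simps Hom_full_subcategory Ident_Hom)
  next
    fix f g x y z
    assume "f \<in> Hom (full_subcategory C X) x y" "g \<in> Hom (full_subcategory C X) y z"
    then show "Comp (full_subcategory C X) g f \<in> Hom (full_subcategory C X) x z"
      by (auto dest!: Hom_full_subcategoryD simp: full_subcategory_simps Hom_full_subcategory intro: Comp_Hom)
  qed (auto dest!: Hom_full_subcategoryD simp: full_subcategory_simps Comp_Ident Ident_Comp Comp_assoc)
qed

section \<open>Presheaves\<close>

lemma Hom_PSh: "f \<in> Hom (PSh C) P Q \<longleftrightarrow> (\<exists>\<alpha>. f = (P, Q, \<alpha>) \<and> is_presheaf_arr C (P, Q, \<alpha>))"
  by (cases f) (auto simp: Hom_def PSh_def)

lemma Obj_PSh: "P \<in> Obj (PSh C) \<longleftrightarrow> is_presheaf C P"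
  by (simp add: PSh_def)

lemma Comp_PSh:
  "Comp (PSh C) (Q', R, \<beta>) (P, Q, \<alpha>) = (P, R, \<lambda>c\<in>Obj C. compose (Sect P c) (\<beta> c) (\<alpha> c))"
  by (simp add: PSh_def)

lemma Ident_PSh: "Ident (PSh C) P = (P, P, \<lambda>c\<in>Obj C. \<lambda>x\<in>Sect P c. x)"
  by (simp add: PSh_def)

lemma is_presheaf_arr_ext:
  assumes "is_presheaf_arr C (P, Q, \<alpha>)" "is_presheaf_arr C (P, Q, \<beta>)"
    and "\<And>c x. c \<in> Obj C \<Longrightarrow> x \<in> Sect P c \<Longrightarrow> \<alpha> c x = \<beta> c x"
  shows "(P, Q, \<alpha>) = (P, Q, \<beta>)"
proof -
  have "\<alpha> = \<beta>"
  proof (rule extensionalityI[of _ "Obj C"])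
    fix c assume "c \<in> Obj C"
    then show "\<alpha> c = \<beta> c"
      using assms by (intro PiE_ext[of _ "Sect P c" "\<lambda>_. Sect Q c"]) (auto simp: is_presheaf_arr_def)
  qed (use assms in \<open>auto simp: is_presheaf_arr_def\<close>)
  then show ?thesis by simp
qed

lemma category_PSh:
  assumes "category C"
  shows "category (PSh C :: (('o, 'a, 'u) presheaf, ('o, 'a, 'u) presheaf_arr) cat)"
proof -
  interpret category C by fact
  let ?P = "PSh C :: (('o, 'a, 'u) presheaf, ('o, 'a, 'u) presheaf_arr) cat"
  have arr_app: "\<alpha> c x \<in> Sect Q c" if "is_presheaf_arr C (P, Q, \<alpha>)" "c \<in> Obj C" "x \<in> Sect P c"
    for P Q :: "('o, 'a, 'u) presheaf" and \<alpha> c x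
    using that by (auto simp: is_presheaf_arr_def)
  have res: "Res P f x \<in> Sect P (Dom C f)" if "is_presheaf C P" "f \<in> Arr C" "x \<in> Sect P (Cod C f)"
    for P :: "('o, 'a, 'u) presheaf" and f x
    using that by (auto simp: is_presheaf_def)
  have comp: "Comp ?P g f \<in> Hom ?P x z" if f: "f \<in> Hom ?P x y" and g: "g \<in> Hom ?P y z" for f g x y z
  proof -
    obtain \<alpha> where \<alpha>: "f = (x, y, \<alpha>)" "is_presheaf_arr C (x, y, \<alpha>)"
      using f by (auto simp: Hom_PSh)
    obtain \<beta> where \<beta>: "g = (y, z, \<beta>)" "is_presheaf_arr C (y, z, \<beta>)"
      using g by (auto simp: Hom_PSh)
    have "is_presheaf_arr C (x, z, \<lambda>c\<in>Obj C. compose (Sect x c) (\<beta> c) (\<alpha> c))"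
      using \<alpha>(2) \<beta>(2) arr_app res
      by (auto simp: is_presheaf_arr_def compose_def Dom_Obj Cod_Obj)
    then show ?thesis
      by (simp add: \<alpha> \<beta> Comp_PSh Hom_PSh)
  qed
  have ident: "Ident ?P x \<in> Hom ?P x x" if "is_presheaf C x" for x
    using that res by (auto simp: Ident_PSh Hom_PSh is_presheaf_arr_def Dom_Obj Cod_Obj)
  show ?thesis
  proof
    show "f \<in> Arr ?P \<Longrightarrow> Dom ?P f \<in> Obj ?P" "f \<in> Arr ?P \<Longrightarrow> Cod ?P f \<in> Obj ?P" for f
      by (cases f; simp add: PSh_def is_presheaf_arr_def)+
  next
    show "x \<in> Obj ?P \<Longrightarrow> Ident ?P x \<in> Hom ?P x x" for x
      by (simp add: Obj_PSh ident)
  next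
    fix f x y assume f: "f \<in> Hom ?P x y"
    then obtain \<alpha> where \<alpha>: "f = (x, y, \<alpha>)" "is_presheaf_arr C (x, y, \<alpha>)"
      by (auto simp: Hom_PSh)
    then have xy: "is_presheaf C x" "is_presheaf C y"
      by (auto simp: is_presheaf_arr_def)
    obtain \<beta> where \<beta>: "Comp ?P f (Ident ?P x) = (x, y, \<beta>)" "is_presheaf_arr C (x, y, \<beta>)"
      using comp[OF ident[OF xy(1)] f] by (auto simp: Hom_PSh)
    show "Comp ?P f (Ident ?P x) = f"
      unfolding \<beta>(1) unfolding \<alpha>(1)
      using \<beta>(1) by (intro is_presheaf_arr_ext[OF \<beta>(2) \<alpha>(2)]) (auto simp: \<alpha>(1) Ident_PSh Comp_PSh compose_def)
    obtain \<gamma> where \<gamma>: "Comp ?P (Ident ?P y) f = (x, y, \<gamma>)" "is_presheaf_arr C (x, y, \<gamma>)"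
      using comp[OF f ident[OF xy(2)]] by (auto simp: Hom_PSh)
    show "Comp ?P (Ident ?P y) f = f"
      unfolding \<gamma>(1) unfolding \<alpha>(1)
      using \<gamma>(1) arr_app[OF \<alpha>(2)]
      by (intro is_presheaf_arr_ext[OF \<gamma>(2) \<alpha>(2)]) (auto simp: \<alpha>(1) Ident_PSh Comp_PSh compose_def)
  next
    fix f g h w x y z assume "f \<in> Hom ?P w x" "g \<in> Hom ?P x y" "h \<in> Hom ?P y z"
    then obtain \<alpha> \<beta> \<gamma> where "f = (w, x, \<alpha>)" "is_presheaf_arr C (w, x, \<alpha>)" "g = (x, y, \<beta>)" "h = (y, z, \<gamma>)"
      by (auto simp: Hom_PSh)
    then show "Comp ?P h (Comp ?P g f) = Comp ?P (Comp ?P h g) f"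
      using arr_app by (auto simp: Comp_PSh compose_def intro!: restrict_ext)
  qed (rule comp)
qed

text \<open>Only maximal sieves cover. This is how a presheaf topos becomes an instance of sheaves
  on a site.\<close>

definition trivial_topology :: "('o, 'a) cat \<Rightarrow> 'o \<Rightarrow> 'a set set" where
  "trivial_topology C c = {{f \<in> Arr C. Cod C f = c}}"

lemma (in category) grothendieck_trivial_topology: "grothendieck_topology C (trivial_topology C)"
proof -
  have max: "{g \<in> Arr C. Cod C g = Dom C f \<and> Comp C f g \<in> Arr C \<and> Cod C (Comp C f g) = Cod C f} =
      {g \<in> Arr C. Cod C g = Dom C f}" if "f \<in> Arr C" for f
    using that Comp_Hom[of _ _ "Dom C f" f "Cod C f"] by (auto simp: Hom_def)
  have trans: "{f \<in> Arr C. Cod C f = c} = R"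
    if c: "c \<in> Obj C" and R: "is_sieve C c R"
      and pb: "\<forall>f\<in>{f \<in> Arr C. Cod C f = c}. pullback_sieve C f R \<in> trivial_topology C (Dom C f)" for c R
  proof
    show "{f \<in> Arr C. Cod C f = c} \<subseteq> R"
    proof
      fix f assume f: "f \<in> {f \<in> Arr C. Cod C f = c}"
      then have "pullback_sieve C f R = {g \<in> Arr C. Cod C g = Dom C f}"
        using pb by (auto simp: trivial_topology_def)
      then have "Ident C (Dom C f) \<in> pullback_sieve C f R"
        using f Ident_Hom[OF Dom_Obj] by (auto simp: Hom_def)
      then show "f \<in> R"
        using f Comp_Ident[OF Arr_Hom] by (simp add: pullback_sieve_def)
    qed
    show "R \<subseteq> {f \<in> Arr C. Cod C f = c}"
      using R by (simp add: is_sieve_def)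
  qed
  have sieve: "is_sieve C c {f \<in> Arr C. Cod C f = c}" for c
    unfolding is_sieve_def using Comp_Hom by (auto simp: Hom_def)
  show ?thesis
    unfolding grothendieck_topology_def
  proof (intro conjI ballI allI impI)
    show "is_sieve C c S" if "S \<in> trivial_topology C c" for c S
      using that sieve by (simp add: trivial_topology_def)
    show "{f \<in> Arr C. Cod C f = c} \<in> trivial_topology C c" for c
      by (simp add: trivial_topology_def)
    show "pullback_sieve C f S \<in> trivial_topology C (Dom C f)"
      if "f \<in> Arr C" "S \<in> trivial_topology C (Cod C f)" for f S
      using that max[OF that(1)] by (simp add: trivial_topology_def pullback_sieve_def)
    show "R \<in> trivial_topology C c"
      if "c \<in> Obj C" "S \<in> trivial_topology C c"
        "is_sieve C c R \<and> (\<forall>f\<in>S. pullback_sieve C f R \<in> trivial_topology C (Dom C f))" for c S R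
      using that trans[of c R] by (simp add: trivial_topology_def)
  qed
qed

text \<open>A matching family on a maximal sieve is determined by its member at the
  identity.\<close>

lemma (in category) is_sheaf_trivial_topology: "is_presheaf C P \<Longrightarrow> is_sheaf C (trivial_topology C) P"
  unfolding is_sheaf_def
proof (intro conjI ballI allI impI)
  fix c S x assume P: "is_presheaf C P" and c: "c \<in> Obj C" and "S \<in> trivial_topology C c"
    and x: "matching_family C P S x"
  then have S: "S = {f \<in> Arr C. Cod C f = c}"
    by (simp add: trivial_topology_def)
  note i = HomD[OF Ident_Hom[OF c]]
  show "\<exists>!y. y \<in> Sect P c \<and> (\<forall>f\<in>S. Res P f y = x f)"
  proof (rule ex1I[of _ "x (Ident C c)"], intro conjI ballI)
    show "x (Ident C c) \<in> Sect P c"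
      using x i S by (auto simp: matching_family_def)
    fix f assume f: "f \<in> S"
    then show "Res P f (x (Ident C c)) = x f"
      using x i S Ident_Comp[OF Arr_Hom, of f] by (auto simp: matching_family_def)
  next
    fix y assume y: "y \<in> Sect P c \<and> (\<forall>f\<in>S. Res P f y = x f)"
    then show "y = x (Ident C c)"
      using P c S i by (auto simp: is_presheaf_def)
  qed
qed

text \<open>An equality of categories, so that an equivalence with presheaves is literally one with
  sheaves.\<close>

lemma (in category) Sh_trivial_topology:
  "(Sh C (trivial_topology C) :: (('o, 'a, 'u) presheaf, ('o, 'a, 'u) presheaf_arr) cat) = PSh C"
  unfolding Sh_def full_subcategory_def
  using is_sheaf_trivial_topology
  by (auto simp: PSh_def is_presheaf_arr_def)

section \<open>Actions of monoids\<close>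

lemma category_one_object: "Group.monoid M \<Longrightarrow> category (one_object_category M)"
  by unfold_locales
    (auto simp: one_object_category_def Hom_def monoid.m_closed monoid.m_assoc monoid.r_one monoid.l_one
      intro: monoid.one_closed)

lemma extensional_unit [simp]: "extensional (UNIV :: unit set) = UNIV" "f \<in> extensional {()}"
  by (auto simp: extensional_def)

lemma is_presheaf_action:
  "is_presheaf (one_object_category M) (P :: (unit, 'm, 'u) presheaf) \<longleftrightarrow>
     Res P \<in> extensional (carrier M) \<and> small TYPE('u) (Sect P ()) \<and>
     (\<forall>m\<in>carrier M. Res P m \<in> Sect P () \<rightarrow>\<^sub>E Sect P ()) \<and>
     (\<forall>x\<in>Sect P (). Res P \<one>\<^bsub>M\<^esub> x = x) \<and>
     (\<forall>m\<in>carrier M. \<forall>n\<in>carrier M. \<forall>x\<in>Sect P (). Res P (n \<otimes>\<^bsub>M\<^esub> m) x = Res P m (Res P n x))"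
  by (simp add: is_presheaf_def one_object_category_def)

lemma is_presheaf_arr_action:
  "is_presheaf_arr (one_object_category M) (P, Q, \<alpha>) \<longleftrightarrow>
     is_presheaf (one_object_category M) P \<and> is_presheaf (one_object_category M) Q \<and>
     \<alpha> () \<in> Sect P () \<rightarrow>\<^sub>E Sect Q () \<and>
     (\<forall>m\<in>carrier M. \<forall>x\<in>Sect P (). \<alpha> () (Res P m x) = Res Q m (\<alpha> () x))"
  by (simp add: is_presheaf_arr_def one_object_category_def)

text \<open>The restrictions provide the extensionality demanded of presheaves, so that only laws
  for actual elements remain to be checked.\<close>

definition action_on :: "('m, 'b) monoid_scheme \<Rightarrow> 'u set \<Rightarrow> ('m \<Rightarrow> 'u \<Rightarrow> 'u) \<Rightarrow> (unit, 'm, 'u) presheaf" where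
  "action_on M X \<rho> = \<lparr>Sect = (\<lambda>_. X), Res = (\<lambda>m\<in>carrier M. \<lambda>x\<in>X. \<rho> m x)\<rparr>"

lemma action_on_simps [simp]:
  "Sect (action_on M X \<rho>) c = X"
  "m \<in> carrier M \<Longrightarrow> x \<in> X \<Longrightarrow> Res (action_on M X \<rho>) m x = \<rho> m x"
  by (simp_all add: action_on_def)

lemma is_presheaf_action_on:
  fixes X :: "'u set"
  assumes "Group.monoid M" "small TYPE('u) X" "\<And>m x. m \<in> carrier M \<Longrightarrow> x \<in> X \<Longrightarrow> \<rho> m x \<in> X"
    and "\<And>x. x \<in> X \<Longrightarrow> \<rho> \<one>\<^bsub>M\<^esub> x = x"
    and "\<And>m n x. m \<in> carrier M \<Longrightarrow> n \<in> carrier M \<Longrightarrow> x \<in> X \<Longrightarrow> \<rho> (n \<otimes>\<^bsub>M\<^esub> m) x = \<rho> m (\<rho> n x)"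
  shows "is_presheaf (one_object_category M) (action_on M X \<rho>)"
  unfolding is_presheaf_action
  using assms monoid.m_closed[OF assms(1)] monoid.one_closed[OF assms(1)] by (simp add: action_on_def)

definition hom_on ::
  "(unit, 'm, 'u) presheaf \<Rightarrow> (unit, 'm, 'u) presheaf \<Rightarrow> ('u \<Rightarrow> 'u) \<Rightarrow> (unit, 'm, 'u) presheaf_arr" where
  "hom_on P Q \<phi> = (P, Q, \<lambda>_. restrict \<phi> (Sect P ()))"

definition app :: "(unit, 'm, 'u) presheaf_arr \<Rightarrow> 'u \<Rightarrow> 'u" where
  "app f = snd (snd f) ()"

lemma app_hom_on [simp]: "x \<in> Sect P () \<Longrightarrow> app (hom_on P Q \<phi>) x = \<phi> x"
  by (simp add: app_def hom_on_def)

abbreviation Act :: "('m, 'b) monoid_scheme \<Rightarrow> ((unit, 'm, 'u) presheaf, (unit, 'm, 'u) presheaf_arr) cat" where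
  "Act M \<equiv> PSh (one_object_category M)"

lemma hom_on_Hom:
  assumes "P \<in> Obj (Act M)" "Q \<in> Obj (Act M)"
    and "\<And>x. x \<in> Sect P () \<Longrightarrow> \<phi> x \<in> Sect Q ()"
    and "\<And>m x. m \<in> carrier M \<Longrightarrow> x \<in> Sect P () \<Longrightarrow> \<phi> (Res P m x) = Res Q m (\<phi> x)"
  shows "hom_on P Q \<phi> \<in> Hom (Act M) P Q"
  using assms unfolding Hom_PSh hom_on_def Obj_PSh
  by (auto simp: is_presheaf_arr_action) (auto simp: is_presheaf_action)

lemma Hom_Act_props:
  assumes "f \<in> Hom (Act M) P Q"
  shows "P \<in> Obj (Act M)" "Q \<in> Obj (Act M)"
    and "\<And>x. x \<in> Sect P () \<Longrightarrow> app f x \<in> Sect Q ()"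
    and "\<And>m x. m \<in> carrier M \<Longrightarrow> x \<in> Sect P () \<Longrightarrow> app f (Res P m x) = Res Q m (app f x)"
  using assms unfolding Hom_PSh Obj_PSh app_def by (auto simp: is_presheaf_arr_action)

lemma Hom_Act_ext:
  assumes "f \<in> Hom (Act M) P Q" "g \<in> Hom (Act M) P Q" "\<And>x. x \<in> Sect P () \<Longrightarrow> app f x = app g x"
  shows "f = g"
proof -
  obtain \<alpha> \<beta> where *: "f = (P, Q, \<alpha>)" "is_presheaf_arr (one_object_category M) (P, Q, \<alpha>)"
    "g = (P, Q, \<beta>)" "is_presheaf_arr (one_object_category M) (P, Q, \<beta>)"
    using assms(1,2) unfolding Hom_PSh by blast
  show ?thesis
    unfolding *(1,3) using assms(3)
    by (intro is_presheaf_arr_ext[OF *(2,4)]) (auto simp: app_def *(1,3))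
qed

lemma Comp_Act_app:
  assumes "f \<in> Hom (Act M) P Q" "g \<in> Hom (Act M) Q R" "x \<in> Sect P ()"
  shows "app (Comp (Act M) g f) x = app g (app f x)"
proof -
  obtain \<alpha> \<beta> where "f = (P, Q, \<alpha>)" "g = (Q, R, \<beta>)"
    using assms(1,2) unfolding Hom_PSh by blast
  then show ?thesis
    using assms(3) by (simp add: Comp_PSh app_def compose_def one_object_category_def)
qed

lemma Ident_Act_app: "x \<in> Sect P () \<Longrightarrow> app (Ident (Act M) P) x = x"
  by (simp add: Ident_PSh app_def one_object_category_def)

lemma Act_Res:
  assumes "P \<in> Obj (Act M)"
  shows "m \<in> carrier M \<Longrightarrow> x \<in> Sect P () \<Longrightarrow> Res P m x \<in> Sect P ()"
    and "x \<in> Sect P () \<Longrightarrow> Res P \<one>\<^bsub>M\<^esub> x = x"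
    and "m \<in> carrier M \<Longrightarrow> n \<in> carrier M \<Longrightarrow> x \<in> Sect P () \<Longrightarrow>
      Res P (n \<otimes>\<^bsub>M\<^esub> m) x = Res P m (Res P n x)"
    and "Sect P = (\<lambda>_. Sect P ())"
  using assms unfolding Obj_PSh is_presheaf_action by (auto simp: fun_eq_iff)

lemma Act_small: "P \<in> Obj (Act M) \<Longrightarrow> small TYPE('u) (Sect (P :: (unit, 'm, 'u) presheaf) ())"
  unfolding Obj_PSh is_presheaf_action by blast

section \<open>Restriction of finitely supported actions\<close>

text \<open>Composition is reversed because presheaves are right actions: the reversal turns them
  into left actions by selfmaps, as in \<open>selfmaps_action\<close>.\<close>

definition selfmaps_monoid :: "'y set \<Rightarrow> ('y \<Rightarrow> 'y) monoid" where
  "selfmaps_monoid Y = \<lparr>carrier = selfmaps Y, mult = (\<lambda>f g. g \<circ> f), one = id\<rparr>"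

lemma selfmaps_monoid_simps [simp]:
  "carrier (selfmaps_monoid Y) = selfmaps Y" "f \<otimes>\<^bsub>selfmaps_monoid Y\<^esub> g = g \<circ> f"
  "\<one>\<^bsub>selfmaps_monoid Y\<^esub> = id"
  by (simp_all add: selfmaps_monoid_def)

lemma monoid_selfmaps_monoid: "Group.monoid (selfmaps_monoid Y)"
  by unfold_locales (auto simp: comp_assoc)

text \<open>Finite support is a condition on objects only; equivariant maps carry supports to
  supports, see \<open>hom_supported\<close>.\<close>

definition FinAct ::
  "'y set \<Rightarrow> ((unit, 'y \<Rightarrow> 'y, 'u) presheaf, (unit, 'y \<Rightarrow> 'y, 'u) presheaf_arr) cat" where
  "FinAct Y = full_subcategory (Act (selfmaps_monoid Y)) {P. finsupp_action Y (Sect P ()) (Res P)}"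

lemma category_FinAct: "category (FinAct Y)"
  unfolding FinAct_def
  by (intro category_full_subcategory category_PSh category_one_object monoid_selfmaps_monoid)

abbreviation supported :: "'y set \<Rightarrow> (unit, 'y \<Rightarrow> 'y, 'u) presheaf \<Rightarrow> 'y set \<Rightarrow> 'u \<Rightarrow> bool" where
  "supported Y P \<equiv> selfmaps_action.supports Y (Res P)"

lemma selfmaps_action_Act:
  "P \<in> Obj (Act (selfmaps_monoid Y)) \<Longrightarrow> selfmaps_action Y (Sect P ()) (Res P)"
  using Act_Res[of P "selfmaps_monoid Y"] by unfold_locales auto

lemma Obj_FinActI:
  assumes "P \<in> Obj (Act (selfmaps_monoid Y))"
    and "\<And>x. x \<in> Sect P () \<Longrightarrow> \<exists>Z. finite Z \<and> Z \<subseteq> Y \<and>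
      (\<forall>f \<in> selfmaps Y. \<forall>g \<in> selfmaps Y. (\<forall>z\<in>Z. f z = g z) \<longrightarrow> Res P f x = Res P g x)"
  shows "P \<in> Obj (FinAct Y)"
proof -
  interpret selfmaps_action Y "Sect P ()" "Res P"
    by (rule selfmaps_action_Act) fact
  have "finsupp_action Y (Sect P ()) (Res P)"
    by unfold_locales (simp add: assms(2) supports_def)
  then show ?thesis
    using assms(1) by (simp add: FinAct_def full_subcategory_simps)
qed

lemma Obj_FinActD:
  assumes "P \<in> Obj (FinAct Y)"
  shows "P \<in> Obj (Act (selfmaps_monoid Y))" "finsupp_action Y (Sect P ()) (Res P)"
  using assms by (simp_all add: FinAct_def full_subcategory_simps)

lemma Hom_FinAct:
  "P \<in> Obj (FinAct Y) \<Longrightarrow> Q \<in> Obj (FinAct Y) \<Longrightarrow>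
    Hom (FinAct Y) P Q = Hom (Act (selfmaps_monoid Y)) P Q"
  unfolding FinAct_def by (simp add: Hom_full_subcategory full_subcategory_simps)

lemma Hom_FinActD: "f \<in> Hom (FinAct Y) P Q \<Longrightarrow> f \<in> Hom (Act (selfmaps_monoid Y)) P Q"
  unfolding FinAct_def by (drule Hom_full_subcategoryD, erule conjunct1)

lemma Comp_FinAct: "Comp (FinAct Y) = Comp (Act (selfmaps_monoid Y))"
  and Ident_FinAct: "Ident (FinAct Y) = Ident (Act (selfmaps_monoid Y))"
  by (simp_all add: FinAct_def full_subcategory_simps)

lemma small_selfmaps:
  assumes "inaccessible TYPE('u)" "small TYPE('u) Y" shows "small TYPE('u) (selfmaps Y)"
proof -
  have "inj_on (\<lambda>f. restrict f Y) (selfmaps Y)"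
  proof (rule inj_onI)
    fix f g assume "f \<in> selfmaps Y" "g \<in> selfmaps Y" "restrict f Y = restrict g Y"
    then have "f y = g y" for y
      by (cases "y \<in> Y") (metis restrict_apply', simp add: selfmaps_out)
    then show "f = g" ..
  qed
  moreover have "(\<lambda>f. restrict f Y) ` selfmaps Y \<subseteq> Y \<rightarrow>\<^sub>E Y"
    by (auto simp: selfmaps_def)
  ultimately have "selfmaps Y \<lesssim> (Y \<rightarrow>\<^sub>E Y)"
    by (auto simp: lepoll_def)
  then show ?thesis
    using small_lepoll small_PiE[OF assms(1,2,2)] by blast
qed

locale small_points =
  fixes Y :: "'y set" and U :: "'u itself"
  assumes inaccessible: "inaccessible TYPE('u)" and small_Y: "small TYPE('u) Y" and Y_nonempty: "Y \<noteq> {}"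
begin

abbreviation "N \<equiv> selfmaps_monoid Y"
abbreviation "F \<equiv> (FinAct Y :: ((unit, 'y \<Rightarrow> 'y, 'u) presheaf, (unit, 'y \<Rightarrow> 'y, 'u) presheaf_arr) cat)"

end

locale restriction = small_points Y U for Y :: "'y set" and U :: "'u itself" +
  fixes M :: "('m, 'b) monoid_scheme" and \<rho> :: "'m \<Rightarrow> 'y \<Rightarrow> 'y"
  assumes M: "Group.monoid M"
    and \<rho>: "m \<in> carrier M \<Longrightarrow> \<rho> m \<in> selfmaps Y" "\<rho> \<one>\<^bsub>M\<^esub> = id"
      "m \<in> carrier M \<Longrightarrow> n \<in> carrier M \<Longrightarrow> \<rho> (m \<otimes>\<^bsub>M\<^esub> n) = \<rho> n \<circ> \<rho> m"
begin

abbreviation "E \<equiv> (Act M :: ((unit, 'm, 'u) presheaf, (unit, 'm, 'u) presheaf_arr) cat)"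

lemma category_E: "category E"
  by (intro category_PSh category_one_object M)

section \<open>Restriction along \<open>\<rho>\<close> and its right adjoint\<close>

definition restr :: "(unit, 'y \<Rightarrow> 'y, 'u) presheaf \<Rightarrow> (unit, 'm, 'u) presheaf" where
  "restr P = action_on M (Sect P ()) (\<lambda>m. Res P (\<rho> m))"

definition restr_fctr where
  "restr_fctr = \<lparr>FObj = restr, FArr = (\<lambda>f. hom_on (restr (Dom F f)) (restr (Cod F f)) (app f))\<rparr>"

lemma restr_simps [simp]:
  "Sect (restr P) c = Sect P ()" "m \<in> carrier M \<Longrightarrow> x \<in> Sect P () \<Longrightarrow> Res (restr P) m x = Res P (\<rho> m) x"
  by (simp_all add: restr_def)

lemma restr_Obj:
  assumes "P \<in> Obj (Act N)" shows "restr P \<in> Obj E"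
  unfolding Obj_PSh restr_def
  using assms Act_small[OF assms] Act_Res[OF assms] \<rho> M
  by (intro is_presheaf_action_on) (auto simp: \<rho>)

lemma FObj_restr [simp]: "FObj restr_fctr P = restr P"
  by (simp add: restr_fctr_def)

lemma restr_Hom:
  assumes "f \<in> Hom (Act N) P Q"
  shows "hom_on (restr P) (restr Q) (app f) \<in> Hom E (restr P) (restr Q)"
  using Hom_Act_props[OF assms] \<rho> by (intro hom_on_Hom restr_Obj) auto

lemma FArr_restr:
  assumes "f \<in> Hom F P Q"
  shows "FArr restr_fctr f = hom_on (restr P) (restr Q) (app f)"
  using HomD[OF assms] by (simp add: restr_fctr_def)

lemma FArr_restr_Hom:
  assumes "f \<in> Hom F P Q" shows "FArr restr_fctr f \<in> Hom E (restr P) (restr Q)"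
  using restr_Hom[OF Hom_FinActD[OF assms]] FArr_restr[OF assms] by simp

lemma app_FArr_restr [simp]:
  assumes "f \<in> Hom F P Q" "x \<in> Sect P ()" shows "app (FArr restr_fctr f) x = app f x"
  using FArr_restr[OF assms(1)] assms(2) by simp

lemma is_functor_restr: "is_functor F E restr_fctr"
proof (rule is_functorI)
  interpret F: category F by (rule category_FinAct)
  fix P assume P: "P \<in> Obj F"
  show "FArr restr_fctr (Ident F P) = Ident E (FObj restr_fctr P)"
  proof (rule Hom_Act_ext)
    show "FArr restr_fctr (Ident F P) \<in> Hom E (restr P) (restr P)"
      using FArr_restr_Hom[OF F.Ident_Hom[OF P]] .
    show "Ident E (FObj restr_fctr P) \<in> Hom E (restr P) (restr P)"
      using category.Ident_Hom[OF category_E] restr_Obj Obj_FinActD(1)[OF P] by simp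
    show "x \<in> Sect (restr P) () \<Longrightarrow> app (FArr restr_fctr (Ident F P)) x = app (Ident E (FObj restr_fctr P)) x" for x
      using F.Ident_Hom[OF P] by (simp add: Ident_FinAct Ident_Act_app)
  qed
next
  interpret F: category F by (rule category_FinAct)
  fix f g P Q R assume fg: "f \<in> Hom F P Q" "g \<in> Hom F Q R"
  note c = F.Comp_Hom[OF fg]
  show "FArr restr_fctr (Comp F g f) = Comp E (FArr restr_fctr g) (FArr restr_fctr f)"
  proof (rule Hom_Act_ext)
    show "FArr restr_fctr (Comp F g f) \<in> Hom E (restr P) (restr R)"
      using FArr_restr_Hom[OF c] .
    show "Comp E (FArr restr_fctr g) (FArr restr_fctr f) \<in> Hom E (restr P) (restr R)"
      using category.Comp_Hom[OF category_E] FArr_restr_Hom fg by blast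
    fix x assume "x \<in> Sect (restr P) ()"
    then have x: "x \<in> Sect P ()" by simp
    show "app (FArr restr_fctr (Comp F g f)) x = app (Comp E (FArr restr_fctr g) (FArr restr_fctr f)) x"
      using x fg c Hom_Act_props(3)[OF Hom_FinActD[OF fg(1)] x] Hom_FinActD
      by (simp add: Comp_Act_app[OF FArr_restr_Hom[OF fg(1)] FArr_restr_Hom[OF fg(2)]] Comp_FinAct
          Comp_Act_app[OF Hom_FinActD[OF fg(1)] Hom_FinActD[OF fg(2)]])
  qed
qed (use restr_Obj Obj_FinActD FArr_restr_Hom category_FinAct in auto)

text \<open>The right adjoint of restriction sends \<open>A\<close> to the \<open>M\<close>-equivariant maps from the selfmaps of
  \<open>Y\<close> to \<open>A\<close> that depend on finitely many values only, encoded as elements of \<open>'u\<close>.\<close>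

definition coind :: "(unit, 'm, 'u) presheaf \<Rightarrow> (('y \<Rightarrow> 'y) \<Rightarrow> 'u) set" where
  "coind A = {\<theta> \<in> selfmaps Y \<rightarrow>\<^sub>E Sect A ().
     (\<forall>m\<in>carrier M. \<forall>g\<in>selfmaps Y. \<theta> (\<rho> m \<circ> g) = Res A m (\<theta> g)) \<and>
     (\<exists>Z. finite Z \<and> Z \<subseteq> Y \<and>
       (\<forall>f\<in>selfmaps Y. \<forall>g\<in>selfmaps Y. (\<forall>z\<in>Z. f z = g z) \<longrightarrow> \<theta> f = \<theta> g))}"

lemma coindD:
  assumes "\<theta> \<in> coind A"
  shows "\<theta> \<in> selfmaps Y \<rightarrow>\<^sub>E Sect A ()"
    and "\<forall>m\<in>carrier M. \<forall>g\<in>selfmaps Y. \<theta> (\<rho> m \<circ> g) = Res A m (\<theta> g)"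
    and "\<exists>Z. finite Z \<and> Z \<subseteq> Y \<and>
       (\<forall>f\<in>selfmaps Y. \<forall>g\<in>selfmaps Y. (\<forall>z\<in>Z. f z = g z) \<longrightarrow> \<theta> f = \<theta> g)"
  using assms unfolding coind_def mem_Collect_eq by blast+

definition coind_code :: "(unit, 'm, 'u) presheaf \<Rightarrow> (('y \<Rightarrow> 'y) \<Rightarrow> 'u) \<Rightarrow> 'u" where
  "coind_code A = code_of (coind A)"

definition coind_obj :: "(unit, 'm, 'u) presheaf \<Rightarrow> (unit, 'y \<Rightarrow> 'y, 'u) presheaf" where
  "coind_obj A = action_on N (coind_code A ` coind A)
     (\<lambda>t e. coind_code A (\<lambda>g\<in>selfmaps Y. inv_into (coind A) (coind_code A) e (g \<circ> t)))"

definition counit :: "(unit, 'm, 'u) presheaf \<Rightarrow> (unit, 'm, 'u) presheaf_arr" where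
  "counit A = hom_on (restr (coind_obj A)) A (\<lambda>e. inv_into (coind A) (coind_code A) e id)"

lemma small_coind: "A \<in> Obj E \<Longrightarrow> small TYPE('u) (coind A)"
  using small_PiE[OF inaccessible small_selfmaps[OF inaccessible small_Y] Act_small[of A M]]
  by (rule small_subset[rotated]) (auto simp: coind_def)

lemma inv_coind_code [simp]:
  "A \<in> Obj E \<Longrightarrow> \<theta> \<in> coind A \<Longrightarrow> inv_into (coind A) (coind_code A) (coind_code A \<theta>) = \<theta>"
  using small_inj_on_code_of[OF small_coind] by (simp add: coind_code_def)

text \<open>Dependence on the values at \<open>Z\<close> becomes dependence on the values at the
  image of \<open>Z\<close> under \<open>t\<close>, and the operations of \<open>M\<close> act from
  the other side.\<close>

lemma coind_shift:
  assumes "\<theta> \<in> coind A" "t \<in> selfmaps Y" shows "(\<lambda>g\<in>selfmaps Y. \<theta> (g \<circ> t)) \<in> coind A"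
proof -
  obtain Z where Z: "finite Z" "Z \<subseteq> Y"
    "\<And>f g. f \<in> selfmaps Y \<Longrightarrow> g \<in> selfmaps Y \<Longrightarrow> (\<forall>z\<in>Z. f z = g z) \<Longrightarrow> \<theta> f = \<theta> g"
    using coindD(3)[OF assms(1)] by blast
  show ?thesis
    unfolding coind_def mem_Collect_eq
  proof (intro conjI ballI)
    show "(\<lambda>g\<in>selfmaps Y. \<theta> (g \<circ> t)) \<in> selfmaps Y \<rightarrow>\<^sub>E Sect A ()"
      unfolding restrict_PiE_iff using PiE_mem[OF coindD(1)[OF assms(1)]] assms(2) by simp
    fix m g assume "m \<in> carrier M" "g \<in> selfmaps Y"
    then show "(\<lambda>g\<in>selfmaps Y. \<theta> (g \<circ> t)) (\<rho> m \<circ> g) = Res A m ((\<lambda>g\<in>selfmaps Y. \<theta> (g \<circ> t)) g)"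
      using coindD(2)[OF assms(1), rule_format, of m "g \<circ> t"] assms(2) \<rho>(1)[of m]
      by (simp add: comp_assoc)
  next
    have "\<theta> (f \<circ> t) = \<theta> (g \<circ> t)"
      if "f \<in> selfmaps Y" "g \<in> selfmaps Y" "\<forall>z\<in>t ` Z. f z = g z" for f g
      by (rule Z(3)) (use that assms(2) in simp_all)
    then have "\<forall>f\<in>selfmaps Y. \<forall>g\<in>selfmaps Y. (\<forall>z\<in>t ` Z. f z = g z) \<longrightarrow>
        (\<lambda>g\<in>selfmaps Y. \<theta> (g \<circ> t)) f = (\<lambda>g\<in>selfmaps Y. \<theta> (g \<circ> t)) g"
      by (intro ballI impI) (simp only: restrict_apply' image_iff)
    then show "\<exists>Z. finite Z \<and> Z \<subseteq> Y \<and> (\<forall>f\<in>selfmaps Y. \<forall>g\<in>selfmaps Y. (\<forall>z\<in>Z. f z = g z) \<longrightarrow>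
        (\<lambda>g\<in>selfmaps Y. \<theta> (g \<circ> t)) f = (\<lambda>g\<in>selfmaps Y. \<theta> (g \<circ> t)) g)"
      by (intro exI[of _ "t ` Z"] conjI finite_imageI Z(1) selfmaps_image[OF assms(2) Z(2)])
  qed
qed

lemma Res_coind_obj:
  assumes "A \<in> Obj E" "\<theta> \<in> coind A" "t \<in> selfmaps Y"
  shows "Res (coind_obj A) t (coind_code A \<theta>) = coind_code A (\<lambda>g\<in>selfmaps Y. \<theta> (g \<circ> t))"
  using assms by (simp add: coind_obj_def)

lemma Sect_coind_obj [simp]: "Sect (coind_obj A) c = coind_code A ` coind A"
  by (simp add: coind_obj_def)

lemma coind_obj_Act:
  assumes A: "A \<in> Obj E" shows "coind_obj A \<in> Obj (Act N)"
  unfolding Obj_PSh coind_obj_def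
proof (rule is_presheaf_action_on)
  show "small TYPE('u) (coind_code A ` coind A)"
    using small_coind[OF A] by (rule small_image)
next
  fix m x assume "m \<in> carrier N" "x \<in> coind_code A ` coind A"
  then show "coind_code A (\<lambda>g\<in>selfmaps Y. inv_into (coind A) (coind_code A) x (g \<circ> m)) \<in> coind_code A ` coind A"
    using coind_shift A by auto
next
  fix x assume "x \<in> coind_code A ` coind A"
  then obtain \<theta> where \<theta>: "\<theta> \<in> coind A" "x = coind_code A \<theta>" by blast
  have "(\<lambda>g\<in>selfmaps Y. \<theta> g) = \<theta>"
    using PiE_restrict[OF coindD(1)[OF \<theta>(1)]] .
  then show "coind_code A (\<lambda>g\<in>selfmaps Y. inv_into (coind A) (coind_code A) x (g \<circ> \<one>\<^bsub>N\<^esub>)) = x"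
    using \<theta> A by simp
next
  fix m n x assume m: "m \<in> carrier N" "n \<in> carrier N" and "x \<in> coind_code A ` coind A"
  then obtain \<theta> where \<theta>: "\<theta> \<in> coind A" "x = coind_code A \<theta>" by blast
  show "coind_code A (\<lambda>g\<in>selfmaps Y. inv_into (coind A) (coind_code A) x (g \<circ> n \<otimes>\<^bsub>N\<^esub> m)) =
    coind_code A (\<lambda>g\<in>selfmaps Y. inv_into (coind A) (coind_code A)
      (coind_code A (\<lambda>g\<in>selfmaps Y. inv_into (coind A) (coind_code A) x (g \<circ> n))) (g \<circ> m))"
    using \<theta> A m coind_shift[OF \<theta>(1)] by (auto simp: comp_assoc intro!: arg_cong[of _ _ "coind_code A"])
qed (rule monoid_selfmaps_monoid)

lemma coind_obj_FinAct:
  assumes A: "A \<in> Obj E" shows "coind_obj A \<in> Obj F"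
proof (rule Obj_FinActI[OF coind_obj_Act[OF A]])
  fix x assume "x \<in> Sect (coind_obj A) ()"
  then obtain \<theta> where \<theta>: "\<theta> \<in> coind A" "x = coind_code A \<theta>" by auto
  obtain Z where Z: "finite Z" "Z \<subseteq> Y"
    "\<And>f g. f \<in> selfmaps Y \<Longrightarrow> g \<in> selfmaps Y \<Longrightarrow> (\<forall>z\<in>Z. f z = g z) \<Longrightarrow> \<theta> f = \<theta> g"
    using coindD(3)[OF \<theta>(1)] by blast
  have "Res (coind_obj A) f x = Res (coind_obj A) g x"
    if fg: "f \<in> selfmaps Y" "g \<in> selfmaps Y" "\<forall>z\<in>Z. f z = g z" for f g
  proof -
    have "(\<lambda>h\<in>selfmaps Y. \<theta> (h \<circ> f)) = (\<lambda>h\<in>selfmaps Y. \<theta> (h \<circ> g))"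
      using fg by (intro restrict_ext Z(3)) auto
    then show ?thesis
      using \<theta> A fg by (simp add: Res_coind_obj)
  qed
  then show "\<exists>Z. finite Z \<and> Z \<subseteq> Y \<and> (\<forall>f\<in>selfmaps Y. \<forall>g\<in>selfmaps Y. (\<forall>z\<in>Z. f z = g z) \<longrightarrow>
      Res (coind_obj A) f x = Res (coind_obj A) g x)"
    using Z(1,2) by blast
qed

lemma app_counit [simp]: "A \<in> Obj E \<Longrightarrow> \<theta> \<in> coind A \<Longrightarrow> app (counit A) (coind_code A \<theta>) = \<theta> id"
  by (simp add: counit_def)

lemma counit_Hom:
  assumes A: "A \<in> Obj E" shows "counit A \<in> Hom E (restr (coind_obj A)) A"
  unfolding counit_def
proof (rule hom_on_Hom)
  show "restr (coind_obj A) \<in> Obj E"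
    using coind_obj_Act[OF A] by (rule restr_Obj)
  fix x assume "x \<in> Sect (restr (coind_obj A)) ()"
  then obtain \<theta> where \<theta>: "\<theta> \<in> coind A" "x = coind_code A \<theta>" by auto
  then show "inv_into (coind A) (coind_code A) x id \<in> Sect A ()"
    using A PiE_mem[OF coindD(1)[OF \<theta>(1)] id_selfmaps(1)] by simp
  fix m assume m: "m \<in> carrier M"
  have "\<theta> (\<rho> m \<circ> id) = Res A m (\<theta> id)"
    using coindD(2)[OF \<theta>(1)] m id_selfmaps(1) by blast
  then show "inv_into (coind A) (coind_code A) (Res (restr (coind_obj A)) m x) id =
      Res A m (inv_into (coind A) (coind_code A) x id)"
    using \<theta> m A \<rho>(1)[OF m] coind_shift[OF \<theta>(1) \<rho>(1)[OF m]] by (simp add: Res_coind_obj)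
qed fact

text \<open>The element \<open>u\<close> has to go to the function that sends \<open>g\<close> to
  the value of \<open>h\<close> at \<open>Res P g u\<close>: its value at \<open>id\<close> is
  prescribed by \<open>h\<close>, and equivariance determines the rest. This function belongs to
  \<open>coind A\<close> because \<open>u\<close> has a finite support.\<close>

lemma universal_counit:
  assumes A: "A \<in> Obj E" and P: "P \<in> Obj F" and h: "h \<in> Hom E (restr P) A"
  shows "\<exists>!k. k \<in> Hom F P (coind_obj A) \<and> Comp E (counit A) (FArr restr_fctr k) = h"
proof -
  note PA = Obj_FinActD(1)[OF P]
  interpret P: finsupp_action Y "Sect P ()" "Res P"
    using P by (rule Obj_FinActD)
  note hp = Hom_Act_props(3)[OF h, simplified]
  have h_M: "app h (Res P (\<rho> m) u) = Res A m (app h u)" if "m \<in> carrier M" "u \<in> Sect P ()" for m u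
    using Hom_Act_props(4)[OF h] that by simp
  define \<theta> where "\<theta> = (\<lambda>u. \<lambda>g\<in>selfmaps Y. app h (Res P g u))"
  have \<theta>: "\<theta> u \<in> coind A" if u: "u \<in> Sect P ()" for u
  proof -
    obtain Z where "finite Z" "Z \<subseteq> Y" "P.supports Z u"
      using P.finsupp[OF u] by blast
    then have "\<exists>Z. finite Z \<and> Z \<subseteq> Y \<and>
       (\<forall>f\<in>selfmaps Y. \<forall>g\<in>selfmaps Y. (\<forall>z\<in>Z. f z = g z) \<longrightarrow> app h (Res P f u) = app h (Res P g u))"
      unfolding P.supports_def by metis
    moreover have "\<forall>m\<in>carrier M. \<forall>g\<in>selfmaps Y. \<theta> u (\<rho> m \<circ> g) = Res A m (\<theta> u g)"
      using u \<rho> by (simp add: \<theta>_def P.act_comp P.act_closed h_M)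
    ultimately show ?thesis
      using u P.act_closed hp unfolding coind_def by (auto simp: \<theta>_def)
  qed
  define k where "k = hom_on P (coind_obj A) (\<lambda>u. coind_code A (\<theta> u))"
  have k: "k \<in> Hom (Act N) P (coind_obj A)"
    unfolding k_def
  proof (rule hom_on_Hom[OF PA coind_obj_Act[OF A]])
    fix u assume u: "u \<in> Sect P ()"
    then show "coind_code A (\<theta> u) \<in> Sect (coind_obj A) ()"
      using \<theta> by simp
    fix t assume "t \<in> carrier N"
    then have t: "t \<in> selfmaps Y" by simp
    have "\<theta> (Res P t u) = (\<lambda>g\<in>selfmaps Y. \<theta> u (g \<circ> t))"
      using u t by (auto simp: \<theta>_def P.act_comp intro!: restrict_ext)
    then show "coind_code A (\<theta> (Res P t u)) = Res (coind_obj A) t (coind_code A (\<theta> u))"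
      using Res_coind_obj[OF A \<theta>[OF u] t] by simp
  qed
  then have kF: "k \<in> Hom F P (coind_obj A)"
    using P coind_obj_FinAct[OF A] by (simp add: Hom_FinAct)
  have app_comp: "app (Comp E (counit A) (FArr restr_fctr k)) u = app (counit A) (app k u)"
    if "k \<in> Hom F P (coind_obj A)" "u \<in> Sect P ()" for k u
    using that Comp_Act_app[OF FArr_restr_Hom[OF that(1)] counit_Hom[OF A]] by simp
  show ?thesis
  proof (rule ex1I[of _ k], intro conjI)
    show "Comp E (counit A) (FArr restr_fctr k) = h"
    proof (rule Hom_Act_ext[OF _ h])
      show "Comp E (counit A) (FArr restr_fctr k) \<in> Hom E (restr P) A"
        using category.Comp_Hom[OF category_E FArr_restr_Hom[OF kF] counit_Hom[OF A]] .
      fix u assume "u \<in> Sect (restr P) ()"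
      then have u: "u \<in> Sect P ()" by simp
      have "app (counit A) (app k u) = app h u"
        using u A \<theta>[OF u] by (simp add: k_def \<theta>_def P.act_id)
      then show "app (Comp E (counit A) (FArr restr_fctr k)) u = app h u"
        using app_comp[OF kF u] by simp
    qed
  next
    fix k' assume k': "k' \<in> Hom F P (coind_obj A) \<and> Comp E (counit A) (FArr restr_fctr k') = h"
    note k'A = Hom_Act_props[OF Hom_FinActD[OF conjunct1[OF k']]]
    show "k' = k"
    proof (rule Hom_Act_ext[OF Hom_FinActD[OF conjunct1[OF k']] k])
      fix u assume u: "u \<in> Sect P ()"
      obtain \<psi> where \<psi>: "\<psi> \<in> coind A" "app k' u = coind_code A \<psi>"
        using k'A(3)[OF u] by auto
      have "\<psi> g = \<theta> u g" if g: "g \<in> selfmaps Y" for g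
      proof -
        have "app k' (Res P g u) = coind_code A (\<lambda>f\<in>selfmaps Y. \<psi> (f \<circ> g))"
          using k'A(4)[OF _ u, of g] g \<psi> Res_coind_obj[OF A \<psi>(1) g] by simp
        then have "app (counit A) (app k' (Res P g u)) = \<psi> g"
          using A coind_shift[OF \<psi>(1) g] by simp
        moreover have "app (counit A) (app k' (Res P g u)) = app h (Res P g u)"
          using app_comp[of k' "Res P g u"] k' P.act_closed[OF g u] by simp
        ultimately show ?thesis
          using g by (simp add: \<theta>_def)
      qed
      moreover have "\<psi> \<in> extensional (selfmaps Y)" "\<theta> u \<in> extensional (selfmaps Y)"
        using coindD(1)[OF \<psi>(1)] by (simp_all add: PiE_def \<theta>_def)
      ultimately have "\<psi> = \<theta> u"
        by (intro extensionalityI)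
      then show "app k' u = app k u"
        using \<psi> u by (simp add: k_def)
    qed
  qed (rule kF)
qed

text \<open>Tuples of points indexed by \<open>Z\<close> represent the elements supported by \<open>Z\<close>.\<close>

definition tuples :: "'y set \<Rightarrow> ('y \<Rightarrow> 'y) set" where
  "tuples Z = {x \<in> selfmaps Y. \<forall>y. y \<notin> Z \<longrightarrow> x y = y}"

definition tuples_code :: "'y set \<Rightarrow> ('y \<Rightarrow> 'y) \<Rightarrow> 'u" where
  "tuples_code Z = code_of (tuples Z)"

text \<open>A composite \<open>t \<circ> x\<close> may move points outside \<open>Z\<close>, so it
  is cut back to \<open>Z\<close>.\<close>

definition rep :: "'y set \<Rightarrow> (unit, 'y \<Rightarrow> 'y, 'u) presheaf" where
  "rep Z = action_on N (tuples_code Z ` tuples Z)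
     (\<lambda>t e. tuples_code Z (fix_outside Z (t \<circ> inv_into (tuples Z) (tuples_code Z) e)))"

lemma small_tuples: "small TYPE('u) (tuples Z)"
  using small_selfmaps[OF inaccessible small_Y] by (rule small_subset[rotated]) (auto simp: tuples_def)

lemma inv_tuples_code [simp]:
  "x \<in> tuples Z \<Longrightarrow> inv_into (tuples Z) (tuples_code Z) (tuples_code Z x) = x"
  using small_inj_on_code_of[OF small_tuples] by (simp add: tuples_code_def)

lemma tuples_selfmaps: "x \<in> tuples Z \<Longrightarrow> x \<in> selfmaps Y"
  by (simp add: tuples_def)

lemma id_tuples: "id \<in> tuples Z"
  by (simp add: tuples_def)

lemma fix_outside_tuples: "Z \<subseteq> Y \<Longrightarrow> x \<in> selfmaps Y \<Longrightarrow> fix_outside Z x \<in> tuples Z"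
  by (auto simp: tuples_def fix_outside_def selfmaps_def)

lemma Res_rep:
  "x \<in> tuples Z \<Longrightarrow> t \<in> selfmaps Y \<Longrightarrow> Res (rep Z) t (tuples_code Z x) = tuples_code Z (fix_outside Z (t \<circ> x))"
  by (simp add: rep_def)

lemma Sect_rep [simp]: "Sect (rep Z) c = tuples_code Z ` tuples Z"
  by (simp add: rep_def)

lemma rep_FinAct:
  assumes Z: "finite Z" "Z \<subseteq> Y" shows "rep Z \<in> Obj F"
proof (rule Obj_FinActI)
  show "rep Z \<in> Obj (Act N)"
    unfolding Obj_PSh rep_def
  proof (rule is_presheaf_action_on)
    show "small TYPE('u) (tuples_code Z ` tuples Z)"
      using small_tuples by (rule small_image)
  next
    fix m x assume "m \<in> carrier N" "x \<in> tuples_code Z ` tuples Z"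
    then show "tuples_code Z (fix_outside Z (m \<circ> inv_into (tuples Z) (tuples_code Z) x)) \<in> tuples_code Z ` tuples Z"
      using fix_outside_tuples[OF Z(2)] by (auto simp: tuples_selfmaps)
  next
    fix x assume "x \<in> tuples_code Z ` tuples Z"
    then obtain y where y: "y \<in> tuples Z" "x = tuples_code Z y" by blast
    then have "fix_outside Z y = y"
      by (auto simp: fix_outside_def tuples_def)
    then show "tuples_code Z (fix_outside Z (\<one>\<^bsub>N\<^esub> \<circ> inv_into (tuples Z) (tuples_code Z) x)) = x"
      using y by simp
  next
    fix m n x assume m: "m \<in> carrier N" "n \<in> carrier N" and "x \<in> tuples_code Z ` tuples Z"
    then obtain y where y: "y \<in> tuples Z" "x = tuples_code Z y" by blast
    then have "fix_outside Z (n \<circ> y) \<in> tuples Z"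
      using m fix_outside_tuples[OF Z(2)] by (simp add: tuples_selfmaps)
    then show "tuples_code Z (fix_outside Z (n \<otimes>\<^bsub>N\<^esub> m \<circ> inv_into (tuples Z) (tuples_code Z) x)) =
        tuples_code Z (fix_outside Z (m \<circ> inv_into (tuples Z) (tuples_code Z)
          (tuples_code Z (fix_outside Z (n \<circ> inv_into (tuples Z) (tuples_code Z) x)))))"
      using y by (auto intro!: arg_cong[of _ _ "tuples_code Z"] fix_outside_cong)
  qed (rule monoid_selfmaps_monoid)
next
  fix e assume "e \<in> Sect (rep Z) ()"
  then obtain x where x: "x \<in> tuples Z" "e = tuples_code Z x" by auto
  have "Res (rep Z) f e = Res (rep Z) g e"
    if "f \<in> selfmaps Y" "g \<in> selfmaps Y" "\<forall>z\<in>x ` Z. f z = g z" for f g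
    using that x by (auto simp: Res_rep intro!: arg_cong[of _ _ "tuples_code Z"] fix_outside_cong)
  then show "\<exists>Z'. finite Z' \<and> Z' \<subseteq> Y \<and> (\<forall>f\<in>selfmaps Y. \<forall>g\<in>selfmaps Y. (\<forall>z\<in>Z'. f z = g z) \<longrightarrow>
      Res (rep Z) f e = Res (rep Z) g e)"
    using Z x selfmaps_image[OF tuples_selfmaps[OF x(1)] Z(2)] by blast
qed

text \<open>The Yoneda correspondence; \<open>u\<close> is recovered as the image of the identity
  tuple.\<close>

definition rep_hom :: "'y set \<Rightarrow> (unit, 'y \<Rightarrow> 'y, 'u) presheaf \<Rightarrow> 'u \<Rightarrow> (unit, 'y \<Rightarrow> 'y, 'u) presheaf_arr" where
  "rep_hom Z P u = hom_on (rep Z) P (\<lambda>e. Res P (inv_into (tuples Z) (tuples_code Z) e) u)"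

lemma app_rep_hom: "x \<in> tuples Z \<Longrightarrow> app (rep_hom Z P u) (tuples_code Z x) = Res P x u"
  by (simp add: rep_hom_def)

lemma rep_hom:
  assumes "finite Z" "Z \<subseteq> Y" "P \<in> Obj F" "u \<in> Sect P ()" "supported Y P Z u"
  shows "rep_hom Z P u \<in> Hom F (rep Z) P"
proof -
  interpret P: finsupp_action Y "Sect P ()" "Res P"
    using assms(3) by (rule Obj_FinActD)
  have "rep_hom Z P u \<in> Hom (Act N) (rep Z) P"
    unfolding rep_hom_def
  proof (rule hom_on_Hom)
    fix e assume "e \<in> Sect (rep Z) ()"
    then obtain x where x: "x \<in> tuples Z" "e = tuples_code Z x" by auto
    then show "Res P (inv_into (tuples Z) (tuples_code Z) e) u \<in> Sect P ()"
      using assms(4) by (simp add: P.act_closed tuples_selfmaps)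
    fix t assume "t \<in> carrier N"
    then have t: "t \<in> selfmaps Y" by simp
    have tx: "fix_outside Z (t \<circ> x) \<in> tuples Z"
      using x t fix_outside_tuples[OF assms(2)] by (simp add: tuples_selfmaps)
    have "Res P (fix_outside Z (t \<circ> x)) u = Res P (t \<circ> x) u"
      using x t tx by (intro P.supportsD[OF assms(5)]) (auto simp: tuples_selfmaps)
    also have "\<dots> = Res P t (Res P x u)"
      using x t assms(4) by (simp add: P.act_comp tuples_selfmaps)
    finally show "Res P (inv_into (tuples Z) (tuples_code Z) (Res (rep Z) t e)) u =
        Res P t (Res P (inv_into (tuples Z) (tuples_code Z) e) u)"
      using x t tx by (simp add: Res_rep)
  qed (use assms rep_FinAct Obj_FinActD in auto)
  then show ?thesis
    using rep_FinAct[OF assms(1,2)] assms(3) by (simp add: Hom_FinAct)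
qed

section \<open>Finite limits on the level of elements\<close>

lemma ex1_implies_uniq: "\<exists>!x. P x \<Longrightarrow> P x \<Longrightarrow> P y \<Longrightarrow> x = y"
  by blast

text \<open>A limit in \<open>F\<close> is known only through the arrows into it, so elements are
  replaced by arrows out of \<open>rep Z\<close>. As \<open>J\<close> has finitely many objects, the
  elements \<open>a j\<close> have a common finite support \<open>Z\<close>, and the image of the
  identity tuple is the element sought.\<close>

lemma limit_elements:
  assumes J: "category J" "finite (Obj J)" and K: "is_functor J F K" and lim: "is_limit J F K v \<pi>"
    and a: "\<And>j. j \<in> Obj J \<Longrightarrow> a j \<in> Sect (FObj K j) ()"
    and a_nat: "\<And>k. k \<in> Arr J \<Longrightarrow> app (FArr K k) (a (Dom J k)) = a (Cod J k)"
  shows "\<exists>!b. b \<in> Sect v () \<and> (\<forall>j\<in>Obj J. app (\<pi> j) b = a j)"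
proof -
  interpret J: category J by fact
  interpret F: category F by (rule category_FinAct)
  have cone: "v \<in> Obj F" "\<And>j. j \<in> Obj J \<Longrightarrow> \<pi> j \<in> Hom F v (FObj K j)"
    using lim by (auto simp: is_limit_def is_cone_def)
  have K_Obj: "FObj K j \<in> Obj F" if "j \<in> Obj J" for j
    using K that is_functor_Obj by fast
  have K_Arr: "FArr K k \<in> Hom F (FObj K (Dom J k)) (FObj K (Cod J k))" if "k \<in> Arr J" for k
    using is_functor_Hom[OF K Arr_Hom[OF that]] .
  note \<pi>A = Hom_Act_props[OF Hom_FinActD[OF cone(2)]]
  note KA = Hom_Act_props[OF Hom_FinActD[OF K_Arr]]
  have "\<exists>Z. finite Z \<and> Z \<subseteq> Y \<and> supported Y (FObj K j) Z (a j)" if j: "j \<in> Obj J" for j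
    using finsupp_action.finsupp[OF Obj_FinActD(2)[OF K_Obj[OF j]] a[OF j]] .
  then obtain z where z: "\<And>j. j \<in> Obj J \<Longrightarrow> finite (z j)" "\<And>j. j \<in> Obj J \<Longrightarrow> z j \<subseteq> Y"
    "\<And>j. j \<in> Obj J \<Longrightarrow> supported Y (FObj K j) (z j) (a j)"
    by metis
  have uniq_hom: "\<exists>!h. h \<in> Hom F (rep Z) v \<and> (\<forall>j\<in>Obj J. Comp F (\<pi> j) h = rep_hom Z (FObj K j) (a j))"
    if Z: "finite Z" "Z \<subseteq> Y" "\<And>j. j \<in> Obj J \<Longrightarrow> supported Y (FObj K j) Z (a j)" for Z
  proof -
    have hom: "rep_hom Z (FObj K j) (a j) \<in> Hom F (rep Z) (FObj K j)" if "j \<in> Obj J" for j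
      using rep_hom Z K_Obj a that by blast
    have "is_cone J F K (rep Z) (\<lambda>j. rep_hom Z (FObj K j) (a j))"
      unfolding is_cone_def
    proof (intro conjI ballI)
      fix k assume k: "k \<in> Arr J"
      note d = hom[OF J.Dom_Obj[OF k]] and c = hom[OF J.Cod_Obj[OF k]]
      show "Comp F (FArr K k) (rep_hom Z (FObj K (Dom J k)) (a (Dom J k))) =
          rep_hom Z (FObj K (Cod J k)) (a (Cod J k))"
      proof (rule Hom_Act_ext[OF Hom_FinActD[OF F.Comp_Hom[OF d K_Arr[OF k]]] Hom_FinActD[OF c]])
        fix e assume e: "e \<in> Sect (rep Z) ()"
        then obtain x where x: "x \<in> tuples Z" "e = tuples_code Z x" by auto
        have "app (Comp F (FArr K k) (rep_hom Z (FObj K (Dom J k)) (a (Dom J k)))) e =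
            app (FArr K k) (app (rep_hom Z (FObj K (Dom J k)) (a (Dom J k))) e)"
          unfolding Comp_FinAct
          by (rule Comp_Act_app[OF Hom_FinActD[OF d] Hom_FinActD[OF K_Arr[OF k]] e])
        then show "app (Comp F (FArr K k) (rep_hom Z (FObj K (Dom J k)) (a (Dom J k)))) e =
            app (rep_hom Z (FObj K (Cod J k)) (a (Cod J k))) e"
          using x KA(4)[OF k _ a[OF J.Dom_Obj[OF k]], of x] a_nat[OF k]
          by (simp add: app_rep_hom tuples_selfmaps)
      qed
    qed (use rep_FinAct[OF Z(1,2)] hom in auto)
    then show ?thesis
      using lim unfolding is_limit_def by blast
  qed
  have app_comp: "app (Comp F (\<pi> j) h) e = app (\<pi> j) (app h e)"
    if "h \<in> Hom F (rep Z) v" "j \<in> Obj J" "e \<in> Sect (rep Z) ()" for h j e Z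
    unfolding Comp_FinAct
    by (rule Comp_Act_app[OF Hom_FinActD[OF that(1)] Hom_FinActD[OF cone(2)[OF that(2)]] that(3)])
  have id_Sect: "tuples_code Z id \<in> Sect (rep Z) ()" for Z
    using id_tuples by simp
  show ?thesis
  proof (rule ex_ex1I)
    let ?Z = "\<Union>j\<in>Obj J. z j"
    have supp: "supported Y (FObj K j) ?Z (a j)" if j: "j \<in> Obj J" for j
    proof -
      interpret P: finsupp_action Y "Sect (FObj K j) ()" "Res (FObj K j)"
        using K_Obj[OF j] by (rule Obj_FinActD)
      show ?thesis
        by (rule P.supports_mono[OF z(3)[OF j]]) (use j in auto)
    qed
    have Z: "finite ?Z" "?Z \<subseteq> Y"
      using z J(2) by auto
    then obtain h where h: "h \<in> Hom F (rep ?Z) v"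
      "\<And>j. j \<in> Obj J \<Longrightarrow> Comp F (\<pi> j) h = rep_hom ?Z (FObj K j) (a j)"
      using uniq_hom[OF Z supp] by blast
    have "app (\<pi> j) (app h (tuples_code ?Z id)) = a j" if j: "j \<in> Obj J" for j
      using app_comp[OF h(1) j id_Sect] h(2)[OF j] id_tuples
        Act_Res(2)[OF Obj_FinActD(1)[OF K_Obj[OF j]] a[OF j]] by (simp add: app_rep_hom)
    then show "\<exists>b. b \<in> Sect v () \<and> (\<forall>j\<in>Obj J. app (\<pi> j) b = a j)"
      using Hom_Act_props(3)[OF Hom_FinActD[OF h(1)] id_Sect] by blast
  next
    interpret v: finsupp_action Y "Sect v ()" "Res v"
      using cone(1) by (rule Obj_FinActD)
    fix b c assume b: "b \<in> Sect v () \<and> (\<forall>j\<in>Obj J. app (\<pi> j) b = a j)"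
      and c: "c \<in> Sect v () \<and> (\<forall>j\<in>Obj J. app (\<pi> j) c = a j)"
    \<comment> \<open>Arrows out of \<open>rep Z\<close> detect only elements supported by
      \<open>Z\<close>, so the supports of both candidates are included.\<close>
    define Z where "Z = v.supp b \<union> v.supp c \<union> (\<Union>j\<in>Obj J. z j)"
    have Z: "finite Z" "Z \<subseteq> Y"
      unfolding Z_def using z J(2) b c v.supp_props by auto
    have supp: "supported Y (FObj K j) Z (a j)" if j: "j \<in> Obj J" for j
    proof -
      interpret P: finsupp_action Y "Sect (FObj K j) ()" "Res (FObj K j)"
        using K_Obj[OF j] by (rule Obj_FinActD)
      show ?thesis
        by (rule P.supports_mono[OF z(3)[OF j]]) (use j in \<open>auto simp: Z_def\<close>)
    qed
    have *: "rep_hom Z v d \<in> Hom F (rep Z) v \<and>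
        (\<forall>j\<in>Obj J. Comp F (\<pi> j) (rep_hom Z v d) = rep_hom Z (FObj K j) (a j))"
      if d: "d \<in> Sect v ()" "v.supports Z d" "\<forall>j\<in>Obj J. app (\<pi> j) d = a j" for d
    proof (intro conjI ballI)
      show hom: "rep_hom Z v d \<in> Hom F (rep Z) v"
        using rep_hom Z cone(1) d by blast
      fix j assume j: "j \<in> Obj J"
      note hom_j = rep_hom[OF Z K_Obj[OF j] a[OF j] supp[OF j]]
      show "Comp F (\<pi> j) (rep_hom Z v d) = rep_hom Z (FObj K j) (a j)"
      proof (rule Hom_Act_ext[OF Hom_FinActD[OF F.Comp_Hom[OF hom cone(2)[OF j]]] Hom_FinActD[OF hom_j]])
        fix e assume e: "e \<in> Sect (rep Z) ()"
        then obtain x where x: "x \<in> tuples Z" "e = tuples_code Z x" by auto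
        then show "app (Comp F (\<pi> j) (rep_hom Z v d)) e = app (rep_hom Z (FObj K j) (a j)) e"
          using app_comp[OF hom j e] \<pi>A(4)[OF j _ d(1), of x] d(3) j
          by (simp add: app_rep_hom tuples_selfmaps)
      qed
    qed
    have "v.supports Z b" "v.supports Z c"
      using b c by (auto simp: Z_def intro: v.supports_mono[OF v.supports_supp])
    then have "rep_hom Z v b = rep_hom Z v c"
      using ex1_implies_uniq[OF uniq_hom[OF Z supp]] *[of b] *[of c] b c by blast
    then have "app (rep_hom Z v b) (tuples_code Z id) = app (rep_hom Z v c) (tuples_code Z id)"
      by simp
    then show "b = c"
      using b c id_tuples by (simp add: app_rep_hom v.act_id)
  qed
qed

text \<open>By \<open>limit_elements\<close>, the limit vertex consists of the compatible families
  of elements. So a cone over the restricted diagram factors elementwise, and uniqueness makes the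
  factorization equivariant.\<close>

lemma preserves_finite_limits_restr: "preserves_finite_limits F E restr_fctr"
  unfolding preserves_finite_limits_def
proof (intro allI impI, elim conjE)
  fix J :: "(nat, nat) cat" and K v \<pi>
  assume J: "category J" "finite (Obj J)" and K: "is_functor J F K" and lim: "is_limit J F K v \<pi>"
  interpret J: category J by fact
  interpret F: category F by (rule category_FinAct)
  interpret E: category E by (rule category_E)
  have cone: "v \<in> Obj F" "\<And>j. j \<in> Obj J \<Longrightarrow> \<pi> j \<in> Hom F v (FObj K j)"
    "\<And>k. k \<in> Arr J \<Longrightarrow> Comp F (FArr K k) (\<pi> (Dom J k)) = \<pi> (Cod J k)"
    using lim by (auto simp: is_limit_def is_cone_def)
  have K_Arr: "FArr K k \<in> Hom F (FObj K (Dom J k)) (FObj K (Cod J k))" if "k \<in> Arr J" for k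
    using is_functor_Hom[OF K Arr_Hom[OF that]] .
  note \<pi>A = Hom_Act_props[OF Hom_FinActD[OF cone(2)]]
  have \<pi>E: "FArr restr_fctr (\<pi> j) \<in> Hom E (restr v) (restr (FObj K j))" if "j \<in> Obj J" for j
    using FArr_restr_Hom[OF cone(2)[OF that]] .
  show "is_limit J E (comp_fctr restr_fctr K) (FObj restr_fctr v) (FArr restr_fctr \<circ> \<pi>)"
    unfolding is_limit_def
  proof (intro conjI allI impI)
    show "is_cone J E (comp_fctr restr_fctr K) (FObj restr_fctr v) (FArr restr_fctr \<circ> \<pi>)"
      unfolding is_cone_def
    proof (intro conjI ballI)
      fix k assume k: "k \<in> Arr J"
      show "Comp E (FArr (comp_fctr restr_fctr K) k) ((FArr restr_fctr \<circ> \<pi>) (Dom J k)) =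
          (FArr restr_fctr \<circ> \<pi>) (Cod J k)"
        using is_functor_Comp[OF is_functor_restr cone(2)[OF J.Dom_Obj[OF k]] K_Arr[OF k]] cone(3)[OF k]
        by simp
    qed (use restr_Obj Obj_FinActD(1)[OF cone(1)] \<pi>E in auto)
    fix w \<sigma> assume w: "is_cone J E (comp_fctr restr_fctr K) w \<sigma>"
    then have w_Obj: "w \<in> Obj E" and \<sigma>: "\<And>j. j \<in> Obj J \<Longrightarrow> \<sigma> j \<in> Hom E w (restr (FObj K j))"
      and \<sigma>_nat: "\<And>k. k \<in> Arr J \<Longrightarrow> Comp E (FArr restr_fctr (FArr K k)) (\<sigma> (Dom J k)) = \<sigma> (Cod J k)"
      by (auto simp: is_cone_def)
    note \<sigma>A = Hom_Act_props[OF \<sigma>]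
    have ex1: "\<exists>!b. b \<in> Sect v () \<and> (\<forall>j\<in>Obj J. app (\<pi> j) b = app (\<sigma> j) y)" if y: "y \<in> Sect w ()" for y
    proof (rule limit_elements[OF J K lim])
      show "app (\<sigma> j) y \<in> Sect (FObj K j) ()" if "j \<in> Obj J" for j
        using \<sigma>A(3)[OF that y] by simp
      fix k assume k: "k \<in> Arr J"
      have "app (\<sigma> (Cod J k)) y = app (FArr restr_fctr (FArr K k)) (app (\<sigma> (Dom J k)) y)"
        using Comp_Act_app[OF \<sigma>[OF J.Dom_Obj[OF k]] FArr_restr_Hom[OF K_Arr[OF k]] y] \<sigma>_nat[OF k] by simp
      then show "app (FArr K k) (app (\<sigma> (Dom J k)) y) = app (\<sigma> (Cod J k)) y"
        using app_FArr_restr[OF K_Arr[OF k]] \<sigma>A(3)[OF J.Dom_Obj[OF k] y] by simp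
    qed
    define b where "b = (\<lambda>y. THE b. b \<in> Sect v () \<and> (\<forall>j\<in>Obj J. app (\<pi> j) b = app (\<sigma> j) y))"
    have b: "b y \<in> Sect v ()" "\<And>j. j \<in> Obj J \<Longrightarrow> app (\<pi> j) (b y) = app (\<sigma> j) y"
      if y: "y \<in> Sect w ()" for y
      using theI'[OF ex1[OF y]] by (auto simp: b_def)
    have b_uniq: "c = b y"
      if y: "y \<in> Sect w ()" "c \<in> Sect v ()" "\<And>j. j \<in> Obj J \<Longrightarrow> app (\<pi> j) c = app (\<sigma> j) y" for c y
      using ex1[OF y(1)] b[OF y(1)] y(2,3) by blast
    note vA = Obj_FinActD(1)[OF cone(1)]
    define h where "h = hom_on w (restr v) b"
    have h: "h \<in> Hom E w (restr v)"
      unfolding h_def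
    proof (rule hom_on_Hom[OF w_Obj restr_Obj[OF vA]])
      show y: "b y \<in> Sect (restr v) ()" if "y \<in> Sect w ()" for y
        using b(1)[OF that] by simp
      fix m y assume m: "m \<in> carrier M" and y: "y \<in> Sect w ()"
      have my: "Res w m y \<in> Sect w ()"
        using Act_Res(1)[OF w_Obj m y] .
      have "Res v (\<rho> m) (b y) = b (Res w m y)"
      proof (rule b_uniq[OF my])
        show "Res v (\<rho> m) (b y) \<in> Sect v ()"
          using Act_Res(1)[OF vA] b(1)[OF y] \<rho>(1)[OF m] by simp
        fix j assume j: "j \<in> Obj J"
        have "app (\<pi> j) (Res v (\<rho> m) (b y)) = Res (FObj K j) (\<rho> m) (app (\<sigma> j) y)"
          using \<pi>A(4)[OF j _ b(1)[OF y], of "\<rho> m"] \<rho>(1)[OF m] b(2)[OF y j] by simp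
        also have "\<dots> = app (\<sigma> j) (Res w m y)"
          using \<sigma>A(4)[OF j m y] \<sigma>A(3)[OF j y] m by simp
        finally show "app (\<pi> j) (Res v (\<rho> m) (b y)) = app (\<sigma> j) (Res w m y)" .
      qed
      then show "b (Res w m y) = Res (restr v) m (b y)"
        using m b(1)[OF y] by simp
    qed
    have app_comp: "app (Comp E (FArr restr_fctr (\<pi> j)) h') y = app (\<pi> j) (app h' y)"
      if "h' \<in> Hom E w (restr v)" "j \<in> Obj J" "y \<in> Sect w ()" for h' j y
      using Comp_Act_app[OF that(1) \<pi>E[OF that(2)] that(3)] Hom_Act_props(3)[OF that(1,3)]
        app_FArr_restr[OF cone(2)[OF that(2)]] by simp
    show "\<exists>!h. h \<in> Hom E w (FObj restr_fctr v) \<and> (\<forall>j\<in>Obj J. Comp E ((FArr restr_fctr \<circ> \<pi>) j) h = \<sigma> j)"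
    proof (rule ex1I[of _ h], intro conjI ballI)
      show "h \<in> Hom E w (FObj restr_fctr v)"
        using h by simp
      fix j assume j: "j \<in> Obj J"
      have "Comp E (FArr restr_fctr (\<pi> j)) h = \<sigma> j"
      proof (rule Hom_Act_ext[OF E.Comp_Hom[OF h \<pi>E[OF j]] \<sigma>[OF j]])
        show "app (Comp E (FArr restr_fctr (\<pi> j)) h) y = app (\<sigma> j) y" if y: "y \<in> Sect w ()" for y
          using app_comp[OF h j y] b(2)[OF y j] y by (simp add: h_def)
      qed
      then show "Comp E ((FArr restr_fctr \<circ> \<pi>) j) h = \<sigma> j"
        by simp
    next
      fix h' assume h': "h' \<in> Hom E w (FObj restr_fctr v) \<and>
        (\<forall>j\<in>Obj J. Comp E ((FArr restr_fctr \<circ> \<pi>) j) h' = \<sigma> j)"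
      then have h'_Hom: "h' \<in> Hom E w (restr v)"
        and h'_comp: "\<And>j. j \<in> Obj J \<Longrightarrow> Comp E (FArr restr_fctr (\<pi> j)) h' = \<sigma> j"
        by auto
      show "h' = h"
      proof (rule Hom_Act_ext[OF h'_Hom h])
        fix y assume y: "y \<in> Sect w ()"
        have "app h' y = b y"
          using Hom_Act_props(3)[OF h'_Hom y] app_comp[OF h'_Hom _ y] h'_comp
          by (intro b_uniq[OF y]) auto
        then show "app h' y = app h y"
          using y by (simp add: h_def)
      qed
    qed
  qed
qed

end

section \<open>Encoding small actions\<close>

text \<open>Turns a function on a small set into a small class. By
  \<open>small_classes_lepoll\<close> there are no more small classes than elements of
  \<open>'u\<close>, so categories of small actions can be encoded in \<open>'u\<close>.\<close>

definition graph_code :: "'a set \<Rightarrow> ('a \<Rightarrow> 'u) \<Rightarrow> 'u set" where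
  "graph_code A f = (\<lambda>x. code_of (UNIV :: ('u \<times> 'u) set) (code_of A x, f x)) ` A"

lemma small_graph_code: "small TYPE('u) A \<Longrightarrow> small TYPE('u) (graph_code A f :: 'u set)"
  unfolding graph_code_def by (rule small_image)

context
  assumes U: "inaccessible TYPE('u)"
begin

lemma graph_code_eqD:
  assumes "small TYPE('u) A" "graph_code A f = (graph_code A g :: 'u set)" "x \<in> A"
  shows "f x = g x"
proof -
  have "(UNIV :: ('u \<times> 'u) set) \<lesssim> (UNIV :: 'u set)"
    using lepoll_universe_Times[OF U, of "UNIV :: 'u set" "UNIV :: 'u set"] by simp
  then have c: "inj (code_of (UNIV :: ('u \<times> 'u) set) :: _ \<Rightarrow> 'u)"
    by (rule inj_on_code_of)
  have e: "inj_on (code_of A :: _ \<Rightarrow> 'u) A"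
    using assms(1) by (rule small_inj_on_code_of)
  have "code_of UNIV (code_of A x :: 'u, f x) \<in> (graph_code A g :: 'u set)"
    using assms(2,3) unfolding graph_code_def by blast
  then obtain y where y: "y \<in> A" "code_of UNIV (code_of A x :: 'u, f x) = (code_of UNIV (code_of A y :: 'u, g y) :: 'u)"
    unfolding graph_code_def by blast
  have "(code_of A x :: 'u, f x) = (code_of A y, g y)"
    using injD[OF c y(2)] .
  then show ?thesis
    using inj_onD[OF e _ assms(3) y(1)] by simp
qed

text \<open>An action is determined by two small classes, its carrier and the graph of its
  operations.\<close>

lemma Obj_Act_lepoll:
  assumes M: "small TYPE('u) (carrier M)"
  shows "Obj (Act M :: ((unit, 'm, 'u) presheaf, (unit, 'm, 'u) presheaf_arr) cat) \<lesssim> (UNIV :: 'u set)"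
proof -
  let ?A = "\<lambda>P :: (unit, 'm, 'u) presheaf. carrier M \<times> Sect P ()"
  let ?c = "\<lambda>P. (Sect P (), graph_code (?A P) (\<lambda>(m, x). Res P m x))"
  let ?O = "Obj (Act M) :: (unit, 'm, 'u) presheaf set"
  have A: "small TYPE('u) (?A P)" if "P \<in> ?O" for P
    using small_Times[OF U M Act_small[OF that]] .
  have "inj_on ?c ?O"
  proof (rule inj_onI)
    fix P Q assume P: "P \<in> ?O" and Q: "Q \<in> ?O" and eq: "?c P = ?c Q"
    then have S: "Sect P () = Sect Q ()" by simp
    have "Res P m x = Res Q m x" if "m \<in> carrier M" "x \<in> Sect P ()" for m x
      using graph_code_eqD[OF A[OF P], of "\<lambda>(m, x). Res P m x" "\<lambda>(m, x). Res Q m x" "(m, x)"] eq S that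
      by simp
    then have "Res P = Res Q"
      using P Q S unfolding Obj_PSh is_presheaf_action
      by (intro extensionalityI[of _ "carrier M"] PiE_ext[of _ "Sect P ()" "\<lambda>_. Sect P ()"]) auto
    then show "P = Q"
      using S by (intro presheaf.equality) (auto simp: fun_eq_iff)
  qed
  moreover have "?c ` ?O \<subseteq> {X. small TYPE('u) X} \<times> {X. small TYPE('u) X}"
    using A Act_small small_graph_code by blast
  ultimately have "?O \<lesssim> {X :: 'u set. small TYPE('u) X} \<times> {X :: 'u set. small TYPE('u) X}"
    unfolding lepoll_def by blast
  then show ?thesis
    using lepoll_trans lepoll_universe_Times[OF U small_classes_lepoll[OF U] small_classes_lepoll[OF U]]
    by blast
qed

lemma Arr_Act_lepoll:
  assumes M: "small TYPE('u) (carrier M)"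
  shows "Arr (Act M :: ((unit, 'm, 'u) presheaf, (unit, 'm, 'u) presheaf_arr) cat) \<lesssim> (UNIV :: 'u set)"
proof -
  let ?O = "Obj (Act M) :: (unit, 'm, 'u) presheaf set"
  let ?Ar = "Arr (Act M) :: (unit, 'm, 'u) presheaf_arr set"
  let ?c = "\<lambda>(P :: (unit, 'm, 'u) presheaf, Q :: (unit, 'm, 'u) presheaf, \<alpha> :: unit \<Rightarrow> 'u \<Rightarrow> 'u).
    (P, Q, graph_code (Sect P ()) (\<alpha> ()))"
  have arr: "P \<in> ?O \<and> Q \<in> ?O \<and> \<alpha> () \<in> Sect P () \<rightarrow>\<^sub>E Sect Q ()" if "(P, Q, \<alpha>) \<in> ?Ar" for P Q \<alpha>
    using that by (simp add: PSh_def is_presheaf_arr_action)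
  have "inj_on ?c ?Ar"
  proof (rule inj_onI)
    fix s t assume st: "s \<in> ?Ar" "t \<in> ?Ar" "?c s = ?c t"
    obtain P Q \<alpha> P' Q' \<beta> where s: "s = (P, Q, \<alpha>)" and t: "t = (P', Q', \<beta>)"
      by (cases s; cases t)
    note * = st[unfolded s t]
    from *(3) have PQ: "P' = P" "Q' = Q" and g: "graph_code (Sect P ()) (\<alpha> ()) = graph_code (Sect P ()) (\<beta> ())"
      by auto
    have "\<alpha> () = \<beta> ()"
      using graph_code_eqD[OF Act_small g] arr[OF *(1)] arr[OF *(2)] PQ
      by (intro PiE_ext[of _ "Sect P ()" "\<lambda>_. Sect Q ()"]) auto
    then show "s = t"
      using PQ by (auto simp: s t fun_eq_iff)
  qed
  moreover have "?c ` ?Ar \<subseteq> ?O \<times> ?O \<times> {X. small TYPE('u) X}"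
  proof (rule image_subsetI)
    fix t assume t: "t \<in> ?Ar"
    obtain P Q \<alpha> where "t = (P, Q, \<alpha>)"
      by (cases t)
    then show "?c t \<in> ?O \<times> ?O \<times> {X. small TYPE('u) X}"
      using arr[of P Q \<alpha>] t small_graph_code[OF Act_small[of P M]] by simp
  qed
  ultimately have "?Ar \<lesssim> ?O \<times> ?O \<times> {X :: 'u set. small TYPE('u) X}"
    unfolding lepoll_def by blast
  moreover have "?O \<times> ?O \<times> {X :: 'u set. small TYPE('u) X} \<lesssim> (UNIV :: 'u set)"
    by (intro lepoll_universe_Times[OF U] Obj_Act_lepoll M small_classes_lepoll[OF U])
  ultimately show ?thesis
    by (rule lepoll_trans)
qed

end

section \<open>Finitely supported actions as presheaves\<close>

lemma (in coding) is_presheaf_codedI: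
  fixes P :: "('p, 'b, 'u) presheaf"
  assumes "Sect P \<in> extensional (Obj CK)" "Res P \<in> extensional (Arr CK)"
    and "\<And>x. x \<in> Obj K \<Longrightarrow> small TYPE('u) (Sect P (eo x))"
    and "\<And>f x y. f \<in> Hom K x y \<Longrightarrow> Res P (ea f) \<in> Sect P (eo y) \<rightarrow>\<^sub>E Sect P (eo x)"
    and "\<And>x s. x \<in> Obj K \<Longrightarrow> s \<in> Sect P (eo x) \<Longrightarrow> Res P (ea (Ident K x)) s = s"
    and "\<And>f g x y z s. f \<in> Hom K x y \<Longrightarrow> g \<in> Hom K y z \<Longrightarrow> s \<in> Sect P (eo z) \<Longrightarrow>
      Res P (ea (Comp K g f)) s = Res P (ea f) (Res P (ea g) s)"
  shows "is_presheaf CK P"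
  unfolding is_presheaf_def
proof (intro conjI ballI impI)
  fix a assume a: "a \<in> Arr CK"
  obtain x y f where "f \<in> Hom K x y" "Dom CK a = eo x" "Cod CK a = eo y" "a = ea f"
    using Arr_Hom[OF a] by (elim Hom_codedE) metis
  then show "Res P a \<in> Sect P (Cod CK a) \<rightarrow>\<^sub>E Sect P (Dom CK a)"
    using assms(4) by simp
next
  fix c s assume "c \<in> Obj CK" "s \<in> Sect P c"
  then show "Res P (Ident CK c) s = s"
    using assms(5) by (auto simp: Ident_coded)
next
  fix a b s assume a: "a \<in> Arr CK" and b: "b \<in> Arr CK" and ab: "Dom CK b = Cod CK a"
    and s: "s \<in> Sect P (Cod CK b)"
  obtain x y f where f: "x \<in> Obj K" "y \<in> Obj K" "f \<in> Hom K x y" "Cod CK a = eo y" "a = ea f"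
    using Arr_Hom[OF a] by (elim Hom_codedE) metis
  obtain y' z g where g: "y' \<in> Obj K" "z \<in> Obj K" "g \<in> Hom K y' z" "Dom CK b = eo y'" "Cod CK b = eo z" "b = ea g"
    using Arr_Hom[OF b] by (elim Hom_codedE) metis
  have "y' = y"
    using ab f g inj_eo by (auto dest: inj_onD)
  then show "Res P (Comp CK b a) s = Res P a (Res P b s)"
    using assms(6)[OF f(3), of g z s] f g s by (simp add: Comp_coded HomD(1)[OF f(3)] HomD(1)[OF g(3)])
qed (use assms in auto)

lemma (in coding) is_presheaf_codedD:
  fixes P :: "('p, 'b, 'u) presheaf"
  assumes "is_presheaf CK P"
  shows "x \<in> Obj K \<Longrightarrow> small TYPE('u) (Sect P (eo x))"
    and "f \<in> Hom K x y \<Longrightarrow> s \<in> Sect P (eo y) \<Longrightarrow> Res P (ea f) s \<in> Sect P (eo x)"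
    and "x \<in> Obj K \<Longrightarrow> s \<in> Sect P (eo x) \<Longrightarrow> Res P (ea (Ident K x)) s = s"
    and "f \<in> Hom K x y \<Longrightarrow> g \<in> Hom K y z \<Longrightarrow> s \<in> Sect P (eo z) \<Longrightarrow>
      Res P (ea (Comp K g f)) s = Res P (ea f) (Res P (ea g) s)"
proof -
  have hom: "ea f \<in> Arr CK \<and> Dom CK (ea f) = eo x \<and> Cod CK (ea f) = eo y" if "f \<in> Hom K x y" for f x y
    using HomD[OF that] by (auto simp: coded_def inj_ea)
  show "x \<in> Obj K \<Longrightarrow> small TYPE('u) (Sect P (eo x))"
    using assms by (simp add: is_presheaf_def)
  show "Res P (ea f) s \<in> Sect P (eo x)" if "f \<in> Hom K x y" "s \<in> Sect P (eo y)"
  proof -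
    have "Res P (ea f) \<in> Sect P (eo y) \<rightarrow>\<^sub>E Sect P (eo x)"
      using assms hom[OF that(1)] unfolding is_presheaf_def by metis
    then show ?thesis
      using that(2) by (rule PiE_mem)
  qed
  show "Res P (ea (Ident K x)) s = s" if "x \<in> Obj K" "s \<in> Sect P (eo x)"
  proof -
    have "Res P (Ident CK (eo x)) s = s"
      using assms that by (simp add: is_presheaf_def)
    then show ?thesis
      using that by (simp add: Ident_coded)
  qed
  show "Res P (ea (Comp K g f)) s = Res P (ea f) (Res P (ea g) s)"
    if "f \<in> Hom K x y" "g \<in> Hom K y z" "s \<in> Sect P (eo z)"
  proof -
    have "Res P (Comp CK (ea g) (ea f)) s = Res P (ea f) (Res P (ea g) s)"
      using assms hom[OF that(1)] hom[OF that(2)] that(3) unfolding is_presheaf_def by metis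
    then show ?thesis
      using that by (simp add: Comp_coded HomD(1)[OF that(1)] HomD(1)[OF that(2)])
  qed
qed

lemma (in coding) is_presheaf_arr_codedI:
  assumes "is_presheaf CK P" "is_presheaf CK Q" "\<alpha> \<in> extensional (Obj CK)"
    and "\<And>x. x \<in> Obj K \<Longrightarrow> \<alpha> (eo x) \<in> Sect P (eo x) \<rightarrow>\<^sub>E Sect Q (eo x)"
    and "\<And>f x y s. f \<in> Hom K x y \<Longrightarrow> s \<in> Sect P (eo y) \<Longrightarrow>
      \<alpha> (eo x) (Res P (ea f) s) = Res Q (ea f) (\<alpha> (eo y) s)"
  shows "is_presheaf_arr CK (P, Q, \<alpha>)"
  unfolding is_presheaf_arr_def prod.case
proof (intro conjI ballI)
  fix a s assume a: "a \<in> Arr CK" and s: "s \<in> Sect P (Cod CK a)"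
  obtain x y f where f: "f \<in> Hom K x y" "Dom CK a = eo x" "Cod CK a = eo y" "a = ea f"
    using Arr_Hom[OF a] by (elim Hom_codedE) metis
  then show "\<alpha> (Dom CK a) (Res P a s) = Res Q a (\<alpha> (Cod CK a) s)"
    using assms(5)[OF f(1)] s by simp
qed (use assms in auto)

lemma (in coding) is_presheaf_arr_codedD:
  assumes "is_presheaf_arr CK (P, Q, \<alpha>)"
  shows "x \<in> Obj K \<Longrightarrow> \<alpha> (eo x) \<in> Sect P (eo x) \<rightarrow>\<^sub>E Sect Q (eo x)"
    and "f \<in> Hom K x y \<Longrightarrow> s \<in> Sect P (eo y) \<Longrightarrow>
      \<alpha> (eo x) (Res P (ea f) s) = Res Q (ea f) (\<alpha> (eo y) s)"
proof -
  have hom: "ea f \<in> Arr CK \<and> Dom CK (ea f) = eo x \<and> Cod CK (ea f) = eo y" if "f \<in> Hom K x y" for f x y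
    using HomD[OF that] by (auto simp: coded_def inj_ea)
  show "x \<in> Obj K \<Longrightarrow> \<alpha> (eo x) \<in> Sect P (eo x) \<rightarrow>\<^sub>E Sect Q (eo x)"
    using assms by (simp add: is_presheaf_arr_def)
  show "\<alpha> (eo x) (Res P (ea f) s) = Res Q (ea f) (\<alpha> (eo y) s)" if "f \<in> Hom K x y" "s \<in> Sect P (eo y)"
    using assms hom[OF that(1)] that(2) unfolding is_presheaf_arr_def prod.case by metis
qed

lemma iso_arr_PSh:
  assumes "category C" and \<alpha>: "is_presheaf_arr C (P, Q, \<alpha>)"
    and bij: "\<And>c. c \<in> Obj C \<Longrightarrow> bij_betw (\<alpha> c) (Sect P c) (Sect Q c)"
  shows "iso_arr (PSh C) (P, Q, \<alpha>)"
proof -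
  interpret category C by fact
  have P: "is_presheaf C P" and Q: "is_presheaf C Q"
    and nat: "\<And>f x. f \<in> Arr C \<Longrightarrow> x \<in> Sect P (Cod C f) \<Longrightarrow>
      \<alpha> (Dom C f) (Res P f x) = Res Q f (\<alpha> (Cod C f) x)"
    using \<alpha> by (auto simp: is_presheaf_arr_def)
  define \<beta> where "\<beta> = (\<lambda>c\<in>Obj C. \<lambda>y\<in>Sect Q c. inv_into (Sect P c) (\<alpha> c) y)"
  have \<beta>_in: "\<beta> c y \<in> Sect P c" and \<alpha>\<beta>: "\<alpha> c (\<beta> c y) = y" if "c \<in> Obj C" "y \<in> Sect Q c" for c y
    using bij_betw_imp_surj_on[OF bij[OF that(1)]] that by (auto simp: \<beta>_def f_inv_into_f inv_into_into)
  have \<beta>\<alpha>: "\<beta> c (\<alpha> c x) = x" and \<alpha>_in: "\<alpha> c x \<in> Sect Q c" if "c \<in> Obj C" "x \<in> Sect P c" for c x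
    using bij[OF that(1)] that by (auto simp: \<beta>_def bij_betw_def)
  have "is_presheaf_arr C (Q, P, \<beta>)"
    unfolding is_presheaf_arr_def prod.case
  proof (intro conjI ballI)
    fix c assume "c \<in> Obj C"
    then show "\<beta> c \<in> Sect Q c \<rightarrow>\<^sub>E Sect P c"
      using \<beta>_in by (auto simp: \<beta>_def)
  next
    fix f y assume f: "f \<in> Arr C" and y: "y \<in> Sect Q (Cod C f)"
    let ?x = "\<beta> (Cod C f) y"
    have x: "?x \<in> Sect P (Cod C f)" "\<alpha> (Cod C f) ?x = y"
      using \<beta>_in \<alpha>\<beta> Cod_Obj[OF f] y by auto
    have "Res P f ?x \<in> Sect P (Dom C f)"
      using P f x by (auto simp: is_presheaf_def)
    then show "\<beta> (Dom C f) (Res Q f y) = Res P f ?x"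
      using nat[OF f x(1)] x(2) \<beta>\<alpha>[OF Dom_Obj[OF f]] by metis
  qed (use P Q in \<open>auto simp: \<beta>_def\<close>)
  then have \<beta>: "(Q, P, \<beta>) \<in> Hom (PSh C) Q P" and \<alpha>': "(P, Q, \<alpha>) \<in> Hom (PSh C) P Q"
    using \<alpha> by (auto simp: Hom_PSh)
  show ?thesis
  proof (rule iso_arrI[OF \<alpha>' \<beta>])
    show "Comp (PSh C) (Q, P, \<beta>) (P, Q, \<alpha>) = Ident (PSh C) P"
      using \<beta>\<alpha> by (auto simp: Comp_PSh Ident_PSh compose_def intro!: restrict_ext)
    show "Comp (PSh C) (P, Q, \<alpha>) (Q, P, \<beta>) = Ident (PSh C) Q"
      using \<alpha>\<beta> by (auto simp: Comp_PSh Ident_PSh compose_def intro!: restrict_ext)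
  qed
qed

lemma selfmaps_extend:
  assumes "g ` Z \<subseteq> W" "W \<subseteq> Y" "Z \<subseteq> Y" "\<forall>y. y \<notin> Z \<longrightarrow> g y = y"
  shows "g \<in> selfmaps Y"
proof -
  have "g y \<in> Y" if "y \<in> Y" for y
    using assms that by (cases "y \<in> Z") auto
  then show ?thesis
    using assms by (auto simp: selfmaps_def)
qed

text \<open>An arrow from \<open>W\<close> to \<open>Z\<close> is a map from \<open>Z\<close> to \<open>W\<close>, extended by the identity.\<close>

definition site :: "'y set \<Rightarrow> ('y set, 'y set \<times> 'y set \<times> ('y \<Rightarrow> 'y)) cat" where
  "site Y = \<lparr>
     Obj = {Z. finite Z \<and> Z \<noteq> {} \<and> Z \<subseteq> Y},
     Arr = {(W, Z, g). finite W \<and> W \<noteq> {} \<and> W \<subseteq> Y \<and> finite Z \<and> Z \<noteq> {} \<and> Z \<subseteq> Y \<and>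
       g ` Z \<subseteq> W \<and> (\<forall>y. y \<notin> Z \<longrightarrow> g y = y)},
     Dom = (\<lambda>(W, Z, g). W),
     Cod = (\<lambda>(W, Z, g). Z),
     Ident = (\<lambda>Z. (Z, Z, id)),
     Comp = (\<lambda>(_, Z', g') (W, Z, g). (W, Z', fix_outside Z' (g \<circ> g')))\<rparr>"

lemma Obj_site: "Z \<in> Obj (site Y) \<longleftrightarrow> finite Z \<and> Z \<noteq> {} \<and> Z \<subseteq> Y"
  by (simp add: site_def)

lemma Hom_site:
  "f \<in> Hom (site Y) W Z \<longleftrightarrow> (\<exists>g. f = (W, Z, g) \<and> W \<in> Obj (site Y) \<and> Z \<in> Obj (site Y) \<and>
     g ` Z \<subseteq> W \<and> (\<forall>y. y \<notin> Z \<longrightarrow> g y = y))"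
  by (cases f) (auto simp: Hom_def site_def)

lemma Comp_site [simp]: "Comp (site Y) (Z, Z', g') (W, Z, g) = (W, Z', fix_outside Z' (g \<circ> g'))"
  by (simp add: site_def)

lemma Ident_site [simp]: "Ident (site Y) Z = (Z, Z, id)"
  by (simp add: site_def)

lemma category_site: "category (site Y)"
proof
  show "f \<in> Arr (site Y) \<Longrightarrow> Dom (site Y) f \<in> Obj (site Y)"
    "f \<in> Arr (site Y) \<Longrightarrow> Cod (site Y) f \<in> Obj (site Y)" for f
    by (auto simp: site_def)
  show "x \<in> Obj (site Y) \<Longrightarrow> Ident (site Y) x \<in> Hom (site Y) x x" for x
    by (auto simp: Hom_site)
next
  fix f g x y z assume "f \<in> Hom (site Y) x y" "g \<in> Hom (site Y) y z"
  then show "Comp (site Y) g f \<in> Hom (site Y) x z"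
    by (auto simp: Hom_site fix_outside_def image_subset_iff)
next
  fix f x y assume "f \<in> Hom (site Y) x y"
  then show "Comp (site Y) f (Ident (site Y) x) = f" "Comp (site Y) (Ident (site Y) y) f = f"
    by (auto simp: Hom_site fix_outside_def fun_eq_iff)
next
  fix f g h w x y z assume "f \<in> Hom (site Y) w x" "g \<in> Hom (site Y) x y" "h \<in> Hom (site Y) y z"
  then show "Comp (site Y) h (Comp (site Y) g f) = Comp (site Y) (Comp (site Y) h g) f"
    by (auto simp: Hom_site fix_outside_def fun_eq_iff image_subset_iff)
qed

section \<open>The presheaf of supported elements\<close>

context small_points
begin

lemma small_site: "small TYPE('u) (Obj (site Y))" "small TYPE('u) (Arr (site Y))"
proof -
  show Obj: "small TYPE('u) (Obj (site Y))"
    by (rule small_subset[OF _ small_Pow[OF inaccessible small_Y]]) (auto simp: Obj_site)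
  have "Arr (site Y) \<subseteq> Obj (site Y) \<times> Obj (site Y) \<times> selfmaps Y"
    by (auto simp: site_def intro: selfmaps_extend)
  then show "small TYPE('u) (Arr (site Y))"
    by (rule small_subset)
      (intro small_Times[OF inaccessible] Obj small_selfmaps[OF inaccessible small_Y])
qed

definition eo :: "'y set \<Rightarrow> 'u" where "eo = code_of (Obj (site Y))"
definition ea :: "'y set \<times> 'y set \<times> ('y \<Rightarrow> 'y) \<Rightarrow> 'u" where "ea = code_of (Arr (site Y))"

sublocale coding "site Y" eo ea
  unfolding eo_def ea_def
  by (intro coding.intro category_site coding_axioms.intro small_inj_on_code_of small_site)

abbreviation "PC \<equiv> (PSh CK :: (('u, 'u, 'u) presheaf, ('u, 'u, 'u) presheaf_arr) cat)"

lemma category_PC: "category PC"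
  by (rule category_PSh[OF category_coded])

text \<open>A map from \<open>Z\<close> to \<open>W\<close> carries elements supported by
  \<open>Z\<close> to elements supported by \<open>W\<close>. This becomes a restriction map because
  the arrows of the site run the opposite way.\<close>

definition elems :: "(unit, 'y \<Rightarrow> 'y, 'u) presheaf \<Rightarrow> 'u \<Rightarrow> 'u set" where
  "elems P c = {u \<in> Sect P (). supported Y P (FObj dec c) u}"

definition elems_psh :: "(unit, 'y \<Rightarrow> 'y, 'u) presheaf \<Rightarrow> ('u, 'u, 'u) presheaf" where
  "elems_psh P = \<lparr>Sect = (\<lambda>c\<in>Obj CK. elems P c),
     Res = (\<lambda>a\<in>Arr CK. \<lambda>u\<in>elems P (Cod CK a). Res P (snd (snd (FArr dec a))) u)\<rparr>"

lemma Sect_elems_psh [simp]: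
  "Z \<in> Obj (site Y) \<Longrightarrow> Sect (elems_psh P) (eo Z) = {u \<in> Sect P (). supported Y P Z u}"
  by (simp add: elems_psh_def elems_def)

lemma Res_elems_psh:
  assumes "(W, Z, g) \<in> Hom (site Y) W Z"
  shows "Res (elems_psh P) (ea (W, Z, g)) = (\<lambda>u\<in>{u \<in> Sect P (). supported Y P Z u}. Res P g u)"
proof -
  have "FObj dec (eo Z) = Z"
    using assms by (simp add: Hom_site)
  then show ?thesis
    using HomD[OF assms] by (simp add: elems_psh_def elems_def coded_def inj_ea)
qed

lemma site_arr_selfmaps: "(W, Z, g) \<in> Hom (site Y) W Z \<Longrightarrow> g \<in> selfmaps Y"
  using selfmaps_extend[of g Z W Y] by (simp add: Hom_site Obj_site)

lemma elems_psh_presheaf: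
  assumes P: "P \<in> Obj F" shows "is_presheaf CK (elems_psh P)"
proof (rule is_presheaf_codedI)
  interpret P: finsupp_action Y "Sect P ()" "Res P"
    using P by (rule Obj_FinActD)
  show "Sect (elems_psh P) \<in> extensional (Obj CK)" "Res (elems_psh P) \<in> extensional (Arr CK)"
    by (simp_all add: elems_psh_def)
  show "small TYPE('u) (Sect (elems_psh P) (eo Z))" if "Z \<in> Obj (site Y)" for Z
    unfolding Sect_elems_psh[OF that]
    by (rule small_subset[OF _ Act_small[OF Obj_FinActD(1)[OF P]]]) simp
  show "Res (elems_psh P) (ea f) \<in> Sect (elems_psh P) (eo Z) \<rightarrow>\<^sub>E Sect (elems_psh P) (eo W)"
    if f: "f \<in> Hom (site Y) W Z" for f W Z
  proof -
    obtain g where g: "f = (W, Z, g)" "g ` Z \<subseteq> W" "W \<in> Obj (site Y)" "Z \<in> Obj (site Y)"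
      using f by (auto simp: Hom_site)
    have gT: "g \<in> selfmaps Y"
      using f g site_arr_selfmaps by blast
    have "supported Y P W (Res P g u)" if "u \<in> Sect P ()" "supported Y P Z u" for u
      using P.supports_mono[OF P.supports_act[OF that(2,1) gT] g(2)] .
    then show ?thesis
      using f g gT by (auto simp: Res_elems_psh P.act_closed)
  qed
  show "Res (elems_psh P) (ea (Ident (site Y) Z)) s = s"
    if "Z \<in> Obj (site Y)" "s \<in> Sect (elems_psh P) (eo Z)" for Z s
    using that Res_elems_psh[of Z Z id P] P.act_id category.Ident_Hom[OF category_site, of Z Y] by simp
  show "Res (elems_psh P) (ea (Comp (site Y) g f)) s = Res (elems_psh P) (ea f) (Res (elems_psh P) (ea g) s)"
    if fg: "f \<in> Hom (site Y) V W" "g \<in> Hom (site Y) W Z" and s: "s \<in> Sect (elems_psh P) (eo Z)"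
    for f g V W Z s
  proof -
    obtain f' where f': "f = (V, W, f')"
      using fg(1) by (auto simp: Hom_site)
    obtain g' where g': "g = (W, Z, g')" "g' ` Z \<subseteq> W" "Z \<in> Obj (site Y)"
      using fg(2) by (auto simp: Hom_site)
    have T: "f' \<in> selfmaps Y" "g' \<in> selfmaps Y"
      using fg f' g' site_arr_selfmaps by blast+
    have c: "(V, Z, fix_outside Z (f' \<circ> g')) \<in> Hom (site Y) V Z"
      using category.Comp_Hom[OF category_site fg] f' g' by simp
    have s': "s \<in> Sect P ()" "supported Y P Z s"
      using s g' by auto
    have "Res P (fix_outside Z (f' \<circ> g')) s = Res P (f' \<circ> g') s"
      using site_arr_selfmaps[OF c] T by (intro P.supportsD[OF s'(2)]) auto
    moreover have "supported Y P W (Res P g' s)"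
      using P.supports_mono[OF P.supports_act[OF s'(2,1) T(2)] g'(2)] .
    ultimately show ?thesis
      using fg f' g' c s' T by (simp add: Res_elems_psh P.act_comp P.act_closed)
  qed
qed

definition elems_fctr where
  "elems_fctr = \<lparr>FObj = elems_psh, FArr = (\<lambda>f. (elems_psh (Dom F f), elems_psh (Cod F f),
     \<lambda>c\<in>Obj CK. \<lambda>u\<in>elems (Dom F f) c. app f u))\<rparr>"

lemma FObj_elems [simp]: "FObj elems_fctr P = elems_psh P"
  by (simp add: elems_fctr_def)

text \<open>If two selfmaps act equally on \<open>u\<close>, they act equally on its image under an
  equivariant map.\<close>

lemma hom_supported:
  assumes f: "f \<in> Hom F P Q" and u: "u \<in> Sect P ()" "supported Y P Z u"
  shows "supported Y Q Z (app f u)"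
proof -
  interpret F: category F by (rule category_FinAct)
  note PQ = F.Hom_Obj[OF f]
  interpret P: finsupp_action Y "Sect P ()" "Res P"
    using PQ by (blast intro: Obj_FinActD)
  interpret Q: finsupp_action Y "Sect Q ()" "Res Q"
    using PQ by (blast intro: Obj_FinActD)
  note fA = Hom_Act_props[OF Hom_FinActD[OF f]]
  show ?thesis
    unfolding Q.supports_def
  proof (intro ballI impI)
    fix g h assume gh: "g \<in> selfmaps Y" "h \<in> selfmaps Y" "\<forall>z\<in>Z. g z = h z"
    then have "Res P g u = Res P h u"
      by (intro P.supportsD[OF u(2)]) auto
    then show "Res Q g (app f u) = Res Q h (app f u)"
      using fA(4)[OF _ u(1), of g] fA(4)[OF _ u(1), of h] gh by simp
  qed
qed

lemma FArr_elems:
  assumes f: "f \<in> Hom F P Q"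
  shows "\<exists>\<alpha>. FArr elems_fctr f = (elems_psh P, elems_psh Q, \<alpha>) \<and>
    is_presheaf_arr CK (elems_psh P, elems_psh Q, \<alpha>) \<and>
    (\<forall>Z\<in>Obj (site Y). \<forall>u. u \<in> Sect P () \<longrightarrow> supported Y P Z u \<longrightarrow> \<alpha> (eo Z) u = app f u)"
proof -
  interpret F: category F by (rule category_FinAct)
  note PQ = F.Hom_Obj[OF f]
  note fA = Hom_Act_props[OF Hom_FinActD[OF f]]
  let ?\<alpha> = "\<lambda>c\<in>Obj CK. \<lambda>u\<in>elems P c. app f u"
  have \<alpha>: "?\<alpha> (eo Z) u = app f u" if "Z \<in> Obj (site Y)" "u \<in> Sect P ()" "supported Y P Z u" for Z u
    using that by (simp add: elems_def)
  have "is_presheaf_arr CK (elems_psh P, elems_psh Q, ?\<alpha>)"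
  proof (rule is_presheaf_arr_codedI)
    show "is_presheaf CK (elems_psh P)" "is_presheaf CK (elems_psh Q)"
      using PQ elems_psh_presheaf by blast+
    show "?\<alpha> (eo Z) \<in> Sect (elems_psh P) (eo Z) \<rightarrow>\<^sub>E Sect (elems_psh Q) (eo Z)" if "Z \<in> Obj (site Y)" for Z
      using that fA(3) hom_supported[OF f] by (auto simp: elems_def)
    show "?\<alpha> (eo W) (Res (elems_psh P) (ea a) s) = Res (elems_psh Q) (ea a) (?\<alpha> (eo Z) s)"
      if a: "a \<in> Hom (site Y) W Z" and s: "s \<in> Sect (elems_psh P) (eo Z)" for a W Z s
    proof -
      obtain g where g: "a = (W, Z, g)" "W \<in> Obj (site Y)" "Z \<in> Obj (site Y)"
        using a by (auto simp: Hom_site)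
      have gT: "g \<in> selfmaps Y"
        using a g site_arr_selfmaps by blast
      have s': "s \<in> Sect P ()" "supported Y P Z s"
        using s g by auto
      have "Res (elems_psh P) (ea a) s \<in> Sect (elems_psh P) (eo W)"
        using is_presheaf_codedD(2)[OF elems_psh_presheaf a s] PQ by blast
      then have "Res P g s \<in> Sect P () \<and> supported Y P W (Res P g s)"
        using a g s' by (simp add: Res_elems_psh)
      then have "?\<alpha> (eo W) (Res P g s) = app f (Res P g s)"
        by (intro \<alpha>[OF g(2)]) simp_all
      also have "\<dots> = Res Q g (app f s)"
        using fA(4)[OF _ s'(1)] gT by simp
      also have "\<dots> = Res (elems_psh Q) (ea a) (app f s)"
        using a g hom_supported[OF f s'] fA(3)[OF s'(1)] by (simp add: Res_elems_psh)
      also have "Res P g s = Res (elems_psh P) (ea a) s"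
        using a g s' by (simp add: Res_elems_psh)
      finally show ?thesis
        unfolding \<alpha>[OF g(3) s'] .
    qed
  qed simp
  moreover have "FArr elems_fctr f = (elems_psh P, elems_psh Q, ?\<alpha>)"
    using HomD[OF f] by (simp add: elems_fctr_def)
  ultimately show ?thesis
    using \<alpha> by blast
qed

lemma FArr_elems_Hom: "f \<in> Hom F P Q \<Longrightarrow> FArr elems_fctr f \<in> Hom PC (elems_psh P) (elems_psh Q)"
  using FArr_elems[of f P Q] by (auto simp: Hom_PSh)

lemma elems_arr_ext:
  assumes "is_presheaf_arr CK (elems_psh P, B, \<alpha>)" "is_presheaf_arr CK (elems_psh P, B, \<beta>)"
    and "\<And>Z u. Z \<in> Obj (site Y) \<Longrightarrow> u \<in> Sect P () \<Longrightarrow> supported Y P Z u \<Longrightarrow> \<alpha> (eo Z) u = \<beta> (eo Z) u"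
  shows "(elems_psh P, B, \<alpha>) = (elems_psh P, B, \<beta>)"
  using assms by (intro is_presheaf_arr_ext[OF assms(1,2)]) auto

lemma is_functor_elems: "is_functor F PC elems_fctr"
proof (rule is_functorI)
  interpret F: category F by (rule category_FinAct)
  fix P assume P: "P \<in> Obj F"
  obtain \<alpha> where \<alpha>: "FArr elems_fctr (Ident F P) = (elems_psh P, elems_psh P, \<alpha>)"
    "is_presheaf_arr CK (elems_psh P, elems_psh P, \<alpha>)"
    "\<And>Z u. Z \<in> Obj (site Y) \<Longrightarrow> u \<in> Sect P () \<Longrightarrow> supported Y P Z u \<Longrightarrow> \<alpha> (eo Z) u = app (Ident F P) u"
    using FArr_elems[OF F.Ident_Hom[OF P]] by blast
  have i: "Ident PC (elems_psh P) \<in> Hom PC (elems_psh P) (elems_psh P)"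
    using category.Ident_Hom[OF category_PC] elems_psh_presheaf[OF P] by (simp add: Obj_PSh)
  show "FArr elems_fctr (Ident F P) = Ident PC (FObj elems_fctr P)"
    unfolding \<alpha>(1) FObj_elems Ident_PSh
  proof (rule elems_arr_ext[OF \<alpha>(2)])
    show "is_presheaf_arr CK (elems_psh P, elems_psh P, \<lambda>c\<in>Obj CK. \<lambda>x\<in>Sect (elems_psh P) c. x)"
      using i by (simp add: Ident_PSh Hom_PSh)
  qed (simp add: \<alpha>(3) Ident_FinAct Ident_Act_app)
next
  interpret F: category F by (rule category_FinAct)
  fix f g P Q R assume fg: "f \<in> Hom F P Q" "g \<in> Hom F Q R"
  note c = F.Comp_Hom[OF fg]
  obtain \<alpha> where \<alpha>: "FArr elems_fctr f = (elems_psh P, elems_psh Q, \<alpha>)"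
    "\<And>Z u. Z \<in> Obj (site Y) \<Longrightarrow> u \<in> Sect P () \<Longrightarrow> supported Y P Z u \<Longrightarrow> \<alpha> (eo Z) u = app f u"
    using FArr_elems[OF fg(1)] by blast
  obtain \<beta> where \<beta>: "FArr elems_fctr g = (elems_psh Q, elems_psh R, \<beta>)"
    "\<And>Z u. Z \<in> Obj (site Y) \<Longrightarrow> u \<in> Sect Q () \<Longrightarrow> supported Y Q Z u \<Longrightarrow> \<beta> (eo Z) u = app g u"
    using FArr_elems[OF fg(2)] by blast
  obtain \<gamma> where \<gamma>: "FArr elems_fctr (Comp F g f) = (elems_psh P, elems_psh R, \<gamma>)"
    "is_presheaf_arr CK (elems_psh P, elems_psh R, \<gamma>)"
    "\<And>Z u. Z \<in> Obj (site Y) \<Longrightarrow> u \<in> Sect P () \<Longrightarrow> supported Y P Z u \<Longrightarrow> \<gamma> (eo Z) u = app (Comp F g f) u"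
    using FArr_elems[OF c] by blast
  have h: "Comp PC (FArr elems_fctr g) (FArr elems_fctr f) \<in> Hom PC (elems_psh P) (elems_psh R)"
    using category.Comp_Hom[OF category_PC] FArr_elems_Hom fg by blast
  have app: "app (Comp F g f) u = app g (app f u)" if "u \<in> Sect P ()" for u
    unfolding Comp_FinAct by (rule Comp_Act_app[OF Hom_FinActD[OF fg(1)] Hom_FinActD[OF fg(2)] that])
  note fA = Hom_Act_props[OF Hom_FinActD[OF fg(1)]]
  show "FArr elems_fctr (Comp F g f) = Comp PC (FArr elems_fctr g) (FArr elems_fctr f)"
    unfolding \<gamma>(1) \<alpha>(1) \<beta>(1) Comp_PSh
  proof (rule elems_arr_ext[OF \<gamma>(2)])
    show "is_presheaf_arr CK (elems_psh P, elems_psh R,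
        \<lambda>c\<in>Obj CK. compose (Sect (elems_psh P) c) (\<beta> c) (\<alpha> c))"
      using h by (simp add: \<alpha>(1) \<beta>(1) Comp_PSh Hom_PSh)
  qed (simp add: \<gamma>(3) \<alpha>(2) \<beta>(2) compose_def app fA(3) hom_supported[OF fg(1)])
qed (use elems_psh_presheaf FArr_elems_Hom category_FinAct in \<open>auto simp: Obj_PSh\<close>)

end

section \<open>The equivalence with presheaves on the site\<close>

context small_points
begin

text \<open>Supports may be empty but objects of the site may not, so a point of \<open>Y\<close> is
  added.\<close>

lemma ex_site_support:
  assumes P: "P \<in> Obj F" and u: "u \<in> Sect P ()"
  shows "\<exists>Z\<in>Obj (site Y). supported Y P Z u"
proof -
  interpret P: finsupp_action Y "Sect P ()" "Res P"
    using P by (rule Obj_FinActD)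
  obtain Z where Z: "finite Z" "Z \<subseteq> Y" "P.supports Z u"
    using P.finsupp[OF u] by blast
  obtain y where y: "y \<in> Y"
    using Y_nonempty by blast
  have "P.supports (insert y Z) u"
    using P.supports_mono[OF Z(3)] by blast
  moreover have "insert y Z \<in> Obj (site Y)"
    using Z y by (simp add: Obj_site)
  ultimately show ?thesis by blast
qed

lemma fully_faithful_elems: "fully_faithful F PC elems_fctr"
  unfolding fully_faithful_def
proof (intro ballI)
  fix P Q assume P: "P \<in> Obj F" and Q: "Q \<in> Obj F"
  interpret P: finsupp_action Y "Sect P ()" "Res P"
    using P by (rule Obj_FinActD)
  interpret Q: finsupp_action Y "Sect Q ()" "Res Q"
    using Q by (rule Obj_FinActD)
  have inj: "inj_on (FArr elems_fctr) (Hom F P Q)"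
  proof (rule inj_onI)
    fix f g assume f: "f \<in> Hom F P Q" and g: "g \<in> Hom F P Q" and eq: "FArr elems_fctr f = FArr elems_fctr g"
    obtain \<alpha> where \<alpha>: "FArr elems_fctr f = (elems_psh P, elems_psh Q, \<alpha>)"
      "\<forall>Z\<in>Obj (site Y). \<forall>u. u \<in> Sect P () \<longrightarrow> supported Y P Z u \<longrightarrow> \<alpha> (eo Z) u = app f u"
      using FArr_elems[OF f] by blast
    obtain \<beta> where \<beta>: "FArr elems_fctr g = (elems_psh P, elems_psh Q, \<beta>)"
      "\<forall>Z\<in>Obj (site Y). \<forall>u. u \<in> Sect P () \<longrightarrow> supported Y P Z u \<longrightarrow> \<beta> (eo Z) u = app g u"
      using FArr_elems[OF g] by blast
    show "f = g"
    proof (rule Hom_Act_ext[OF Hom_FinActD[OF f] Hom_FinActD[OF g]])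
      fix u assume u: "u \<in> Sect P ()"
      obtain Z where Z: "Z \<in> Obj (site Y)" "supported Y P Z u"
        using ex_site_support[OF P u] by blast
      have "app f u = \<alpha> (eo Z) u" "app g u = \<beta> (eo Z) u"
        using \<alpha>(2) \<beta>(2) Z u by auto
      then show "app f u = app g u"
        using eq \<alpha>(1) \<beta>(1) by simp
    qed
  qed
  have "t \<in> FArr elems_fctr ` Hom F P Q" if t: "t \<in> Hom PC (elems_psh P) (elems_psh Q)" for t
  proof -
    obtain \<eta> where \<eta>: "t = (elems_psh P, elems_psh Q, \<eta>)" "is_presheaf_arr CK (elems_psh P, elems_psh Q, \<eta>)"
      using t by (auto simp: Hom_PSh)
    have \<eta>_in: "\<eta> (eo Z) u \<in> Sect Q () \<and> supported Y Q Z (\<eta> (eo Z) u)"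
      if "Z \<in> Obj (site Y)" "u \<in> Sect P ()" "supported Y P Z u" for Z u
      using PiE_mem[OF is_presheaf_arr_codedD(1)[OF \<eta>(2) that(1)], of u] that by simp
    have \<eta>_nat: "\<eta> (eo W) (Res P g u) = Res Q g (\<eta> (eo Z) u)"
      if "W \<in> Obj (site Y)" "Z \<in> Obj (site Y)" "u \<in> Sect P ()" "supported Y P Z u"
        "g ` Z \<subseteq> W" "\<forall>y. y \<notin> Z \<longrightarrow> g y = y" for W Z g u
    proof -
      have a: "(W, Z, g) \<in> Hom (site Y) W Z"
        using that by (auto simp: Hom_site)
      have u: "u \<in> Sect (elems_psh P) (eo Z)"
        using that by simp
      show ?thesis
        using is_presheaf_arr_codedD(2)[OF \<eta>(2) a u] \<eta>_in[OF that(2,3,4)] that(3,4)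
        by (simp add: Res_elems_psh[OF a])
    qed
    \<comment> \<open>The inclusion of \<open>Z\<close> into \<open>Z'\<close> is the arrow with
      underlying map \<open>id\<close>, so naturality compares the two components. Passing to a
      union, the value at \<open>u\<close> does not depend on the support that is used.\<close>
    have mono: "\<eta> (eo Z') u = \<eta> (eo Z) u"
      if "Z \<in> Obj (site Y)" "Z' \<in> Obj (site Y)" "u \<in> Sect P ()" "supported Y P Z u" "Z \<subseteq> Z'" for Z Z' u
      using \<eta>_nat[OF that(2,1,3,4), of id] that \<eta>_in[OF that(1,3,4)] by (simp add: P.act_id Q.act_id)
    have indep: "\<eta> (eo Z) u = \<eta> (eo Z') u"
      if "Z \<in> Obj (site Y)" "Z' \<in> Obj (site Y)" "u \<in> Sect P ()" "supported Y P Z u" "supported Y P Z' u" for Z Z' u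
      using mono[of Z "Z \<union> Z'" u] mono[of Z' "Z \<union> Z'" u] that by (simp add: Obj_site)
    define \<phi> where "\<phi> = (\<lambda>u. \<eta> (eo (SOME Z. Z \<in> Obj (site Y) \<and> supported Y P Z u)) u)"
    have \<phi>: "\<phi> u = \<eta> (eo Z) u" if "Z \<in> Obj (site Y)" "u \<in> Sect P ()" "supported Y P Z u" for Z u
    proof -
      let ?Z = "SOME Z. Z \<in> Obj (site Y) \<and> supported Y P Z u"
      have "?Z \<in> Obj (site Y) \<and> supported Y P ?Z u"
        by (rule someI[of _ Z]) (use that in simp)
      then show ?thesis
        unfolding \<phi>_def using indep[of ?Z Z u] that by blast
    qed
    have f: "hom_on P Q \<phi> \<in> Hom (Act N) P Q"
    proof (rule hom_on_Hom[OF Obj_FinActD(1)[OF P] Obj_FinActD(1)[OF Q]])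
      fix u assume u: "u \<in> Sect P ()"
      obtain Z where Z: "Z \<in> Obj (site Y)" "supported Y P Z u"
        using ex_site_support[OF P u] by blast
      note \<eta>u = \<eta>_in[OF Z(1) u Z(2)]
      show "\<phi> u \<in> Sect Q ()"
        using \<phi>[OF Z(1) u Z(2)] \<eta>u by simp
      fix m assume "m \<in> carrier N"
      then have m: "m \<in> selfmaps Y" by simp
      \<comment> \<open>Naturality is available only along arrows of the site, so \<open>m\<close>
        is replaced by its cut to \<open>Z\<close>, which acts on \<open>u\<close> in the same
        way.\<close>
      let ?g = "fix_outside Z m"
      have W: "m ` Z \<in> Obj (site Y)" "Z \<subseteq> Y"
        using Z m selfmaps_image[of m Y Z] by (auto simp: Obj_site)
      have g: "?g \<in> selfmaps Y" "\<And>z. z \<in> Z \<Longrightarrow> ?g z = m z"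
        using fix_outside_selfmaps[OF W(2)] selfmaps_image[OF m W(2)] by auto
      have mu: "Res P m u = Res P ?g u"
        by (rule P.supportsD[OF Z(2) m g(1)]) (simp add: g(2))
      have "\<phi> (Res P m u) = \<eta> (eo (m ` Z)) (Res P m u)"
        by (rule \<phi>[OF W(1) P.act_closed[OF m u] P.supports_act[OF Z(2) u m]])
      also have "\<dots> = Res Q ?g (\<eta> (eo Z) u)"
        unfolding mu by (rule \<eta>_nat[OF W(1) Z(1) u Z(2)]) (auto simp: fix_outside_def)
      also have "\<dots> = Res Q m (\<eta> (eo Z) u)"
        by (rule Q.supportsD[OF conjunct2[OF \<eta>u] g(1) m g(2)])
      finally show "\<phi> (Res P m u) = Res Q m (\<phi> u)"
        using \<phi>[OF Z(1) u Z(2)] by simp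
    qed
    then have fF: "hom_on P Q \<phi> \<in> Hom F P Q"
      using P Q by (simp add: Hom_FinAct)
    obtain \<alpha> where \<alpha>: "FArr elems_fctr (hom_on P Q \<phi>) = (elems_psh P, elems_psh Q, \<alpha>)"
      "is_presheaf_arr CK (elems_psh P, elems_psh Q, \<alpha>)"
      "\<And>Z u. Z \<in> Obj (site Y) \<Longrightarrow> u \<in> Sect P () \<Longrightarrow> supported Y P Z u \<Longrightarrow>
        \<alpha> (eo Z) u = app (hom_on P Q \<phi>) u"
      using FArr_elems[OF fF] by blast
    have "FArr elems_fctr (hom_on P Q \<phi>) = t"
      unfolding \<alpha>(1) \<eta>(1) by (rule elems_arr_ext[OF \<alpha>(2) \<eta>(2)]) (simp add: \<alpha>(3) \<phi>)
    then show ?thesis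
      using fF by blast
  qed
  moreover have "FArr elems_fctr f \<in> Hom PC (elems_psh P) (elems_psh Q)" if "f \<in> Hom F P Q" for f
    using FArr_elems_Hom[OF that] .
  ultimately have "FArr elems_fctr ` Hom F P Q = Hom PC (elems_psh P) (elems_psh Q)"
    by (intro equalityI subsetI) auto
  then show "bij_betw (FArr elems_fctr) (Hom F P Q) (Hom PC (FObj elems_fctr P) (FObj elems_fctr Q))"
    using inj by (simp add: bij_betw_def)
qed

text \<open>A presheaf \<open>B\<close> on the site yields a finitely supported action, whose elements are the
  compatible families of their images under all maps to finite sets of points.\<close>

definition finite_maps :: "('y set \<times> ('y \<Rightarrow> 'y)) set" where
  "finite_maps = {(W, g). W \<in> Obj (site Y) \<and> g \<in> selfmaps Y \<and> g ` Y \<subseteq> W}"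

definition families :: "('u, 'u, 'u) presheaf \<Rightarrow> ('y set \<times> ('y \<Rightarrow> 'y) \<Rightarrow> 'u) set" where
  "families B = {\<theta> \<in> (\<Pi>\<^sub>E (W, g) \<in> finite_maps. Sect B (eo W)).
     (\<forall>V W k g. (V, W, k) \<in> Hom (site Y) V W \<longrightarrow> (W, g) \<in> finite_maps \<longrightarrow>
        \<theta> (V, k \<circ> g) = Res B (ea (V, W, k)) (\<theta> (W, g))) \<and>
     (\<exists>Z. finite Z \<and> Z \<subseteq> Y \<and> (\<forall>W f g. (W, f) \<in> finite_maps \<longrightarrow> (W, g) \<in> finite_maps \<longrightarrow>
        (\<forall>z\<in>Z. f z = g z) \<longrightarrow> \<theta> (W, f) = \<theta> (W, g)))}"

lemma finite_maps_comp:
  "(W, g) \<in> finite_maps \<Longrightarrow> t \<in> selfmaps Y \<Longrightarrow> (W, g \<circ> t) \<in> finite_maps"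
  by (auto simp: finite_maps_def image_subset_iff selfmaps_in)

lemma finite_maps_arr:
  assumes "(W, g) \<in> finite_maps" "(V, W, k) \<in> Hom (site Y) V W"
  shows "(V, k \<circ> g) \<in> finite_maps"
  using assms site_arr_selfmaps[OF assms(2)] by (auto simp: finite_maps_def Hom_site image_subset_iff)

lemma familiesD:
  assumes "\<theta> \<in> families B"
  shows "\<theta> \<in> (\<Pi>\<^sub>E (W, g) \<in> finite_maps. Sect B (eo W))"
    and "(W, g) \<in> finite_maps \<Longrightarrow> \<theta> (W, g) \<in> Sect B (eo W)"
    and "(V, W, k) \<in> Hom (site Y) V W \<Longrightarrow> (W, g) \<in> finite_maps \<Longrightarrow>
      \<theta> (V, k \<circ> g) = Res B (ea (V, W, k)) (\<theta> (W, g))"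
    and "\<exists>Z. finite Z \<and> Z \<subseteq> Y \<and> (\<forall>W f g. (W, f) \<in> finite_maps \<longrightarrow> (W, g) \<in> finite_maps \<longrightarrow>
        (\<forall>z\<in>Z. f z = g z) \<longrightarrow> \<theta> (W, f) = \<theta> (W, g))"
proof -
  show 1: "\<theta> \<in> (\<Pi>\<^sub>E (W, g) \<in> finite_maps. Sect B (eo W))"
    using assms unfolding families_def by blast
  show "\<theta> (W, g) \<in> Sect B (eo W)" if "(W, g) \<in> finite_maps"
    using PiE_mem[OF 1 that] by simp
qed (use assms in \<open>unfold families_def, blast+\<close>)

lemma families_ext:
  assumes "\<theta> \<in> families B" "\<theta>' \<in> families B" "\<And>W g. (W, g) \<in> finite_maps \<Longrightarrow> \<theta> (W, g) = \<theta>' (W, g)"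
  shows "\<theta> = \<theta>'"
  using familiesD(1)[OF assms(1)] familiesD(1)[OF assms(2)] assms(3) by (intro PiE_ext) auto

definition shift :: "('y \<Rightarrow> 'y) \<Rightarrow> ('y set \<times> ('y \<Rightarrow> 'y) \<Rightarrow> 'u) \<Rightarrow> 'y set \<times> ('y \<Rightarrow> 'y) \<Rightarrow> 'u" where
  "shift t \<theta> = (\<lambda>(W, g)\<in>finite_maps. \<theta> (W, g \<circ> t))"

lemma shift_app [simp]: "(W, g) \<in> finite_maps \<Longrightarrow> shift t \<theta> (W, g) = \<theta> (W, g \<circ> t)"
  by (simp add: shift_def)

lemma shift_families:
  assumes \<theta>: "\<theta> \<in> families B" and t: "t \<in> selfmaps Y" shows "shift t \<theta> \<in> families B"
  unfolding families_def mem_Collect_eq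
proof (intro conjI allI impI)
  show "shift t \<theta> \<in> (\<Pi>\<^sub>E (W, g) \<in> finite_maps. Sect B (eo W))"
    unfolding shift_def restrict_PiE_iff using familiesD(2)[OF \<theta>] finite_maps_comp[OF _ t] by auto
  fix V W k g assume "(V, W, k) \<in> Hom (site Y) V W" "(W, g) \<in> finite_maps"
  then show "shift t \<theta> (V, k \<circ> g) = Res B (ea (V, W, k)) (shift t \<theta> (W, g))"
    using familiesD(3)[OF \<theta>, of V W k "g \<circ> t"] finite_maps_comp[OF _ t] finite_maps_arr
    by (simp add: comp_assoc)
next
  obtain Z where Z: "finite Z" "Z \<subseteq> Y" "\<And>W f g. (W, f) \<in> finite_maps \<Longrightarrow> (W, g) \<in> finite_maps \<Longrightarrow>
      (\<forall>z\<in>Z. f z = g z) \<Longrightarrow> \<theta> (W, f) = \<theta> (W, g)"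
    using familiesD(4)[OF \<theta>] by blast
  have "shift t \<theta> (W, f) = shift t \<theta> (W, g)"
    if "(W, f) \<in> finite_maps" "(W, g) \<in> finite_maps" "\<forall>z\<in>t ` Z. f z = g z" for W f g
    using Z(3)[OF finite_maps_comp[OF that(1) t] finite_maps_comp[OF that(2) t]] that by simp
  then show "\<exists>Z. finite Z \<and> Z \<subseteq> Y \<and> (\<forall>W f g. (W, f) \<in> finite_maps \<longrightarrow> (W, g) \<in> finite_maps \<longrightarrow>
      (\<forall>z\<in>Z. f z = g z) \<longrightarrow> shift t \<theta> (W, f) = shift t \<theta> (W, g))"
    by (intro exI[of _ "t ` Z"] conjI finite_imageI Z(1) selfmaps_image[OF t Z(2)] allI impI)
qed

lemma shift_id: "\<theta> \<in> families B \<Longrightarrow> shift id \<theta> = \<theta>"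
  by (rule families_ext[OF shift_families]) simp_all

lemma shift_comp:
  "\<theta> \<in> families B \<Longrightarrow> f \<in> selfmaps Y \<Longrightarrow> g \<in> selfmaps Y \<Longrightarrow> shift g (shift f \<theta>) = shift (g \<circ> f) \<theta>"
  by (rule families_ext[OF shift_families[OF shift_families] shift_families])
    (simp_all add: finite_maps_comp comp_assoc)

lemma small_families:
  assumes B: "is_presheaf CK B" shows "small TYPE('u) (families B)"
proof -
  have "finite_maps \<subseteq> Obj (site Y) \<times> selfmaps Y"
    by (auto simp: finite_maps_def)
  then have 1: "small TYPE('u) finite_maps"
    by (rule small_subset) (intro small_Times[OF inaccessible] small_site small_selfmaps[OF inaccessible small_Y])
  have 2: "small TYPE('u) (\<Union>W\<in>Obj (site Y). Sect B (eo W))"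
    by (intro small_UN[OF inaccessible] small_site is_presheaf_codedD(1)[OF B])
  have "families B \<subseteq> finite_maps \<rightarrow>\<^sub>E (\<Union>W\<in>Obj (site Y). Sect B (eo W))"
  proof
    fix \<theta> assume \<theta>: "\<theta> \<in> families B"
    show "\<theta> \<in> finite_maps \<rightarrow>\<^sub>E (\<Union>W\<in>Obj (site Y). Sect B (eo W))"
    proof (rule PiE_I)
      fix p assume p: "p \<in> finite_maps"
      obtain W g where "p = (W, g)" by (cases p)
      then show "\<theta> p \<in> (\<Union>W\<in>Obj (site Y). Sect B (eo W))"
        using familiesD(2)[OF \<theta>, of W g] p by (auto simp: finite_maps_def)
    next
      fix p assume "p \<notin> finite_maps"
      then show "\<theta> p = undefined"
        using PiE_arb[OF familiesD(1)[OF \<theta>]] by blast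
    qed
  qed
  then show ?thesis
    using small_PiE[OF inaccessible 1 2] by (rule small_subset)
qed

definition fam_code :: "('u, 'u, 'u) presheaf \<Rightarrow> ('y set \<times> ('y \<Rightarrow> 'y) \<Rightarrow> 'u) \<Rightarrow> 'u" where
  "fam_code B = code_of (families B)"

definition fam_obj :: "('u, 'u, 'u) presheaf \<Rightarrow> (unit, 'y \<Rightarrow> 'y, 'u) presheaf" where
  "fam_obj B = action_on N (fam_code B ` families B)
     (\<lambda>t e. fam_code B (shift t (inv_into (families B) (fam_code B) e)))"

lemma Sect_fam_obj [simp]: "Sect (fam_obj B) c = fam_code B ` families B"
  by (simp add: fam_obj_def)

context
  fixes B :: "('u, 'u, 'u) presheaf"
  assumes B: "is_presheaf CK B"
begin

lemma inj_fam_code: "inj_on (fam_code B) (families B)"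
  unfolding fam_code_def by (rule small_inj_on_code_of[OF small_families[OF B]])

lemma inv_fam_code [simp]: "\<theta> \<in> families B \<Longrightarrow> inv_into (families B) (fam_code B) (fam_code B \<theta>) = \<theta>"
  using inj_fam_code by simp

lemma Res_fam_obj [simp]:
  "\<theta> \<in> families B \<Longrightarrow> t \<in> selfmaps Y \<Longrightarrow> Res (fam_obj B) t (fam_code B \<theta>) = fam_code B (shift t \<theta>)"
  by (simp add: fam_obj_def)

lemma fam_obj_FinAct: "fam_obj B \<in> Obj F"
proof (rule Obj_FinActI)
  show "fam_obj B \<in> Obj (Act N)"
    unfolding Obj_PSh fam_obj_def
  proof (rule is_presheaf_action_on)
    show "small TYPE('u) (fam_code B ` families B)"
      by (rule small_image[OF small_families[OF B]])
  qed (auto simp: monoid_selfmaps_monoid shift_families shift_id shift_comp)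
  fix e assume "e \<in> Sect (fam_obj B) ()"
  then obtain \<theta> where \<theta>: "\<theta> \<in> families B" "e = fam_code B \<theta>" by auto
  obtain Z where Z: "finite Z" "Z \<subseteq> Y" "\<And>W f g. (W, f) \<in> finite_maps \<Longrightarrow> (W, g) \<in> finite_maps \<Longrightarrow>
      (\<forall>z\<in>Z. f z = g z) \<Longrightarrow> \<theta> (W, f) = \<theta> (W, g)"
    using familiesD(4)[OF \<theta>(1)] by blast
  have "Res (fam_obj B) f e = Res (fam_obj B) g e"
    if fg: "f \<in> selfmaps Y" "g \<in> selfmaps Y" "\<forall>z\<in>Z. f z = g z" for f g
  proof -
    have "shift f \<theta> = shift g \<theta>"
    proof (rule families_ext[OF shift_families[OF \<theta>(1) fg(1)] shift_families[OF \<theta>(1) fg(2)]])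
      fix W h assume h: "(W, h) \<in> finite_maps"
      show "shift f \<theta> (W, h) = shift g \<theta> (W, h)"
        using Z(3)[OF finite_maps_comp[OF h fg(1)] finite_maps_comp[OF h fg(2)]] fg(3) h by simp
    qed
    then show ?thesis
      using \<theta> fg by simp
  qed
  then show "\<exists>Z. finite Z \<and> Z \<subseteq> Y \<and> (\<forall>f\<in>selfmaps Y. \<forall>g\<in>selfmaps Y. (\<forall>z\<in>Z. f z = g z) \<longrightarrow>
      Res (fam_obj B) f e = Res (fam_obj B) g e)"
    using Z(1,2) by blast
qed

text \<open>A retraction of \<open>Y\<close> onto \<open>Z\<close> needs a point of
  \<open>Z\<close>; the site consists of nonempty sets for this reason.\<close>

definition retr :: "'y set \<Rightarrow> 'y \<Rightarrow> 'y" where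
  "retr Z y = (if y \<in> Y \<and> y \<notin> Z then SOME z. z \<in> Z else y)"

lemma retr:
  assumes "Z \<in> Obj (site Y)"
  shows "(Z, retr Z) \<in> finite_maps" "z \<in> Z \<Longrightarrow> retr Z z = z"
proof -
  have "(SOME z. z \<in> Z) \<in> Z" "Z \<subseteq> Y"
    using assms by (auto simp: Obj_site some_in_eq)
  then show "(Z, retr Z) \<in> finite_maps"
    using assms by (auto simp: finite_maps_def retr_def selfmaps_def)
  show "z \<in> Z \<Longrightarrow> retr Z z = z"
    by (simp add: retr_def)
qed

lemma retr_comp: "(W, f) \<in> finite_maps \<Longrightarrow> retr W \<circ> f = f"
  by (auto simp: finite_maps_def retr_def selfmaps_def fun_eq_iff image_subset_iff)

text \<open>The values at \<open>f\<close> and \<open>g\<close> are those of the shifted families at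
  the retraction onto \<open>W\<close>, because this retraction is the identity on the values of
  maps into \<open>W\<close>.\<close>

lemma supported_fam:
  assumes \<theta>: "\<theta> \<in> families B" and "supported Y (fam_obj B) Z (fam_code B \<theta>)"
    and "(W, f) \<in> finite_maps" "(W, g) \<in> finite_maps" "\<And>z. z \<in> Z \<Longrightarrow> f z = g z"
  shows "\<theta> (W, f) = \<theta> (W, g)"
proof -
  have W: "W \<in> Obj (site Y)" and fg: "f \<in> selfmaps Y" "g \<in> selfmaps Y"
    using assms(3,4) by (auto simp: finite_maps_def)
  interpret P: finsupp_action Y "Sect (fam_obj B) ()" "Res (fam_obj B)"
    using fam_obj_FinAct by (rule Obj_FinActD)
  have "Res (fam_obj B) f (fam_code B \<theta>) = Res (fam_obj B) g (fam_code B \<theta>)"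
    by (rule P.supportsD[OF assms(2) fg assms(5)])
  then have "shift f \<theta> = shift g \<theta>"
    using inj_onD[OF inj_fam_code _ shift_families[OF \<theta> fg(1)] shift_families[OF \<theta> fg(2)]] \<theta> fg by simp
  then have "shift f \<theta> (W, retr W) = shift g \<theta> (W, retr W)"
    by simp
  then show ?thesis
    using retr[OF W] retr_comp assms(3,4) by simp
qed

definition fam_eval :: "'u \<Rightarrow> 'u \<Rightarrow> 'u" where
  "fam_eval = (\<lambda>c\<in>Obj CK. \<lambda>e\<in>elems (fam_obj B) c.
     inv_into (families B) (fam_code B) e (FObj dec c, retr (FObj dec c)))"

lemma fam_eval:
  "Z \<in> Obj (site Y) \<Longrightarrow> \<theta> \<in> families B \<Longrightarrow> supported Y (fam_obj B) Z (fam_code B \<theta>) \<Longrightarrow>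
    fam_eval (eo Z) (fam_code B \<theta>) = \<theta> (Z, retr Z)"
  by (simp add: fam_eval_def elems_def)

text \<open>A family supported by \<open>Z\<close> is determined by its value at the retraction onto
  \<open>Z\<close>, since every finite map agrees on \<open>Z\<close> with one that factors through
  this retraction. Conversely, a section \<open>b\<close> extends to a family by restricting it
  along the maps cut to \<open>Z\<close>.\<close>

lemma bij_fam_eval:
  assumes Z: "Z \<in> Obj (site Y)"
  shows "bij_betw (fam_eval (eo Z)) (Sect (elems_psh (fam_obj B)) (eo Z)) (Sect B (eo Z))"
proof -
  interpret P: finsupp_action Y "Sect (fam_obj B) ()" "Res (fam_obj B)"
    using fam_obj_FinAct by (rule Obj_FinActD)
  have arr: "(W, Z, fix_outside Z f) \<in> Hom (site Y) W Z" if "(W, f) \<in> finite_maps" for W f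
    using that Z by (auto simp: Hom_site finite_maps_def fix_outside_def Obj_site image_subset_iff subset_iff)
  have ZY: "Z \<subseteq> Y"
    using Z by (simp add: Obj_site)
  have fam_val: "\<theta> (W, f) = Res B (ea (W, Z, fix_outside Z f)) (\<theta> (Z, retr Z))"
    if \<theta>: "\<theta> \<in> families B" "supported Y (fam_obj B) Z (fam_code B \<theta>)" and f: "(W, f) \<in> finite_maps" for \<theta> W f
  proof -
    have "\<theta> (W, f) = \<theta> (W, fix_outside Z f \<circ> retr Z)"
      by (rule supported_fam[OF \<theta> f finite_maps_arr[OF retr(1)[OF Z] arr[OF f]]])
        (simp add: retr(2)[OF Z])
    then show ?thesis
      using familiesD(3)[OF \<theta>(1) arr[OF f] retr(1)[OF Z]] by simp
  qed
  have "fam_eval (eo Z) ` Sect (elems_psh (fam_obj B)) (eo Z) = Sect B (eo Z)"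
  proof (rule equalityI; rule subsetI)
    fix b assume "b \<in> fam_eval (eo Z) ` Sect (elems_psh (fam_obj B)) (eo Z)"
    then obtain \<theta> where "\<theta> \<in> families B" "b = fam_eval (eo Z) (fam_code B \<theta>)"
        "supported Y (fam_obj B) Z (fam_code B \<theta>)"
      using Z by auto
    then show "b \<in> Sect B (eo Z)"
      using familiesD(2)[OF _ retr(1)[OF Z]] Z by (simp add: fam_eval)
  next
    fix b assume b: "b \<in> Sect B (eo Z)"
    define \<theta> where "\<theta> = (\<lambda>(W, f)\<in>finite_maps. Res B (ea (W, Z, fix_outside Z f)) b)"
    have \<theta>_app: "\<theta> (W, f) = Res B (ea (W, Z, fix_outside Z f)) b" if "(W, f) \<in> finite_maps" for W f
      using that by (simp add: \<theta>_def)
    have \<theta>: "\<theta> \<in> families B"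
      unfolding families_def mem_Collect_eq
    proof (intro conjI allI impI)
      show "\<theta> \<in> (\<Pi>\<^sub>E (W, g) \<in> finite_maps. Sect B (eo W))"
        unfolding \<theta>_def restrict_PiE_iff using is_presheaf_codedD(2)[OF B arr b] by auto
      fix V W k g assume k: "(V, W, k) \<in> Hom (site Y) V W" and g: "(W, g) \<in> finite_maps"
      have "fix_outside Z (k \<circ> fix_outside Z g) = fix_outside Z (k \<circ> g)"
        by (rule fix_outside_cong) simp
      then show "\<theta> (V, k \<circ> g) = Res B (ea (V, W, k)) (\<theta> (W, g))"
        using is_presheaf_codedD(4)[OF B k arr[OF g] b] \<theta>_app[OF g] \<theta>_app[OF finite_maps_arr[OF g k]]
        by simp
    next
      have "\<theta> (W, f) = \<theta> (W, g)"
        if "(W, f) \<in> finite_maps" "(W, g) \<in> finite_maps" "\<forall>z\<in>Z. f z = g z" for W f g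
        using that fix_outside_cong[of Z f g] by (simp add: \<theta>_app)
      then show "\<exists>Z. finite Z \<and> Z \<subseteq> Y \<and> (\<forall>W f g. (W, f) \<in> finite_maps \<longrightarrow> (W, g) \<in> finite_maps \<longrightarrow>
          (\<forall>z\<in>Z. f z = g z) \<longrightarrow> \<theta> (W, f) = \<theta> (W, g))"
        using Z unfolding Obj_site by blast
    qed
    have supp: "supported Y (fam_obj B) Z (fam_code B \<theta>)"
      unfolding P.supports_def
    proof (intro ballI impI)
      fix f g assume fg: "f \<in> selfmaps Y" "g \<in> selfmaps Y" "\<forall>z\<in>Z. f z = g z"
      have "shift f \<theta> = shift g \<theta>"
      proof (rule families_ext[OF shift_families[OF \<theta> fg(1)] shift_families[OF \<theta> fg(2)]])
        fix W h assume h: "(W, h) \<in> finite_maps"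
        have "fix_outside Z (h \<circ> f) = fix_outside Z (h \<circ> g)"
          using fg(3) by (intro fix_outside_cong) simp
        then show "shift f \<theta> (W, h) = shift g \<theta> (W, h)"
          using h finite_maps_comp[OF h fg(1)] finite_maps_comp[OF h fg(2)] by (simp add: \<theta>_app)
      qed
      then show "Res (fam_obj B) f (fam_code B \<theta>) = Res (fam_obj B) g (fam_code B \<theta>)"
        using \<theta> fg by simp
    qed
    have "fix_outside Z (retr Z) = id"
      by (rule fix_outside_id) (rule retr(2)[OF Z])
    then have "fam_eval (eo Z) (fam_code B \<theta>) = b"
      using fam_eval[OF Z \<theta> supp] \<theta>_app[OF retr(1)[OF Z]] is_presheaf_codedD(3)[OF B Z b] by simp
    moreover have "fam_code B \<theta> \<in> Sect (elems_psh (fam_obj B)) (eo Z)"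
      using Z \<theta> supp by simp
    ultimately show "b \<in> fam_eval (eo Z) ` Sect (elems_psh (fam_obj B)) (eo Z)"
      by blast
  qed
  moreover have "inj_on (fam_eval (eo Z)) (Sect (elems_psh (fam_obj B)) (eo Z))"
  proof (rule inj_onI)
    fix d e assume d: "d \<in> Sect (elems_psh (fam_obj B)) (eo Z)" and e: "e \<in> Sect (elems_psh (fam_obj B)) (eo Z)"
      and eq: "fam_eval (eo Z) d = fam_eval (eo Z) e"
    obtain \<theta> where \<theta>: "\<theta> \<in> families B" "d = fam_code B \<theta>" "supported Y (fam_obj B) Z (fam_code B \<theta>)"
      using d Z by auto
    obtain \<psi> where \<psi>: "\<psi> \<in> families B" "e = fam_code B \<psi>" "supported Y (fam_obj B) Z (fam_code B \<psi>)"
      using e Z by auto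
    have "\<theta> = \<psi>"
      using eq \<theta>(2) \<psi>(2) fam_val[OF \<theta>(1,3)] fam_val[OF \<psi>(1,3)] fam_eval[OF Z \<theta>(1,3)] fam_eval[OF Z \<psi>(1,3)]
      by (intro families_ext[OF \<theta>(1) \<psi>(1)]) simp
    then show "d = e"
      using \<theta>(2) \<psi>(2) by simp
  qed
  ultimately show ?thesis
    by (simp add: bij_betw_def)
qed

text \<open>Naturality holds because \<open>retr W \<circ> g\<close> and
  \<open>g \<circ> retr Z\<close> agree on \<open>Z\<close>, the support of the family.\<close>

lemma fam_eval_arr: "is_presheaf_arr CK (elems_psh (fam_obj B), B, fam_eval)"
proof (rule is_presheaf_arr_codedI[OF elems_psh_presheaf[OF fam_obj_FinAct] B])
  show "fam_eval \<in> extensional (Obj CK)"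
    by (simp add: fam_eval_def)
  show "fam_eval (eo Z) \<in> Sect (elems_psh (fam_obj B)) (eo Z) \<rightarrow>\<^sub>E Sect B (eo Z)"
    if Z: "Z \<in> Obj (site Y)" for Z
  proof (rule PiE_I)
    show "fam_eval (eo Z) e \<in> Sect B (eo Z)" if "e \<in> Sect (elems_psh (fam_obj B)) (eo Z)" for e
      using bij_betwE[OF bij_fam_eval[OF Z]] that by blast
    show "fam_eval (eo Z) e = undefined" if "e \<notin> Sect (elems_psh (fam_obj B)) (eo Z)" for e
    proof -
      have "e \<notin> elems (fam_obj B) (eo Z)"
        using that Z by (auto simp: elems_def)
      then show ?thesis
        using Z by (simp add: fam_eval_def)
    qed
  qed
  fix a W Z e assume a: "a \<in> Hom (site Y) W Z" and e: "e \<in> Sect (elems_psh (fam_obj B)) (eo Z)"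
  obtain g where g: "a = (W, Z, g)" "W \<in> Obj (site Y)" "Z \<in> Obj (site Y)" "g ` Z \<subseteq> W"
    using a by (auto simp: Hom_site)
  have a': "(W, Z, g) \<in> Hom (site Y) W Z"
    using a g by simp
  have gT: "g \<in> selfmaps Y"
    using site_arr_selfmaps[OF a'] .
  obtain \<theta> where \<theta>: "\<theta> \<in> families B" "e = fam_code B \<theta>" "supported Y (fam_obj B) Z (fam_code B \<theta>)"
    using e g(3) by auto
  have "Res (elems_psh (fam_obj B)) (ea a) e = fam_code B (shift g \<theta>)"
    using \<theta> gT unfolding g(1) Res_elems_psh[OF a'] by simp
  moreover from this have "supported Y (fam_obj B) W (fam_code B (shift g \<theta>))"
    using is_presheaf_codedD(2)[OF elems_psh_presheaf[OF fam_obj_FinAct] a e] g(2) by simp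
  ultimately have "fam_eval (eo W) (Res (elems_psh (fam_obj B)) (ea a) e) = \<theta> (W, retr W \<circ> g)"
    using fam_eval[OF g(2) shift_families[OF \<theta>(1) gT]] retr(1)[OF g(2)] by simp
  also have "\<dots> = \<theta> (W, g \<circ> retr Z)"
    using g(4) retr(2)[OF g(2)] retr(2)[OF g(3)]
    by (intro supported_fam[OF \<theta>(1,3)] finite_maps_comp[OF retr(1)[OF g(2)] gT]
        finite_maps_arr[OF retr(1)[OF g(3)] a']) (simp add: image_subset_iff)
  also have "\<dots> = Res B (ea a) (fam_eval (eo Z) e)"
    using familiesD(3)[OF \<theta>(1) a' retr(1)[OF g(3)]] fam_eval[OF g(3) \<theta>(1,3)] \<theta>(2) g(1) by simp
  finally show "fam_eval (eo W) (Res (elems_psh (fam_obj B)) (ea a) e) = Res B (ea a) (fam_eval (eo Z) e)" .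
qed

end

lemma essentially_surjective_elems:
  assumes "B \<in> Obj PC"
  shows "\<exists>P\<in>Obj F. \<exists>i\<in>Hom PC (FObj elems_fctr P) B. iso_arr PC i"
proof -
  have B: "is_presheaf CK B"
    using assms by (simp add: Obj_PSh)
  have "iso_arr PC (elems_psh (fam_obj B), B, fam_eval B)"
    using bij_fam_eval[OF B] by (intro iso_arr_PSh[OF category_coded fam_eval_arr[OF B]]) auto
  then show ?thesis
    using fam_obj_FinAct[OF B] fam_eval_arr[OF B] by (force simp: Hom_PSh)
qed

section \<open>The topos of finitely supported actions, encoded in the universe\<close>

definition topos_obj :: "(unit, 'y \<Rightarrow> 'y, 'u) presheaf \<Rightarrow> 'u" where
  "topos_obj = code_of (Obj F)"

definition topos_arr :: "(unit, 'y \<Rightarrow> 'y, 'u) presheaf_arr \<Rightarrow> 'u" where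
  "topos_arr = code_of (Arr F)"

sublocale topos: coding F topos_obj topos_arr
proof (intro coding.intro category_FinAct coding_axioms.intro)
  have N: "small TYPE('u) (carrier N)"
    using small_selfmaps[OF inaccessible small_Y] by simp
  have sub: "Obj F \<subseteq> Obj (Act N)" "Arr F \<subseteq> Arr (Act N)"
    by (auto simp: FinAct_def full_subcategory_def)
  have "Obj F \<lesssim> (UNIV :: 'u set)" "Arr F \<lesssim> (UNIV :: 'u set)"
    using lepoll_trans[OF subset_imp_lepoll[OF sub(1)] Obj_Act_lepoll[OF inaccessible N]]
      lepoll_trans[OF subset_imp_lepoll[OF sub(2)] Arr_Act_lepoll[OF inaccessible N]] by simp_all
  then show "inj_on topos_obj (Obj F)" "inj_on topos_arr (Arr F)"
    unfolding topos_obj_def topos_arr_def by (simp_all add: inj_on_code_of)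
qed

abbreviation "topos \<equiv> topos.CK"

text \<open>Decoding followed by the functor of supported elements is fully faithful and essentially
  surjective onto presheaves on the encoded site, which are the sheaves for the trivial
  topology.\<close>

lemma grothendieck_topos: "grothendieck_topos topos"
proof -
  interpret CK: category CK by (rule category_coded)
  have "\<exists>G. equivalence topos PC (comp_fctr elems_fctr topos.dec) G"
  proof (rule equivalence_if_essentially_surjective)
    show "is_functor topos PC (comp_fctr elems_fctr topos.dec)"
      by (rule is_functor_comp[OF topos.category_coded topos.is_functor_dec is_functor_elems])
    show "fully_faithful topos PC (comp_fctr elems_fctr topos.dec)"
      by (intro fully_faithful_comp[OF topos.is_functor_dec] topos.fully_faithful_dec fully_faithful_elems)
    fix B assume "B \<in> Obj PC"
    then obtain P i where "P \<in> Obj F" "i \<in> Hom PC (FObj elems_fctr P) B" "iso_arr PC i"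
      using essentially_surjective_elems by blast
    then show "\<exists>x\<in>Obj topos. \<exists>i\<in>Hom PC (FObj (comp_fctr elems_fctr topos.dec) x) B. iso_arr PC i"
      by (intro bexI[of _ "topos_obj P"]) auto
  qed (rule topos.category_coded, rule category_PC)
  then obtain G where "equivalence topos (Sh CK (trivial_topology CK)) (comp_fctr elems_fctr topos.dec) G"
    unfolding CK.Sh_trivial_topology by blast
  moreover have "small TYPE('u) (Obj CK)" "small TYPE('u) (Arr CK)"
    unfolding Obj_coded Arr_coded by (intro small_image small_site)+
  ultimately show ?thesis
    unfolding grothendieck_topos_def
    using topos.category_coded CK.category_axioms CK.grothendieck_trivial_topology by blast
qed

end

section \<open>Many quotient topoi\<close>

lemma is_functor_iso_arr:
  assumes "category C" "is_functor C D F" "f \<in> Hom C x y" "iso_arr C f" shows "iso_arr D (FArr F f)"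
proof -
  interpret category C by fact
  obtain g where g: "g \<in> Hom C y x" "Comp C g f = Ident C x" "Comp C f g = Ident C y"
    using iso_arrE[OF assms(4,3)] .
  have xy: "x \<in> Obj C" "y \<in> Obj C"
    using Hom_Obj[OF assms(3)] by auto
  show ?thesis
  proof (rule iso_arrI[OF is_functor_Hom[OF assms(2,3)] is_functor_Hom[OF assms(2) g(1)]])
    show "Comp D (FArr F g) (FArr F f) = Ident D (FObj F x)"
      using is_functor_Comp[OF assms(2,3) g(1)] g(2) is_functor_Ident[OF assms(2) xy(1)] by simp
    show "Comp D (FArr F f) (FArr F g) = Ident D (FObj F y)"
      using is_functor_Comp[OF assms(2) g(1) assms(3)] g(3) is_functor_Ident[OF assms(2) xy(2)] by simp
  qed
qed

text \<open>Quotients are told apart by the sizes of such actions. Trivial actions of every small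
  size restrict from all the topoi constructed above and carry no information.\<close>

definition nontrivial_action :: "('m, 'b) monoid_scheme \<Rightarrow> (unit, 'm, 'u) presheaf \<Rightarrow> bool" where
  "nontrivial_action M A \<longleftrightarrow> (\<exists>m\<in>carrier M. \<exists>x\<in>Sect A (). Res A m x \<noteq> x)"

lemma iso_action:
  assumes i: "i \<in> Hom (Act M) A B" "iso_arr (Act M) i"
  shows "Sect A () \<lesssim> Sect B ()" "Sect B () \<lesssim> Sect A ()"
    and "nontrivial_action M A \<longleftrightarrow> nontrivial_action M B"
proof -
  obtain j where j: "j \<in> Hom (Act M) B A" "Comp (Act M) j i = Ident (Act M) A" "Comp (Act M) i j = Ident (Act M) B"
    using iso_arrE[OF i(2,1)] .
  note iA = Hom_Act_props[OF i(1)] and jA = Hom_Act_props[OF j(1)]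
  have ji: "app j (app i x) = x" if "x \<in> Sect A ()" for x
    using Comp_Act_app[OF i(1) j(1) that] Ident_Act_app[OF that, of M] j(2) by simp
  have ij: "app i (app j y) = y" if "y \<in> Sect B ()" for y
    using Comp_Act_app[OF j(1) i(1) that] Ident_Act_app[OF that, of M] j(3) by simp
  have "inj_on (app i) (Sect A ())" "inj_on (app j) (Sect B ())"
    using ji ij by (metis inj_onI)+
  then show "Sect A () \<lesssim> Sect B ()" "Sect B () \<lesssim> Sect A ()"
    unfolding lepoll_def using iA(3) jA(3) by blast+
  have "nontrivial_action M B" if nt: "nontrivial_action M A"
  proof -
    obtain m x where m: "m \<in> carrier M" "x \<in> Sect A ()" "Res A m x \<noteq> x"
      using nt by (auto simp: nontrivial_action_def)
    have "Res B m (app i x) \<noteq> app i x"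
      using m iA(4)[OF m(1,2)] ji[OF m(2)] ji[OF Act_Res(1)[OF iA(1) m(1,2)]] by metis
    then show ?thesis
      using m iA(3) by (auto simp: nontrivial_action_def)
  qed
  moreover have "nontrivial_action M A" if nt: "nontrivial_action M B"
  proof -
    obtain m x where m: "m \<in> carrier M" "x \<in> Sect B ()" "Res B m x \<noteq> x"
      using nt by (auto simp: nontrivial_action_def)
    have "Res A m (app j x) \<noteq> app j x"
      using m jA(4)[OF m(1,2)] ij[OF m(2)] ij[OF Act_Res(1)[OF jA(1) m(1,2)]] by metis
    then show ?thesis
      using m jA(3) by (auto simp: nontrivial_action_def)
  qed
  ultimately show "nontrivial_action M A \<longleftrightarrow> nontrivial_action M B"
    by blast
qed

context restriction
begin

text \<open>Rigidity is fullness; faithfulness is automatic, as restriction keeps the underlying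
  maps.\<close>

lemma fully_faithful_restr:
  assumes rigid: "\<And>P Q f t u. P \<in> Obj F \<Longrightarrow> Q \<in> Obj F \<Longrightarrow> f \<in> Hom E (restr P) (restr Q) \<Longrightarrow>
    t \<in> selfmaps Y \<Longrightarrow> u \<in> Sect P () \<Longrightarrow> app f (Res P t u) = Res Q t (app f u)"
  shows "fully_faithful F E restr_fctr"
  unfolding fully_faithful_def
proof (intro ballI)
  fix P Q assume P: "P \<in> Obj F" and Q: "Q \<in> Obj F"
  have "inj_on (FArr restr_fctr) (Hom F P Q)"
  proof (rule inj_onI)
    fix f g assume f: "f \<in> Hom F P Q" and g: "g \<in> Hom F P Q" and eq: "FArr restr_fctr f = FArr restr_fctr g"
    show "f = g"
    proof (rule Hom_Act_ext[OF Hom_FinActD[OF f] Hom_FinActD[OF g]])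
      fix u assume "u \<in> Sect P ()"
      then show "app f u = app g u"
        using app_FArr_restr[OF f] app_FArr_restr[OF g] eq by metis
    qed
  qed
  moreover have "FArr restr_fctr ` Hom F P Q = Hom E (restr P) (restr Q)"
  proof (intro equalityI subsetI)
    fix h assume "h \<in> FArr restr_fctr ` Hom F P Q"
    then show "h \<in> Hom E (restr P) (restr Q)"
      using FArr_restr_Hom by blast
  next
    fix h assume h: "h \<in> Hom E (restr P) (restr Q)"
    have "hom_on P Q (app h) \<in> Hom (Act N) P Q"
    proof (rule hom_on_Hom[OF Obj_FinActD(1)[OF P] Obj_FinActD(1)[OF Q]])
      show "app h u \<in> Sect Q ()" if "u \<in> Sect P ()" for u
        using Hom_Act_props(3)[OF h] that by simp
      show "app h (Res P t u) = Res Q t (app h u)" if "t \<in> carrier N" "u \<in> Sect P ()" for t u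
        using rigid[OF P Q h] that by simp
    qed
    then have f: "hom_on P Q (app h) \<in> Hom F P Q"
      using P Q by (simp add: Hom_FinAct)
    have "FArr restr_fctr (hom_on P Q (app h)) = h"
      by (rule Hom_Act_ext[OF FArr_restr_Hom[OF f] h]) (use app_FArr_restr[OF f] in simp)
    then show "h \<in> FArr restr_fctr ` Hom F P Q"
      by (rule image_eqI[OF sym f])
  qed
  ultimately show "bij_betw (FArr restr_fctr) (Hom F P Q) (Hom E (FObj restr_fctr P) (FObj restr_fctr Q))"
    by (simp add: bij_betw_def)
qed

lemma quotient_topos_restr:
  assumes ff: "fully_faithful F E restr_fctr"
  shows "\<exists>R. quotient_topos E (topos, \<lparr>direct = R, inverse_im = comp_fctr restr_fctr topos.dec\<rparr>)"
proof -
  interpret T: category topos by (rule topos.category_coded)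
  interpret E: category E by (rule category_E)
  let ?L = "comp_fctr restr_fctr topos.dec"
  interpret universal_arrows topos E ?L "\<lambda>A. topos_obj (coind_obj A)" counit
  proof
    show "is_functor topos E ?L"
      by (rule is_functor_comp[OF topos.category_coded topos.is_functor_dec is_functor_restr])
  next
    fix A assume A: "A \<in> Obj E"
    note c = coind_obj_FinAct[OF A]
    show "topos_obj (coind_obj A) \<in> Obj topos"
      using c by simp
    show "counit A \<in> Hom E (FObj ?L (topos_obj (coind_obj A))) A"
      using c counit_Hom[OF A] by simp
    fix x h assume x: "x \<in> Obj topos" and h: "h \<in> Hom E (FObj ?L x) A"
    obtain P where P: "P \<in> Obj F" "x = topos_obj P"
      using x by auto
    have "\<exists>!k. k \<in> Hom F P (coind_obj A) \<and> Comp E (counit A) (FArr restr_fctr k) = h"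
      using universal_counit[OF A P(1)] h P by simp
    then obtain k where k: "k \<in> Hom F P (coind_obj A)" "Comp E (counit A) (FArr restr_fctr k) = h"
      and uniq: "\<And>k'. k' \<in> Hom F P (coind_obj A) \<Longrightarrow> Comp E (counit A) (FArr restr_fctr k') = h \<Longrightarrow> k' = k"
      unfolding Ex1_def by blast
    show "\<exists>!k. k \<in> Hom topos x (topos_obj (coind_obj A)) \<and> Comp E (counit A) (FArr ?L k) = h"
    proof (rule ex1I[of _ "topos_arr k"])
      show "topos_arr k \<in> Hom topos x (topos_obj (coind_obj A)) \<and> Comp E (counit A) (FArr ?L (topos_arr k)) = h"
        using k P c HomD(1)[OF k(1)] by (simp add: topos.Hom_coded)
    next
      fix k' assume k': "k' \<in> Hom topos x (topos_obj (coind_obj A)) \<and> Comp E (counit A) (FArr ?L k') = h"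
      then obtain k'' where k'': "k'' \<in> Hom F P (coind_obj A)" "k' = topos_arr k''"
        using P c by (auto simp: topos.Hom_coded)
      then show "k' = topos_arr k"
        using k' uniq[of k''] HomD(1)[OF k''(1)] by simp
    qed
  qed
  have "geometric_morphism E topos \<lparr>direct = R, inverse_im = ?L\<rparr>"
    unfolding geometric_morphism_def
    using adjunction preserves_finite_limits_comp[OF topos.is_functor_dec
        topos.preserves_finite_limits_dec preserves_finite_limits_restr] by simp
  moreover have "connected_geom E topos \<lparr>direct = R, inverse_im = ?L\<rparr>"
    unfolding connected_geom_def
    using fully_faithful_comp[OF topos.is_functor_dec topos.fully_faithful_dec ff] by simp
  ultimately have "quotient_topos E (topos, \<lparr>direct = R, inverse_im = ?L\<rparr>)"
    using grothendieck_topos by (simp add: quotient_topos_def)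
  then show ?thesis ..
qed

end

lemma small_points_points:
  assumes "inaccessible TYPE('u)" "small TYPE('u) S" "b \<in> S"
  shows "small_points TYPE('u) (points (S :: 'u set))"
proof
  have "points S \<subseteq> (UNIV :: nat set) \<times> ((UNIV :: nat set) \<rightarrow>\<^sub>E S)"
    by (auto simp: points_def)
  then have "points S \<lesssim> (UNIV :: nat set) \<times> ((UNIV :: nat set) \<rightarrow>\<^sub>E S)"
    by (rule subset_imp_lepoll)
  then show "small TYPE('u) (points S)"
    using small_Times[OF assms(1) small_nat[OF assms(1)] small_PiE[OF assms(1) small_nat[OF assms(1)] assms(2)]]
    by (rule small_lepoll)
  show "points S \<noteq> {}"
    using assms(3) by (auto simp: points_def intro!: exI[of _ "\<lambda>_. b"])
qed fact

text \<open>An element whose support contains a point would have different images under the replacements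
  of that point by the points of a fresh colour, and these are at least as many as \<open>S\<close>.\<close>

lemma small_action_trivial:
  assumes P: "P \<in> Obj (FinAct (points S))" and small: "\<not> S \<lesssim> Sect P ()"
    and u: "u \<in> Sect P ()" and t: "t \<in> selfmaps (points S)"
  shows "Res P t u = u"
proof -
  interpret finsupp_action "points S" "Sect P ()" "Res P"
    using P by (rule Obj_FinActD)
  have "supp u = {}"
  proof (rule ccontr)
    assume "supp u \<noteq> {}"
    then obtain z where z: "z \<in> supp u" by blast
    \<comment> \<open>Points of a colour absent from the support lie outside it. So replacing
      \<open>z\<close> by such a point is injective on the support, and the new support reveals
      which point was inserted.\<close>
    obtain k where k: "k \<notin> fst ` supp u"
      using ex_new_if_finite[OF infinite_UNIV_nat finite_imageI[OF finite_supp[OF u]]] by blast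
    define y where "y = (\<lambda>v :: 'a. (k, \<lambda>_ :: nat. v))"
    define g where "g = (\<lambda>v. fix_outside {z} (\<lambda>_. y v))"
    have y_new: "y v \<notin> supp u" for v
      using k by (force simp: y_def)
    have g: "g v \<in> selfmaps (points S)" if "v \<in> S" for v
      unfolding g_def using that supp_subset[OF u] z
      by (intro fix_outside_selfmaps) (auto simp: y_def points_def)
    have inj: "inj_on (g v) (supp u)" for v
      unfolding inj_on_def g_def fix_outside_def by (metis y_new singletonD)
    have "inj_on (\<lambda>v. Res P (g v) u) S"
    proof (rule inj_onI)
      fix v w assume v: "v \<in> S" and w: "w \<in> S" and eq: "Res P (g v) u = Res P (g w) u"
      have "g v ` supp u = g w ` supp u"
        using supp_act_inj[OF u g[OF v] inj] supp_act_inj[OF u g[OF w] inj] eq by simp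
      moreover have "y v \<in> g v ` supp u"
        using z by (force simp: g_def)
      ultimately obtain z' where "z' \<in> supp u" "y v = g w z'"
        by auto
      then have "y v = y w"
        using y_new[of v] by (auto simp: g_def fix_outside_def split: if_splits)
      then show "v = w"
        by (auto simp: y_def fun_eq_iff)
    qed
    moreover have "(\<lambda>v. Res P (g v) u) ` S \<subseteq> Sect P ()"
      using act_closed[OF g u] by blast
    ultimately show False
      using small unfolding lepoll_def by blast
  qed
  then show ?thesis
    using supports_fixed[OF supports_supp[OF u] u t] by simp
qed

section \<open>The quotient of the free monoid's topos attached to a set \<open>S\<close>\<close>

locale generating_maps =
  fixes G :: "'g set" and S :: "'u set" and b :: 'u
  assumes G: "infinite G" "countable G" and U: "inaccessible TYPE('u)"
    and S: "small TYPE('u) S" and b: "b \<in> S"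
begin

text \<open>As \<open>G\<close> is infinite and countable, its enumeration exhausts the natural
  numbers, so every basic map is the operation of some generator.\<close>

definition gen :: "'g \<Rightarrow> 'u point \<Rightarrow> 'u point" where
  "gen g = from_nat_into (basic_maps b S) (to_nat_on G g)"

lemma gen_image: "gen ` G = basic_maps b S"
proof -
  have "to_nat_on G ` G = UNIV"
    using bij_betw_imp_surj_on[OF to_nat_on_infinite[OF G(2,1)]] .
  moreover have "basic_maps b S \<noteq> {}"
    by (simp add: basic_maps_def)
  ultimately show ?thesis
    using range_from_nat_into[OF _ countable_basic_maps] unfolding gen_def
    by (metis image_image)
qed

lemma fold_gen_selfmaps: "w \<in> lists G \<Longrightarrow> fold gen w \<in> selfmaps (points S)"
proof (induction w)
  case (Cons g w)
  then have "gen g \<in> selfmaps (points S)" "fold gen w \<in> selfmaps (points S)"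
    using gen_image basic_maps_selfmaps[OF b] by auto
  then show ?case
    unfolding fold.simps by (rule comp_selfmaps)
qed simp

text \<open>The letters of a word act from left to right, so concatenation corresponds to reversed
  composition.\<close>

sublocale restriction "points S" "TYPE('u)" "free_monoid G" "fold gen"
proof (intro restriction.intro small_points_points[OF U S b] restriction_axioms.intro)
  show "Group.monoid (free_monoid G)"
    by unfold_locales (auto simp: free_monoid_def)
qed (auto simp: free_monoid_def fold_gen_selfmaps)

text \<open>For \<open>u\<close> supported by \<open>Z\<close>, a tuple indexed by \<open>Z\<close>
  acts on \<open>u\<close>, and applying \<open>f\<close> afterwards gives a
  \<open>tuple_map\<close>: commuting with the basic maps is what \<open>f\<close> provides. The
  claim is \<open>equivariant\<close> at the identity tuple.\<close>

lemma rigid: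
  assumes P: "P \<in> Obj F" and Q: "Q \<in> Obj F" and f: "f \<in> Hom E (restr P) (restr Q)"
    and t: "t \<in> selfmaps (points S)" and u: "u \<in> Sect P ()"
  shows "app f (Res P t u) = Res Q t (app f u)"
proof -
  interpret P: finsupp_action "points S" "Sect P ()" "Res P"
    using P by (rule Obj_FinActD)
  interpret Q: finsupp_action "points S" "Sect Q ()" "Res Q"
    using Q by (rule Obj_FinActD)
  obtain Z where Z': "Z \<in> Obj (site (points S))" and Zu: "P.supports Z u"
    using ex_site_support[OF P u] by (rule bexE)
  have supp_Z: "finite Z" "Z \<noteq> {}" "Z \<subseteq> points S" "P.supports Z u"
    using Z'[unfolded Obj_site] Zu by simp_all
  have f_in: "app f v \<in> Sect Q ()" if "v \<in> Sect P ()" for v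
    using Hom_Act_props(3)[OF f] that by simp
  have f_basic: "app f (Res P m v) = Res Q m (app f v)" if "m \<in> basic_maps b S" "v \<in> Sect P ()" for m v
  proof -
    have "m \<in> gen ` G"
      using that(1) by (simp only: gen_image)
    then obtain g where g: "g \<in> G" "m = gen g"
      by (elim imageE)
    then have "[g] \<in> carrier (free_monoid G)" "fold gen [g] = m"
      by (simp_all add: free_monoid_def)
    then show ?thesis
      using Hom_Act_props(4)[OF f, of "[g]" v] that(2) f_in by simp
  qed
  define \<Phi> where "\<Phi> = (\<lambda>x. app f (Res P (fix_outside Z x) u))"
  have x: "fix_outside Z x \<in> selfmaps (points S)" if "x ` Z \<subseteq> points S" for x
    using that supp_Z(3) by (rule fix_outside_selfmaps[rotated])
  interpret tuple_map S "Sect Q ()" "Res Q" b Z \<Phi>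
  proof
    show "b \<in> S" by (rule b)
    show "\<Phi> x \<in> Sect Q ()" if "x ` Z \<subseteq> points S" for x
      unfolding \<Phi>_def by (intro f_in P.act_closed x that u)
    show "\<Phi> x = \<Phi> x'" if "\<And>i. i \<in> Z \<Longrightarrow> x i = x' i" for x x'
      unfolding \<Phi>_def using fix_outside_cong[of Z x x'] that by simp
    fix m x assume m: "m \<in> basic_maps b S" and xZ: "x ` Z \<subseteq> points S"
    have mT: "m \<in> selfmaps (points S)"
      using m basic_maps_selfmaps[OF b] by blast
    have mx: "(m \<circ> x) ` Z \<subseteq> points S"
      using selfmaps_image[OF mT xZ] by (simp add: image_comp)
    have "Res P (fix_outside Z (m \<circ> x)) u = Res P (m \<circ> fix_outside Z x) u"
      by (rule P.supportsD[OF supp_Z(4) x[OF mx] comp_selfmaps[OF x[OF xZ] mT]]) simp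
    then show "\<Phi> (m \<circ> x) = Res Q m (\<Phi> x)"
      unfolding \<Phi>_def using f_basic[OF m P.act_closed[OF x[OF xZ] u]] P.act_comp[OF x[OF xZ] mT u] by simp
  qed (rule supp_Z)+
  have "\<Phi> (t \<circ> id) = Res Q t (\<Phi> id)"
    using supp_Z(3) by (intro equivariant t) simp
  moreover have "Res P (fix_outside Z t) u = Res P t u"
    by (rule P.supportsD[OF supp_Z(4) x t]) (use selfmaps_image[OF t supp_Z(3)] in simp_all)
  moreover have "fix_outside Z id = id"
    by (rule fix_outside_id) simp
  ultimately show ?thesis
    by (simp add: \<Phi>_def P.act_id[OF u])
qed

lemma ex_quotient_topos:
  "\<exists>R. quotient_topos E (topos, \<lparr>direct = R, inverse_im = comp_fctr restr_fctr topos.dec\<rparr>)"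
  by (rule quotient_topos_restr[OF fully_faithful_restr[OF rigid]])

text \<open>The witness is the action on single points: the table \<open>(0, [])\<close> paints
  everything with colour \<open>0\<close> and so moves a point of colour \<open>1\<close>.\<close>

lemma ex_nontrivial: "\<exists>P\<in>Obj F. nontrivial_action (free_monoid G) (restr P)"
proof -
  define y :: "'u point" where "y = (1, \<lambda>_. b)"
  have y: "{y} \<subseteq> points S"
    using b by (simp add: y_def points_def)
  let ?m = "fix_outside (points S) (paint (0, []))"
  have "?m \<in> basic_maps b S"
    unfolding basic_maps_def by (rule imageI) blast
  then obtain g where g: "g \<in> G" "gen g = ?m"
    using gen_image by (metis imageE)
  have gT: "gen g \<in> selfmaps (points S)" and gM: "[g] \<in> carrier (free_monoid G)"
    using g(1) gen_image basic_maps_selfmaps[OF b] by (auto simp: free_monoid_def)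
  have e: "tuples_code {y} id \<in> Sect (rep {y}) ()"
    using id_tuples by simp
  have "fix_outside {y} (gen g) y \<noteq> id y"
    using y by (simp add: g(2)) (simp add: y_def recolour_def)
  then have "tuples_code {y} (fix_outside {y} (gen g)) \<noteq> tuples_code {y} id"
    using inv_tuples_code[OF fix_outside_tuples[OF y gT]] inv_tuples_code[OF id_tuples] by metis
  then have "Res (restr (rep {y})) [g] (tuples_code {y} id) \<noteq> tuples_code {y} id"
    using e gM gT Res_rep[OF id_tuples gT] by simp
  moreover have "tuples_code {y} id \<in> Sect (restr (rep {y})) ()"
    using e by simp
  ultimately have "nontrivial_action (free_monoid G) (restr (rep {y}))"
    unfolding nontrivial_action_def using gM by blast
  then show ?thesis
    using rep_FinAct[OF _ y] by blast
qed

text \<open>Up to isomorphism, \<open>inverse_im f'\<close> after \<open>d\<close> is restriction,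
  and isomorphic actions are equally large and nontrivial together. So both claims reduce to
  restricted actions, where \<open>ex_nontrivial\<close> and \<open>small_action_trivial\<close>
  apply.\<close>

lemma not_equivalent:
  assumes q: "quotient_topos E (F', f')"
    and equiv: "equivalent_quotients E (F', f')
      (topos, \<lparr>direct = R, inverse_im = comp_fctr restr_fctr topos.dec\<rparr>)"
  shows "\<exists>x\<in>Obj F'. nontrivial_action (free_monoid G) (FObj (inverse_im f') x)"
    and "x \<in> Obj F' \<Longrightarrow> nontrivial_action (free_monoid G) (FObj (inverse_im f') x) \<Longrightarrow>
      S \<lesssim> Sect (FObj (inverse_im f') x) ()"
proof -
  let ?I = "inverse_im f'" and ?L = "comp_fctr restr_fctr topos.dec"
  obtain e d where ed: "equivalence F' topos e d" and iso: "nat_isomorphic topos E (comp_fctr ?I d) ?L"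
    using equiv by (auto simp: equivalent_quotients_def geom_isomorphic_def comp_geom_def)
  have F': "category F'" and I: "is_functor F' E ?I"
    using q by (auto simp: quotient_topos_def grothendieck_topos_def geometric_morphism_def adjunction_def)
  have e: "is_functor F' topos e" and d: "is_functor topos F' d"
    and de: "nat_isomorphic F' F' (comp_fctr d e) id_fctr"
    using ed by (auto simp: equivalence_def)
  have Id: "\<exists>i\<in>Hom E (FObj ?I (FObj d x)) (FObj ?L x). iso_arr E i" if "x \<in> Obj topos" for x
    using iso that by (auto simp: nat_isomorphic_def dest!: nat_transD)
  obtain P where P: "P \<in> Obj F" "nontrivial_action (free_monoid G) (restr P)"
    using ex_nontrivial by blast
  have x: "topos_obj P \<in> Obj topos"
    using P(1) by simp
  obtain i where i: "i \<in> Hom E (FObj ?I (FObj d (topos_obj P))) (restr P)" "iso_arr E i"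
    using Id[OF x] P(1) by auto
  show "\<exists>x\<in>Obj F'. nontrivial_action (free_monoid G) (FObj ?I x)"
    using iso_action(3)[OF i] P(2) is_functor_Obj[OF d x] by blast
  assume x: "x \<in> Obj F'" and nt: "nontrivial_action (free_monoid G) (FObj ?I x)"
  have ex: "FObj e x \<in> Obj topos"
    using e x by (rule is_functor_Obj)
  \<comment> \<open>The object \<open>x\<close> need not be a value of \<open>d\<close>, but it is
    isomorphic to \<open>FObj d (FObj e x)\<close>.\<close>
  obtain j where j: "j \<in> Hom F' (FObj d (FObj e x)) x" "iso_arr F' j"
    using de x by (fastforce simp: nat_isomorphic_def dest!: nat_transD)
  have Ij: "FArr ?I j \<in> Hom E (FObj ?I (FObj d (FObj e x))) (FObj ?I x)" "iso_arr E (FArr ?I j)"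
    using is_functor_Hom[OF I j(1)] is_functor_iso_arr[OF F' I j] by simp_all
  obtain P where P: "P \<in> Obj F" "FObj e x = topos_obj P"
    using ex by auto
  obtain i where i: "i \<in> Hom E (FObj ?I (FObj d (FObj e x))) (restr P)" "iso_arr E i"
    using Id[OF ex] P by auto
  have "nontrivial_action (free_monoid G) (restr P)"
    using iso_action(3)[OF Ij] iso_action(3)[OF i] nt by blast
  then obtain w u where w: "w \<in> carrier (free_monoid G)" and u: "u \<in> Sect P ()" and "Res P (fold gen w) u \<noteq> u"
    unfolding nontrivial_action_def by auto
  moreover have "fold gen w \<in> selfmaps (points S)"
    using w by (intro fold_gen_selfmaps) (simp add: free_monoid_def)
  ultimately have "S \<lesssim> Sect P ()"
    using small_action_trivial[OF P(1) _ u] by blast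
  also have "Sect P () \<lesssim> Sect (FObj ?I (FObj d (FObj e x))) ()"
    using iso_action(2)[OF i] by simp
  also have "\<dots> \<lesssim> Sect (FObj ?I x) ()"
    using iso_action(1)[OF Ij] .
  finally show "S \<lesssim> Sect (FObj ?I x) ()" .
qed

end

theorem corollary6p19:
  fixes G :: "'g set"
    and E :: "((unit, 'g list, 'u) presheaf, (unit, 'g list, 'u) presheaf_arr) cat"
  assumes "inaccessible TYPE('u)"
    and "infinite G" and "countable G"
    and "E = action_topos (free_monoid G)"
  shows "\<not> (\<exists>Q :: ((unit, 'g list, 'u) presheaf, (unit, 'g list, 'u) presheaf_arr, 'u) quotient set.
           small TYPE('u) Q \<and>
           (\<forall>q\<in>Q. quotient_topos E q) \<and>
           (\<forall>q. quotient_topos E q \<longrightarrow> (\<exists>q'\<in>Q. equivalent_quotients E q' q)))"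
proof (rule notI, elim exE conjE)
  fix Q :: "((unit, 'g list, 'u) presheaf, (unit, 'g list, 'u) presheaf_arr, 'u) quotient set"
  assume Q: "small TYPE('u) Q" and quot: "\<forall>q\<in>Q. quotient_topos E q"
    and all: "\<forall>q. quotient_topos E q \<longrightarrow> (\<exists>q'\<in>Q. equivalent_quotients E q' q)"
  have E: "E = Act (free_monoid G)"
    using assms(4) by (simp add: action_topos_def)
  define nt where "nt = (\<lambda>(q :: ((unit, 'g list, 'u) presheaf, (unit, 'g list, 'u) presheaf_arr, 'u) quotient) x.
    x \<in> Obj (fst q) \<and> nontrivial_action (free_monoid G) (FObj (inverse_im (snd q)) x))"
  \<comment> \<open>One nontrivial action is selected from each listed quotient that has one. The
    estimate in \<open>not_equivalent\<close> holds for all of them, so any choice will do.\<close>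
  define A where "A = (\<lambda>q :: ((unit, 'g list, 'u) presheaf, (unit, 'g list, 'u) presheaf_arr, 'u) quotient.
    Sect (FObj (inverse_im (snd q)) (SOME x. nt q x)) ())"
  \<comment> \<open>A common bound for the sizes of the selected actions; it is small because
    \<open>Q\<close> and the actions are.\<close>
  define W where "W = (\<Union>q\<in>{q \<in> Q. \<exists>x. nt q x}. A q)"
  have small_A: "small TYPE('u) (A q)" if "q \<in> {q \<in> Q. \<exists>x. nt q x}" for q
  proof -
    have "nt q (SOME x. nt q x)"
      using that by (simp add: someI_ex)
    then have "(SOME x. nt q x) \<in> Obj (fst q)"
      by (simp add: nt_def)
    moreover have "is_functor (fst q) E (inverse_im (snd q))"
      using quot that by (auto simp: quotient_topos_def geometric_morphism_def adjunction_def split: prod.splits)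
    ultimately show ?thesis
      unfolding A_def E by (intro Act_small[of _ "free_monoid G"] is_functor_Obj)
  qed
  have "small TYPE('u) {q \<in> Q. \<exists>x. nt q x}"
    using Q by (rule small_subset[rotated]) blast
  then have W: "small TYPE('u) W"
    unfolding W_def using small_A by (intro small_UN[OF assms(1)])
  \<comment> \<open>The power set of \<open>W\<close> exceeds all selected actions in size. It is
    encoded because the entries of points are taken from a subset of \<open>'u\<close>, and the code
    of the empty set serves as base value.\<close>
  define c where "c = (code_of (Pow W) :: 'u set \<Rightarrow> 'u)"
  have c: "inj_on c (Pow W)"
    unfolding c_def by (rule small_inj_on_code_of[OF small_Pow[OF assms(1) W]])
  have S: "small TYPE('u) (c ` Pow W)"
    by (rule small_image[OF small_Pow[OF assms(1) W]])
  interpret generating_maps G "c ` Pow W" "c {}"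
    using assms S by unfold_locales auto
  obtain R where R: "quotient_topos E (topos, \<lparr>direct = R, inverse_im = comp_fctr restr_fctr topos.dec\<rparr>)"
    using ex_quotient_topos unfolding E by blast
  then obtain q where q: "q \<in> Q"
      "equivalent_quotients E q (topos, \<lparr>direct = R, inverse_im = comp_fctr restr_fctr topos.dec\<rparr>)"
    using all by blast
  obtain F' f' where F': "q = (F', f')"
    by (cases q)
  note ne = not_equivalent[OF quot[rule_format, OF q(1), unfolded F' E] q(2)[unfolded F' E]]
  have ex: "\<exists>x. nt q x"
    using ne(1) by (auto simp: nt_def F')
  then have "nt q (SOME x. nt q x)"
    by (rule someI_ex)
  then have "c ` Pow W \<lesssim> A q"
    using ne(2) by (simp add: nt_def F' A_def)
  also have "A q \<subseteq> W"
    unfolding W_def using q(1) ex by blast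
  then have "A q \<lesssim> W"
    by (rule subset_imp_lepoll)
  finally have "c ` Pow W \<lesssim> W" .
  moreover have "Pow W \<lesssim> c ` Pow W"
    using c unfolding lepoll_def by blast
  ultimately have "Pow W \<lesssim> W"
    using lepoll_trans by blast
  then show False
    using lesspoll_Pow_self[of W] by (meson lesspoll_trans2 lesspoll_def eqpoll_refl)
qed

end
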